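(* Suppose that $$\mathbb{E}\log Z\in(-\infty,0)\quad\text{and}\quad \mathbb{E}\,W_1\log^+W_1<\infty,$$ and that the distribution of $\log Z$ is non-arithmetic. If $$\mathbb{E}\,(\log^+Z)^3a(\log^+Z)<\infty\quad\text{and}\quad \mathbb{E}\,W_1(\log^+W_1)^2a(\log^+W_1)<\infty,$$ then the series $\sum_{n=0}^\infty a(n)(W-W_n)$ converges almost surely.
   Context: Let $\mathcal{M}$ be a point process on $\mathbb{R}$ (a random locally finite counting measure) with $\mathcal{M}\{+\infty\}=0$, and let $L:=\mathcal{M}(\mathbb{R})$, which may be deterministic or random, finite or infinite with positive probability. The branching random walk (BRW) generated by $\mathcal{M}$ is the sequence of point processes $\mathcal{M}_n$, $n=0,1,\dots$, with $\mathcal{M}_0(B)=1_{\{0\in B\}}$ and $\mathcal{M}_{n+1}(B)=\sum_r\mathcal{M}_{n,r}(B-A_{n,r})$ for Borel $B\subset\mathbb{R}$, where $\{A_{n,r}\}_r$ are the points of $\mathcal{M}_n$ and $\{\mathcal{M}_{n,r}\}$ are independent copies of $\mathcal{M}$. The BRW is supercritical: if $\mathbb{P}\{L<\infty\}=1$, it is additionally assumed that $\mathbb{E}L>1$. Individuals are the nodes $u$ of the associated family tree; $|u|$ is the generation of $u$, $A_u$ its position (the initial ancestor has generation $0$ and position $0$), so that $\{A_u:|u|=n\}$ are the points of $\mathcal{M}_n$. It is assumed that for some fixed $\gamma>0$, $m(\gamma):=\mathbb{E}\int_{\mathbb{R}}e^{\gamma x}\,\mathcal{M}_1(dx)\in(0,\infty)$.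 Put $Y_u:=e^{\gamma A_u}/m(\gamma)^{|u|}$ and $W_n:=\sum_{|u|=n}Y_u=m(\gamma)^{-n}\int_{\mathbb{R}}e^{\gamma x}\mathcal{M}_n(dx)$, a non-negative martingale with respect to $\mathcal{F}_n=\sigma(\mathcal{M}_1,\dots,\mathcal{M}_n)$. $Z$ is a random variable whose distribution is defined by $\mathbb{E}\,r(Z)=\mathbb{E}\sum_{|u|=1}Y_u\,r(Y_u)$ for all non-negative bounded Borel functions $r$. Under the conditions $\mathbb{E}\log Z\in(-\infty,0)$ and $\mathbb{E}W_1\log^+W_1<\infty$ the martingale $W_n$ is uniformly integrable, and $W$ denotes its almost sure and $L_1$ limit ($\mathbb{E}W=1$). $a:\mathbb{R}^+\to\mathbb{R}^+$ is a function regularly varying at $\infty$ with exponent $\alpha>-1$; if $\alpha=0$ it is additionally assumed that $a$ does not decrease near $\infty$. Here $\log^+x=\max(\log x,0)$ (and $\log^+0=0$). A distribution is non-arithmetic if it is not concentrated on $d\mathbb{Z}$ for any $d>0$. *)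

theory Defs
  imports "HOL-Probability.Probability"
begin

section \<open>Point processes on the real line\<close>

definition counting_measures :: "real measure set" where
  "counting_measures = {\<mu>. sets \<mu> = sets borel \<and>
     (\<forall>B\<in>sets borel. emeasure \<mu> B \<in> range ennreal_of_enat) \<and>
     (\<forall>K. compact K \<longrightarrow> emeasure \<mu> K < \<infinity>)}"

text \<open>The \<sigma>-algebra generated by the evaluations, as in the definition of \<^const>\<open>subprob_algebra\<close>.
  A point process is a random variable with values in this space.\<close>

definition counting_measure_space :: "real measure measure" where
  "counting_measure_space =
     (SUP B\<in>sets borel. vimage_algebra counting_measures (\<lambda>\<mu>. emeasure \<mu> B) borel)"

text \<open>The points of a counting measure are listed with multiplicity, cell by cell: the label
  \<open>(z, k)\<close> stands for the point of rank \<open>k\<close> (counted from \<open>0\<close>, from left to right) in the cell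
  \<open>[z, z + 1)\<close>, which is a point of the measure iff the cell carries more than \<open>k\<close> points.
  Lemma \<open>emeasure_eq_count_points\<close> shows that this enumeration is correct.\<close>

type_synonym label = "int \<times> nat"

definition labels :: "real measure \<Rightarrow> label set" where
  "labels \<mu> = {(z, k). of_nat k < emeasure \<mu> {real_of_int z..<real_of_int z + 1}}"

definition label_point :: "real measure \<Rightarrow> label \<Rightarrow> real" where
  "label_point \<mu> = (\<lambda>(z, k). Inf {x. real_of_int z \<le> x \<and> of_nat k < emeasure \<mu> {real_of_int z..x}})"

lemma space_counting_measure_space: "space counting_measure_space = counting_measures"
  by (auto simp add: counting_measure_space_def space_Sup_eq_UN)

lemma counting_measuresD:
  assumes "\<mu> \<in> counting_measures"
  shows "sets \<mu> = sets borel" "B \<in> sets borel \<Longrightarrow> \<exists>n. emeasure \<mu> B = ennreal_of_enat n"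
    "emeasure \<mu> {a..b} < \<infinity>"
  using assms by (auto simp: counting_measures_def)

lemma label_point_le_iff:
  assumes mu: "\<mu> \<in> counting_measures" and zx: "real_of_int z \<le> x" and k: "(z, k) \<in> labels \<mu>"
  shows "label_point \<mu> (z, k) \<le> x \<longleftrightarrow> of_nat k < emeasure \<mu> {real_of_int z..x}"
proof -
  note D = counting_measuresD[OF mu]
  let ?S = "{x. real_of_int z \<le> x \<and> of_nat k < emeasure \<mu> {real_of_int z..x}}"
  have bdd: "bdd_below ?S" by (rule bdd_belowI[of _ "real_of_int z"]) auto
  have "of_nat k < emeasure \<mu> {real_of_int z..<real_of_int z + 1}" using k by (simp add: labels_def)
  also have "\<dots> \<le> emeasure \<mu> {real_of_int z..real_of_int z + 1}"
    by (rule emeasure_mono) (auto simp: D(1))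
  finally have ne: "?S \<noteq> {}" by (auto intro!: exI[of _ "real_of_int z + 1"])
  show ?thesis
  proof
    assume "of_nat k < emeasure \<mu> {real_of_int z..x}"
    then show "label_point \<mu> (z, k) \<le> x"
      unfolding label_point_def using zx bdd by (auto intro!: cInf_lower)
  next
    assume le: "label_point \<mu> (z, k) \<le> x"
    show "of_nat k < emeasure \<mu> {real_of_int z..x}"
    proof (rule ccontr)
      assume "\<not> of_nat k < emeasure \<mu> {real_of_int z..x}"
      then have Fx: "emeasure \<mu> {real_of_int z..x} \<le> of_nat k" by simp
      let ?A = "\<lambda>n::nat. {real_of_int z..x + 1 / real (Suc n)}"
      have "(INF n. emeasure \<mu> (?A n)) = emeasure \<mu> (\<Inter>n. ?A n)"
      proof (rule INF_emeasure_decseq)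
        show "range ?A \<subseteq> sets \<mu>" by (auto simp: D(1))
        show "decseq ?A"
          by (rule decseq_SucI) (auto intro: order_trans simp: field_simps)
        show "\<And>i. emeasure \<mu> (?A i) \<noteq> \<infinity>" using D(3) by (metis less_irrefl)
      qed
      also have "(\<Inter>n. ?A n) = {real_of_int z..x}"
      proof -
        have "t \<le> x" if "\<forall>n::nat. t \<le> x + 1 / real (Suc n)" for t
        proof (rule field_le_epsilon)
          fix e :: real assume "e > 0"
          then obtain n where "1 / real (Suc n) < e" using nat_approx_posE by metis
          with that[rule_format, of n] show "t \<le> x + e" by linarith
        qed
        moreover have "t \<le> x + 1 / real (Suc n)" if "t \<le> x" for t n
          using that by (simp add: add_increasing2)
        ultimately show ?thesis by auto
      qed
      also have "emeasure \<mu> {real_of_int z..x} < of_nat (Suc k)"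
        using Fx
      proof (rule order_le_less_trans)
        show "of_nat k < (of_nat (Suc k) :: ennreal)"
          by (simp add: ennreal_of_nat_eq_real_of_nat ennreal_less_iff del: of_nat_Suc)
      qed
      finally obtain n where n: "emeasure \<mu> (?A n) < of_nat (Suc k)" by (auto simp: INF_less_iff)
      obtain j where j: "emeasure \<mu> (?A n) = ennreal_of_enat j" using D(2)[of "?A n"] by auto
      have "emeasure \<mu> (?A n) \<le> of_nat k"
        using n unfolding j
        by (cases j) (auto simp: ennreal_of_enat_def ennreal_of_nat_eq_real_of_nat ennreal_less_iff simp del: of_nat_Suc)
      moreover have "emeasure \<mu> {real_of_int z..y} \<le> emeasure \<mu> (?A n)" if "y \<le> x + 1 / real (Suc n)" for y
        using that by (intro emeasure_mono) (auto simp: D(1))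
      ultimately have small: "emeasure \<mu> {real_of_int z..y} \<le> of_nat k" if "y \<le> x + 1 / real (Suc n)" for y
        using that order_trans by blast
      have "x + 1 / real (Suc n) \<le> y" if "y \<in> ?S" for y
      proof (rule ccontr)
        assume "\<not> x + 1 / real (Suc n) \<le> y"
        then have "emeasure \<mu> {real_of_int z..y} \<le> of_nat k" by (intro small) simp
        with that show False by (simp add: leD)
      qed
      then have "x + 1 / real (Suc n) \<le> Inf ?S" using ne by (intro cInf_greatest) auto
      moreover have "1 / real (Suc n) > 0" by simp
      ultimately show False using le unfolding label_point_def prod.case by linarith
    qed
  qed
qed

lemma label_point_in_cell:
  assumes mu: "\<mu> \<in> counting_measures" and k: "(z, k) \<in> labels \<mu>"
  shows "real_of_int z \<le> label_point \<mu> (z, k)" "label_point \<mu> (z, k) < real_of_int z + 1"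
proof -
  note D = counting_measuresD[OF mu]
  let ?A = "\<lambda>n::nat. {real_of_int z..real_of_int z + 1 - 1 / real (Suc n)}"
  have "(SUP n. emeasure \<mu> (?A n)) = emeasure \<mu> (\<Union>n. ?A n)"
  proof (rule SUP_emeasure_incseq)
    show "range ?A \<subseteq> sets \<mu>" by (auto simp: D(1))
    show "incseq ?A"
      by (rule incseq_SucI) (auto intro: order_trans simp: field_simps)
  qed
  also have "(\<Union>n. ?A n) = {real_of_int z..<real_of_int z + 1}"
  proof -
    have "\<exists>n. t \<le> real_of_int z + 1 - 1 / real (Suc n)" if t: "t < real_of_int z + 1" for t
    proof -
      from t have "real_of_int z + 1 - t > 0" by simp
      then obtain n where "1 / real (Suc n) < real_of_int z + 1 - t" using nat_approx_posE by metis
      then show ?thesis by (intro exI[of _ n]) linarith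
    qed
    moreover have "t < real_of_int z + 1" if "t \<le> real_of_int z + 1 - 1 / real (Suc n)" for t n
    proof -
      have "1 / real (Suc n) > 0" by simp
      with that show ?thesis by linarith
    qed
    ultimately show ?thesis by auto
  qed
  finally have "of_nat k < (SUP n. emeasure \<mu> (?A n))" using k by (simp add: labels_def)
  then obtain n where n: "of_nat k < emeasure \<mu> (?A n)" by (auto simp: less_SUP_iff)
  then have ne: "?A n \<noteq> {}" by auto
  then have "real_of_int z \<le> real_of_int z + 1 - 1 / real (Suc n)" by simp
  from label_point_le_iff[OF mu this k] n
  have "label_point \<mu> (z, k) \<le> real_of_int z + 1 - 1 / real (Suc n)" by simp
  moreover have "1 / real (Suc n) > 0" by simp
  ultimately show "label_point \<mu> (z, k) < real_of_int z + 1" by linarith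
  have "{x. real_of_int z \<le> x \<and> of_nat k < emeasure \<mu> {real_of_int z..x}} \<noteq> {}"
    using n ne by (auto intro!: exI[of _ "real_of_int z + 1 - 1 / real (Suc n)"])
  then show "real_of_int z \<le> label_point \<mu> (z, k)"
    unfolding label_point_def by (auto intro!: cInf_greatest)
qed

lemma emeasure_cell_eq_count_points:
  assumes mu: "\<mu> \<in> counting_measures" and B: "B \<in> sets borel"
  shows "emeasure \<mu> (B \<inter> {real_of_int z..<real_of_int z + 1}) =
         emeasure (count_space UNIV) {k. (z, k) \<in> labels \<mu> \<and> label_point \<mu> (z, k) \<in> B}"
proof -
  note D = counting_measuresD[OF mu]
  let ?C = "{real_of_int z..<real_of_int z + 1}"
  have "emeasure \<mu> ?C \<le> emeasure \<mu> {real_of_int z..real_of_int z + 1}"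
    by (rule emeasure_mono) (auto simp: D(1))
  also note D(3)
  finally have fin: "emeasure \<mu> ?C < \<infinity>" .
  obtain c where c: "emeasure \<mu> ?C = of_nat c"
    using D(2)[of ?C] fin by (auto simp: ennreal_of_enat_def split: enat.splits)
  have lab: "(z, k) \<in> labels \<mu> \<longleftrightarrow> k < c" for k by (simp add: labels_def c)
  let ?M = "density \<mu> (indicator ?C)"
  let ?N = "distr (count_space {..<c}) borel (\<lambda>k. label_point \<mu> (z, k))"
  have emM: "emeasure ?M X = emeasure \<mu> (X \<inter> ?C)" if "X \<in> sets borel" for X
  proof -
    have "emeasure ?M X = (\<integral>\<^sup>+ x. indicator ?C x * indicator X x \<partial>\<mu>)"
      using that by (intro emeasure_density) (auto simp: D(1) intro!: borel_measurable_indicator)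
    also have "\<dots> = (\<integral>\<^sup>+ x. indicator (X \<inter> ?C) x \<partial>\<mu>)"
      by (intro nn_integral_cong) (auto split: split_indicator)
    also have "\<dots> = emeasure \<mu> (X \<inter> ?C)"
      using that by (intro nn_integral_indicator) (auto simp: D(1))
    finally show ?thesis .
  qed
  have emN: "emeasure ?N X = of_nat (card {k. k < c \<and> label_point \<mu> (z, k) \<in> X})" if "X \<in> sets borel" for X
  proof -
    have "emeasure ?N X = emeasure (count_space {..<c}) ((\<lambda>k. label_point \<mu> (z, k)) -` X \<inter> {..<c})"
      using that by (simp add: emeasure_distr)
    also have "(\<lambda>k. label_point \<mu> (z, k)) -` X \<inter> {..<c} = {k. k < c \<and> label_point \<mu> (z, k) \<in> X}" by auto
    also have "emeasure (count_space {..<c}) \<dots> = of_nat (card {k. k < c \<and> label_point \<mu> (z, k) \<in> X})"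
      by (subst emeasure_count_space_finite) auto
    finally show ?thesis .
  qed
  have "?M = ?N"
  proof (rule cdf_unique')
    show "finite_borel_measure ?M"
      by (intro finite_borel_measure.intro finite_measureI finite_borel_measure_axioms.intro)
         (use fin in \<open>auto simp: emM D(1) sets_eq_imp_space_eq[OF D(1)]\<close>)
    show "finite_borel_measure ?N"
      by (intro finite_borel_measure.intro finite_measureI finite_borel_measure_axioms.intro)
         (auto simp: emN)
    show "cdf ?M = cdf ?N"
    proof
      fix x :: real
      consider "x < real_of_int z" | "real_of_int z \<le> x" "x < real_of_int z + 1" | "real_of_int z + 1 \<le> x"
        by linarith
      then have "emeasure ?M {..x} = emeasure ?N {..x}"
      proof cases
        case 1
        then have "{..x} \<inter> ?C = {}" by auto
        moreover have "{k. k < c \<and> label_point \<mu> (z, k) \<in> {..x}} = {}"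
          using 1 label_point_in_cell(1)[OF mu] lab by force
        ultimately show ?thesis by (simp add: emM emN)
      next
        case 2
        then have eq: "{..x} \<inter> ?C = {real_of_int z..x}" by auto
        have le: "emeasure \<mu> {real_of_int z..x} \<le> of_nat c"
          unfolding c[symmetric] using 2 by (intro emeasure_mono) (auto simp: D(1))
        obtain j where j: "emeasure \<mu> {real_of_int z..x} = of_nat j"
          using D(2)[of "{real_of_int z..x}"] D(3)[of "real_of_int z" x]
          by (auto simp: ennreal_of_enat_def split: enat.splits)
        have "{k. k < c \<and> label_point \<mu> (z, k) \<in> {..x}} = {..<j}"
          proof (intro set_eqI iffI)
          fix k assume "k \<in> {k. k < c \<and> label_point \<mu> (z, k) \<in> {..x}}"
          then show "k \<in> {..<j}" using label_point_le_iff[OF mu 2(1), of k] lab[of k] j by auto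
        next
          fix k assume "k \<in> {..<j}"
          then have "k < j" by simp
          moreover from this have "k < c" using le j by simp
          ultimately show "k \<in> {k. k < c \<and> label_point \<mu> (z, k) \<in> {..x}}"
            using label_point_le_iff[OF mu 2(1), of k] lab[of k] j by auto
        qed
        then show ?thesis by (simp add: emM emN eq j)
      next
        case 3
        then have "{..x} \<inter> ?C = ?C" by auto
        moreover have "{k. k < c \<and> label_point \<mu> (z, k) \<in> {..x}} = {..<c}"
          using 3 label_point_in_cell(2)[OF mu] lab by force
        ultimately show ?thesis by (simp add: emM emN c)
      qed
      then show "cdf ?M x = cdf ?N x" by (simp add: cdf_def measure_def)
    qed
  qed
  then have "emeasure \<mu> (B \<inter> ?C) = of_nat (card {k. k < c \<and> label_point \<mu> (z, k) \<in> B})"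
    using emM[OF B] emN[OF B] by simp
  also have "\<dots> = emeasure (count_space UNIV) {k. (z, k) \<in> labels \<mu> \<and> label_point \<mu> (z, k) \<in> B}"
    by (subst emeasure_count_space_finite) (auto simp: lab)
  finally show ?thesis .
qed

lemma emeasure_eq_count_points:
  assumes mu: "\<mu> \<in> counting_measures" and B: "B \<in> sets borel"
  shows "emeasure \<mu> B = emeasure (count_space UNIV) {i \<in> labels \<mu>. label_point \<mu> i \<in> B}"
proof -
  note D = counting_measuresD[OF mu]
  let ?C = "\<lambda>z::int. {real_of_int z..<real_of_int z + 1}"
  let ?P = "\<lambda>z. {k. (z, k) \<in> labels \<mu> \<and> label_point \<mu> (z, k) \<in> B}"
  have dis: "disjoint_family ?C"
    unfolding disjoint_family_on_def
  proof (intro ballI impI equals0I)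
    fix m n :: int and x assume "m \<noteq> n" "x \<in> ?C m \<inter> ?C n"
    then have "\<lfloor>x\<rfloor> = m" "\<lfloor>x\<rfloor> = n" by (auto simp: floor_eq_iff)
    with \<open>m \<noteq> n\<close> show False by simp
  qed
  have cov: "(\<Union>z. ?C z) = UNIV"
  proof -
    have "x \<in> ?C \<lfloor>x\<rfloor>" for x by (simp add: floor_correct)
    then show ?thesis by blast
  qed
  have "emeasure \<mu> B = emeasure \<mu> (\<Union>z. B \<inter> ?C z)"
    using cov by (metis Int_UNIV_right Int_UN_distrib)
  also have "\<dots> = (\<integral>\<^sup>+z. emeasure \<mu> (B \<inter> ?C z) \<partial>count_space UNIV)"
    using dis B by (intro emeasure_UN_countable) (auto simp: D(1) disjoint_family_on_def)
  also have "\<dots> = (\<integral>\<^sup>+z. emeasure (count_space UNIV) (Pair z ` ?P z) \<partial>count_space UNIV)"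
  proof (rule nn_integral_cong)
    fix z :: int
    have "inj_on (Pair z) (?P z)" by (simp add: inj_on_def)
    then have "emeasure (count_space UNIV) (Pair z ` ?P z) = emeasure (count_space UNIV) (?P z)"
      by (cases "finite (?P z)") (auto simp: card_image finite_image_iff)
    then show "emeasure \<mu> (B \<inter> ?C z) = emeasure (count_space UNIV) (Pair z ` ?P z)"
      using emeasure_cell_eq_count_points[OF mu B] by simp
  qed
  also have "\<dots> = emeasure (count_space UNIV) (\<Union>z. Pair z ` ?P z)"
    by (intro emeasure_UN_countable[symmetric]) (auto simp: disjoint_family_on_def)
  also have "(\<Union>z. Pair z ` ?P z) = {i \<in> labels \<mu>. label_point \<mu> i \<in> B}" by auto
  finally show ?thesis .
qed


section \<open>Branching random walks\<close>

text \<open>Individuals are finite sequences of labels, youngest label first, so that \<open>i # u\<close> is the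
  child of \<open>u\<close> with label \<open>i\<close> and \<open>length u\<close> is the generation of \<open>u\<close>. The point process \<open>N u\<close>
  gives the displacements of the children of \<open>u\<close> relative to \<open>u\<close>; it plays the role of the copy
  of the generating point process attached to \<open>u\<close>, and \<open>N []\<close> that of the generating point
  process itself. A sequence \<open>u\<close> is a node of the family tree iff \<open>alive N \<omega> u\<close>.\<close>

type_synonym individual = "label list"

primrec alive :: "(individual \<Rightarrow> 'w \<Rightarrow> real measure) \<Rightarrow> 'w \<Rightarrow> individual \<Rightarrow> bool" where
  "alive N \<omega> [] = True"
| "alive N \<omega> (i # u) = (alive N \<omega> u \<and> i \<in> labels (N u \<omega>))"

primrec position :: "(individual \<Rightarrow> 'w \<Rightarrow> real measure) \<Rightarrow> 'w \<Rightarrow> individual \<Rightarrow> real" where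
  "position N \<omega> [] = 0"
| "position N \<omega> (i # u) = position N \<omega> u + label_point (N u \<omega>) i"

definition generation :: "(individual \<Rightarrow> 'w \<Rightarrow> real measure) \<Rightarrow> nat \<Rightarrow> 'w \<Rightarrow> individual set" where
  "generation N n \<omega> = {u. alive N \<omega> u \<and> length u = n}"

text \<open>The point process \<open>\<M>\<^sub>n\<close> of the positions in generation \<open>n\<close>; lemmas \<open>brw_0\<close> and
  \<open>emeasure_brw_Suc\<close> give its recursive description.\<close>

definition brw :: "(individual \<Rightarrow> 'w \<Rightarrow> real measure) \<Rightarrow> nat \<Rightarrow> 'w \<Rightarrow> real measure" where
  "brw N n \<omega> = distr (count_space (generation N n \<omega>)) borel (position N \<omega>)"

locale branching_random_walk = prob_space P
  for P :: "'w measure" and N :: "individual \<Rightarrow> 'w \<Rightarrow> real measure" +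
  assumes indep: "indep_vars (\<lambda>_. counting_measure_space) N UNIV"
    and ident: "\<And>u. distr P counting_measure_space (N u) = distr P counting_measure_space (N [])"
    and supercritical: "AE \<omega> in P. emeasure (N [] \<omega>) UNIV < \<infinity> \<Longrightarrow>
      1 < (\<integral>\<^sup>+\<omega>. emeasure (N [] \<omega>) UNIV \<partial>P)"

lemma emeasure_brw:
  assumes "B \<in> sets borel"
  shows "emeasure (brw N n \<omega>) B =
    emeasure (count_space UNIV) {u \<in> generation N n \<omega>. position N \<omega> u \<in> B}"
proof -
  have "emeasure (brw N n \<omega>) B =
    emeasure (count_space (generation N n \<omega>)) {u \<in> generation N n \<omega>. position N \<omega> u \<in> B}"
    using assms by (auto simp: brw_def emeasure_distr intro!: arg_cong2[where f = emeasure])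
  then show ?thesis by (simp add: emeasure_count_space)
qed

lemma generation_0: "generation N 0 \<omega> = {[]}"
  by (auto simp: generation_def)

lemma brw_0: "brw N 0 \<omega> = return borel 0"
proof (rule measure_eqI)
  fix B assume "B \<in> sets (brw N 0 \<omega>)"
  then have B: "B \<in> sets borel" by (simp add: brw_def)
  have "{u \<in> generation N 0 \<omega>. position N \<omega> u \<in> B} = (if 0 \<in> B then {[]} else {})"
    by (auto simp: generation_0)
  then show "emeasure (brw N 0 \<omega>) B = emeasure (return borel 0) B"
    using B by (simp add: emeasure_brw)
qed (simp add: brw_def)

lemma emeasure_brw_Suc:
  assumes N: "\<And>u. N u \<omega> \<in> counting_measures" and B: "B \<in> sets borel"
  shows "emeasure (brw N (Suc n) \<omega>) B =
    (\<integral>\<^sup>+u. emeasure (N u \<omega>) {x. position N \<omega> u + x \<in> B} \<partial>count_space (generation N n \<omega>))"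
proof -
  let ?C = "\<lambda>u. {i \<in> labels (N u \<omega>). label_point (N u \<omega>) i \<in> {x. position N \<omega> u + x \<in> B}}"
  have "{u \<in> generation N (Suc n) \<omega>. position N \<omega> u \<in> B} =
    (\<Union>u\<in>generation N n \<omega>. (\<lambda>i. i # u) ` ?C u)"
    by (auto simp: generation_def length_Suc_conv)
  then have "emeasure (brw N (Suc n) \<omega>) B =
    emeasure (count_space UNIV) (\<Union>u\<in>generation N n \<omega>. (\<lambda>i. i # u) ` ?C u)"
    using B by (simp add: emeasure_brw)
  also have "\<dots> = (\<integral>\<^sup>+u. emeasure (count_space UNIV) ((\<lambda>i. i # u) ` ?C u)
      \<partial>count_space (generation N n \<omega>))"
    by (intro emeasure_UN_countable) (auto simp: disjoint_family_on_def)
  also have "\<dots> = (\<integral>\<^sup>+u. emeasure (N u \<omega>) {x. position N \<omega> u + x \<in> B}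
      \<partial>count_space (generation N n \<omega>))"
  proof (rule nn_integral_cong)
    fix u
    have "inj_on (\<lambda>i. i # u) (?C u)" by (simp add: inj_on_def)
    then have "emeasure (count_space UNIV) ((\<lambda>i. i # u) ` ?C u) = emeasure (count_space UNIV) (?C u)"
      by (cases "finite (?C u)") (auto simp: card_image finite_image_iff)
    also have "{x. position N \<omega> u + x \<in> B} \<in> sets borel"
    proof -
      have "(\<lambda>x. position N \<omega> u + x) \<in> borel_measurable borel" by simp
      from measurable_sets[OF this B] show ?thesis by (simp add: vimage_def)
    qed
    then have "emeasure (count_space UNIV) (?C u) = emeasure (N u \<omega>) {x. position N \<omega> u + x \<in> B}"
      using emeasure_eq_count_points[OF N] by simp
    finally show "emeasure (count_space UNIV) ((\<lambda>i. i # u) ` ?C u) =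
      emeasure (N u \<omega>) {x. position N \<omega> u + x \<in> B}" .
  qed
  finally show ?thesis .
qed

lemma brw_1:
  assumes "\<And>u. N u \<omega> \<in> counting_measures"
  shows "brw N 1 \<omega> = N [] \<omega>"
proof (rule measure_eqI)
  show "sets (brw N 1 \<omega>) = sets (N [] \<omega>)"
    using counting_measuresD(1)[OF assms] by (simp add: brw_def)
  fix B assume "B \<in> sets (brw N 1 \<omega>)"
  then have "B \<in> sets borel" by (simp add: brw_def)
  from emeasure_brw_Suc[of N \<omega>, OF assms this, of 0] show "emeasure (brw N 1 \<omega>) B = emeasure (N [] \<omega>) B"
    by (simp add: generation_0 nn_integral_count_space_finite)
qed

definition brw_moment :: "'w measure \<Rightarrow> (individual \<Rightarrow> 'w \<Rightarrow> real measure) \<Rightarrow> real \<Rightarrow> ennreal" where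
  "brw_moment P N \<gamma> = (\<integral>\<^sup>+\<omega>. (\<integral>\<^sup>+x. ennreal (exp (\<gamma> * x)) \<partial>brw N 1 \<omega>) \<partial>P)"

definition brw_Y :: "'w measure \<Rightarrow> (individual \<Rightarrow> 'w \<Rightarrow> real measure) \<Rightarrow> real \<Rightarrow> individual \<Rightarrow> 'w \<Rightarrow> real" where
  "brw_Y P N \<gamma> u \<omega> = exp (\<gamma> * position N \<omega> u) / enn2real (brw_moment P N \<gamma>) ^ length u"

text \<open>If \<open>0 < brw_moment P N \<gamma> < \<infinity>\<close>, the sum is almost surely finite, because its expectation is \<open>1\<close>.
  On the exceptional null set \<^const>\<open>infsum\<close> returns \<open>0\<close>.\<close>

definition brw_W :: "'w measure \<Rightarrow> (individual \<Rightarrow> 'w \<Rightarrow> real measure) \<Rightarrow> real \<Rightarrow> nat \<Rightarrow> 'w \<Rightarrow> real" where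
  "brw_W P N \<gamma> n \<omega> = (\<Sum>\<^sub>\<infinity>u\<in>generation N n \<omega>. brw_Y P N \<gamma> u \<omega>)"


section \<open>Notions from analysis\<close>

text \<open>Only the values on \<open>[0, \<infinity>)\<close> are used, and \<open>ln 0 = 0\<close> in HOL, so \<open>ln_plus 0 = 0\<close>.\<close>

definition ln_plus :: "real \<Rightarrow> real" where
  "ln_plus x = max (ln x) 0"

definition regularly_varying :: "(real \<Rightarrow> real) \<Rightarrow> real \<Rightarrow> bool" where
  "regularly_varying a \<alpha> \<longleftrightarrow>
     a \<in> borel_measurable (restrict_space borel {0..}) \<and>
     (\<forall>\<^sub>F x in at_top. 0 < a x) \<and>
     (\<forall>t>0. ((\<lambda>x. a (t * x) / a x) \<longlongrightarrow> t powr \<alpha>) at_top)"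

definition non_arithmetic :: "real measure \<Rightarrow> bool" where
  "non_arithmetic \<nu> \<longleftrightarrow> (\<forall>d>0. \<not> (AE x in \<nu>. \<exists>k::int. x = d * of_int k))"

end

theory Submission
  imports Defs
begin

text \<open>By Abel summation it suffices that \<open>\<Sum> A(n) \<bar>W\<^bsub>n+1\<^esub> - W\<^sub>n\<bar>\<close> converges almost surely, where
  \<open>A(n) = a(0) + \<dots> + a(n)\<close>; it even has finite expectation. The increment \<open>W\<^bsub>n+1\<^esub> - W\<^sub>n\<close> is the sum
  of \<open>Y\<^sub>u (U\<^sub>u - 1)\<close> over \<open>\<bar>u\<bar> = n\<close>, where the \<open>U\<^sub>u\<close> are copies of \<open>W\<^sub>1\<close> independent of generation \<open>n\<close>.
  Truncate at \<open>Y\<^sub>u U\<^sub>u \<le> \<delta>\<^sup>2\<close> with \<open>\<delta> = e\<^bsup>-\<beta>n\<^esup>\<close>: the centred truncated terms are orthogonal, so their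
  sum has \<open>L\<^sub>1\<close> norm \<open>O(\<delta>)\<close>. By the many-to-one formula the remaining terms contribute
  \<open>E[W\<^sub>1; S\<^sub>n + ln W\<^sub>1 > -2\<beta>n]\<close>, where \<open>S\<^sub>n\<close> is a random walk with steps \<open>ln Z\<close> independent of \<open>W\<^sub>1\<close>.
  As the drift is negative, this is at most \<open>E[W\<^sub>1; ln W\<^sub>1 > \<beta>n] + P(S\<^sub>n > -3\<beta>n)\<close>, and a Fuk-Nagaev
  type bound for the walk together with \<open>A(n) = O(n a(n))\<close> turns the moment assumptions into
  summability.\<close>

section \<open>Regularly varying functions\<close>

text \<open>The moment assumptions are logarithmic, so W_1 may have no moment of order above 1.
  Working with E|W_{n+1} - W_n| copes with this: the truncation level is exponentially small in n,
  yet on the logarithmic scale it only moves the barrier by 2 \<beta> n, which the negative drift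
  absorbs. The powers 3 and 2 arise when tails are summed against A(n). The walk contributes n P(ln
  Z > n / K), the factor n counting the steps that may be large; the sum is of order E (ln+ Z)^2 A(K
  ln+ Z), hence of E (ln+ Z)^3 a(ln+ Z). The tail of W_1 has no such factor, and its sum is governed
  by E W_1 ln+ W_1 A(K ln+ W_1), hence by the square. Regular variation is exploited through two
  consequences for large x: a is constant on [x, 2 x] up to a bounded factor, and a(2 x) / a(x)
  stays above a number exceeding 1/2. They give A(K x) = O(x a(x)) and polynomial growth of A; the
  latter lets a decay n^-p with p at choice absorb the error term of the walk estimate.\<close>

lemma large_uniformity_set:
  fixes h :: "real \<Rightarrow> real" and s :: "nat \<Rightarrow> real"
  assumes [measurable]: "h \<in> borel_measurable borel"
    and lim: "\<And>u. ((\<lambda>t. h (t + u) - h t) \<longlongrightarrow> \<alpha> * u) at_top"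
    and s: "filterlim s at_top sequentially"
  shows "\<exists>n. \<forall>k\<ge>n. measure lborel {v\<in>{0..2}. \<forall>m\<ge>k. \<bar>h (s m + v) - h (s m)\<bar> \<le> 2 * \<bar>\<alpha>\<bar> + 1} > 3 / 2"
proof -
  \<comment> \<open>The sets increase to all of [0, 2]: for fixed v the differences tend to \<alpha>
    * v, at most 2 * \<bar>\<alpha>\<bar> in size, and the 1 absorbs the error. Continuity from
    below then gives measures above 3/2, half the length of the interval [0, 3] in which two such
    sets are later made to meet.\<close>
  define U where "U k = {v\<in>{0..2::real}. \<forall>m\<ge>k. \<bar>h (s m + v) - h (s m)\<bar> \<le> 2 * \<bar>\<alpha>\<bar> + 1}" for k :: nat
  have meas [measurable]: "U k \<in> sets borel" for k
    unfolding U_def by measurable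
  have inc: "incseq U"
    by (auto simp: incseq_def U_def)
  have un: "(\<Union>k. U k) = {0..2}"
  proof -
    have "\<exists>k. v \<in> U k" if v: "v \<in> {0..2}" for v
    proof -
      have "(\<lambda>m. h (s m + v) - h (s m)) \<longlonglongrightarrow> \<alpha> * v"
        by (rule filterlim_compose[OF lim s])
      then have "\<forall>\<^sub>F m in sequentially. dist (h (s m + v) - h (s m)) (\<alpha> * v) < 1"
        by (rule tendstoD) simp
      then obtain k where k: "\<And>m. m \<ge> k \<Longrightarrow> \<bar>h (s m + v) - h (s m) - \<alpha> * v\<bar> < 1"
        by (auto simp: eventually_sequentially dist_real_def)
      have "\<bar>\<alpha> * v\<bar> \<le> \<bar>\<alpha>\<bar> * 2"
        unfolding abs_mult using v by (intro mult_left_mono) auto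
      then have "\<bar>h (s m + v) - h (s m)\<bar> \<le> 2 * \<bar>\<alpha>\<bar> + 1" if "m \<ge> k" for m
        using k[OF that] by linarith
      then show ?thesis using v by (auto simp: U_def)
    qed
    then show ?thesis by (auto simp: U_def)
  qed
  have fm: "U k \<in> fmeasurable lborel" for k
    by (rule fmeasurableI2[OF fmeasurableI[of "{0..2}"]]) (use meas[of k] in \<open>auto simp: U_def\<close>)
  then have e: "emeasure lborel (U k) = ennreal (measure lborel (U k))" for k
    by (intro emeasure_eq_ennreal_measure) (auto simp: fmeasurable_def less_top)
  have "(\<lambda>k. emeasure lborel (U k)) \<longlonglongrightarrow> emeasure lborel (\<Union>k. U k)"
    using inc by (intro Lim_emeasure_incseq) auto
  then have "(\<lambda>k. ennreal (measure lborel (U k))) \<longlonglongrightarrow> ennreal 2"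
    by (simp add: un e)
  then have "(\<lambda>k. measure lborel (U k)) \<longlonglongrightarrow> 2"
    by (subst (asm) tendsto_ennreal_iff) auto
  then have "\<forall>\<^sub>F k in sequentially. measure lborel (U k) > 3 / 2"
    by (rule order_tendstoD) simp
  then show ?thesis
    by (auto simp: eventually_sequentially U_def)
qed

text \<open>Both \<open>x\<close> and \<open>x + u\<close> are compared with a common third point \<open>x + v\<close>; one exists because
  the sets of good \<open>v\<close> fill more than half of an interval.\<close>

lemma additive_limit_locally_bounded:
  fixes h :: "real \<Rightarrow> real"
  assumes h [measurable]: "h \<in> borel_measurable borel"
    and lim: "\<And>u. ((\<lambda>t. h (t + u) - h t) \<longlongrightarrow> \<alpha> * u) at_top"
  shows "\<exists>T. \<forall>t\<ge>T. \<forall>u\<in>{0..1}. \<bar>h (t + u) - h t\<bar> \<le> 4 * \<bar>\<alpha>\<bar> + 2"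
proof (rule ccontr)
  assume "\<not> ?thesis"
  then have "\<forall>n::nat. \<exists>t u. t \<ge> real n \<and> u \<in> {0..1} \<and> \<bar>h (t + u) - h t\<bar> > 4 * \<bar>\<alpha>\<bar> + 2"
    by (metis not_le)
  then obtain t u where t: "\<And>n. t n \<ge> real n" and u: "\<And>n. u n \<in> {0..1}"
    and bad: "\<And>n. \<bar>h (t n + u n) - h (t n)\<bar> > 4 * \<bar>\<alpha>\<bar> + 2"
    by metis
  have lt: "filterlim t at_top sequentially"
    by (rule filterlim_at_top_mono[OF filterlim_real_sequentially]) (simp add: t)
  have ltu: "filterlim (\<lambda>n. t n + u n) at_top sequentially"
  proof (rule filterlim_at_top_mono[OF filterlim_real_sequentially], rule always_eventually, rule allI)
    show "real n \<le> t n + u n" for n using t[of n] u[of n] by auto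
  qed
  obtain n1 where n1: "\<And>k. k \<ge> n1 \<Longrightarrow>
      measure lborel {v\<in>{0..2}. \<forall>m\<ge>k. \<bar>h (t m + v) - h (t m)\<bar> \<le> 2 * \<bar>\<alpha>\<bar> + 1} > 3 / 2"
    using large_uniformity_set[OF h lim lt] by blast
  obtain n2 where n2: "\<And>k. k \<ge> n2 \<Longrightarrow>
      measure lborel {v\<in>{0..2}. \<forall>m\<ge>k. \<bar>h (t m + u m + v) - h (t m + u m)\<bar> \<le> 2 * \<bar>\<alpha>\<bar> + 1} > 3 / 2"
    using large_uniformity_set[OF h lim ltu] by blast
  define k where "k = max n1 n2"
  define A where "A = {v\<in>{0..2}. \<forall>m\<ge>k. \<bar>h (t m + v) - h (t m)\<bar> \<le> 2 * \<bar>\<alpha>\<bar> + 1}"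
  define V where "V = {v\<in>{0..2}. \<forall>m\<ge>k. \<bar>h (t m + u m + v) - h (t m + u m)\<bar> \<le> 2 * \<bar>\<alpha>\<bar> + 1}"
  \<comment> \<open>\<open>V\<close> as seen from \<open>t k\<close> rather than from
    \<open>t k + u k\<close>. The shift by at most 1 keeps it inside [0, 3], so \<open>A\<close> and
    \<open>V'\<close> cannot be disjoint.\<close>
  define V' where "V' = (+) (- u k) -` V"
  have [measurable]: "A \<in> sets borel" "V \<in> sets borel"
    unfolding A_def V_def by measurable
  have [measurable]: "V' \<in> sets borel"
  proof -
    have "(+) (- u k) -` V \<inter> space borel \<in> sets borel" by measurable
    then show ?thesis by (simp add: V'_def)
  qed
  have "emeasure lborel V = emeasure (distr lborel borel ((+) (- u k))) V"
    by (simp only: lborel_distr_plus)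
  also have "\<dots> = emeasure lborel V'"
    by (subst emeasure_distr) (auto simp: V'_def)
  finally have mV: "measure lborel V = measure lborel V'" by (simp add: measure_def)
  have sub: "A \<subseteq> {0..3}" "V' \<subseteq> {0..3}"
    using u[of k] by (auto simp: A_def V'_def V_def)
  have c: "{0..3::real} \<in> fmeasurable lborel" by (intro fmeasurableI) auto
  have fm: "A \<in> fmeasurable lborel" "V' \<in> fmeasurable lborel"
    by (rule fmeasurableI2[OF c sub(1)], simp) (rule fmeasurableI2[OF c sub(2)], simp)
  have "A \<inter> V' \<noteq> {}"
  proof
    assume "A \<inter> V' = {}"
    then have "measure lborel (A \<union> V') = measure lborel A + measure lborel V'"
      using fm by (intro measure_Union) (auto simp: fmeasurable_def less_top)
    moreover have "measure lborel (A \<union> V') \<le> measure lborel {0..3::real}"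
      using sub fm c by (intro measure_mono_fmeasurable) auto
    moreover have "measure lborel A > 3 / 2" "measure lborel V > 3 / 2"
      using n1[of k] n2[of k] by (auto simp: A_def V_def k_def)
    ultimately show False using mV by simp
  qed
  then obtain w where "w \<in> A" "w - u k \<in> V" by (auto simp: V'_def)
  then have "\<bar>h (t k + w) - h (t k)\<bar> \<le> 2 * \<bar>\<alpha>\<bar> + 1"
    "\<bar>h (t k + u k + (w - u k)) - h (t k + u k)\<bar> \<le> 2 * \<bar>\<alpha>\<bar> + 1"
    by (auto simp: A_def V_def)
  then have "\<bar>h (t k + w) - h (t k)\<bar> \<le> 2 * \<bar>\<alpha>\<bar> + 1" "\<bar>h (t k + w) - h (t k + u k)\<bar> \<le> 2 * \<bar>\<alpha>\<bar> + 1"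
    by (auto simp: algebra_simps)
  with bad[of k] show False by linarith
qed

text \<open>The limits for single ratios are upgraded to a bound uniform over the ratios in [1, 2],
  in the manner of the uniform convergence theorem. In logarithmic coordinates these ratios become
  shifts in [0, ln 2], a part of [0, 1], so \<open>additive_limit_locally_bounded\<close> applies to
  ln (a (exp t)).\<close>

lemma regularly_varying_locally_bounded:
  assumes "regularly_varying a \<alpha>"
  obtains C x0 where "C \<ge> 1" "x0 \<ge> 1" "\<And>x. x \<ge> x0 \<Longrightarrow> 0 < a x"
    "\<And>x l. x \<ge> x0 \<Longrightarrow> 1 \<le> l \<Longrightarrow> l \<le> 2 \<Longrightarrow> a (l * x) \<le> C * a x"
    "\<And>x l. x \<ge> x0 \<Longrightarrow> 1 \<le> l \<Longrightarrow> l \<le> 2 \<Longrightarrow> a x \<le> C * a (l * x)"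
proof -
  note rv = assms[unfolded regularly_varying_def]
  define h where "h t = ln (a (exp t))" for t :: real
  have [measurable]: "h \<in> borel_measurable borel"
  proof -
    have "exp \<in> borel \<rightarrow>\<^sub>M restrict_space borel {0::real..}"
      by (rule measurable_restrict_space2) auto
    then have "(\<lambda>t. a (exp t)) \<in> borel_measurable borel"
      using rv by (auto intro: measurable_compose)
    then show ?thesis unfolding h_def by measurable
  qed
  obtain x1 where x1: "\<And>x. x \<ge> x1 \<Longrightarrow> 0 < a x"
    using rv by (auto simp: eventually_at_top_linorder)
  have lim: "((\<lambda>t. h (t + u) - h t) \<longlongrightarrow> \<alpha> * u) at_top" for u
  proof -
    have "((\<lambda>x. a (exp u * x) / a x) \<longlongrightarrow> exp u powr \<alpha>) at_top" using rv by simp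
    from filterlim_compose[OF this exp_at_top]
    have "((\<lambda>t. ln (a (exp u * exp t) / a (exp t))) \<longlongrightarrow> ln (exp u powr \<alpha>)) at_top"
      by (intro tendsto_ln) auto
    moreover have "\<forall>\<^sub>F t in at_top. ln (a (exp u * exp t) / a (exp t)) = h (t + u) - h t"
    proof (rule eventually_mono)
      have "\<forall>\<^sub>F t in at_top. x1 \<le> exp t"
        using exp_at_top by (simp add: filterlim_at_top)
      moreover have "filterlim (\<lambda>t. exp (t + u)) at_top at_top"
        using filterlim_compose[OF exp_at_top filterlim_tendsto_add_at_top[OF tendsto_const filterlim_ident, of u]]
        by (simp add: add.commute)
      then have "\<forall>\<^sub>F t in at_top. x1 \<le> exp (t + u)"
        by (simp add: filterlim_at_top)
      ultimately show "\<forall>\<^sub>F t in at_top. x1 \<le> exp t \<and> x1 \<le> exp (t + u)"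
        by (rule eventually_conj)
      show "ln (a (exp u * exp t) / a (exp t)) = h (t + u) - h t" if "x1 \<le> exp t \<and> x1 \<le> exp (t + u)" for t
        using x1[of "exp t"] x1[of "exp (t + u)"] that
        by (simp add: h_def exp_add ln_div mult.commute)
    qed
    ultimately have "((\<lambda>t. h (t + u) - h t) \<longlongrightarrow> ln (exp u powr \<alpha>)) at_top"
      by (simp add: filterlim_cong)
    then show ?thesis by (simp add: ln_powr)
  qed
  obtain T where T: "\<And>t u. t \<ge> T \<Longrightarrow> u \<in> {0..1} \<Longrightarrow> \<bar>h (t + u) - h t\<bar> \<le> 4 * \<bar>\<alpha>\<bar> + 2"
    using additive_limit_locally_bounded[OF \<open>h \<in> borel_measurable borel\<close> lim] by blast
  define C where "C = exp (4 * \<bar>\<alpha>\<bar> + 2)"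
  define x0 where "x0 = max 1 (max x1 (exp T))"
  have key: "a (l * x) \<le> C * a x \<and> a x \<le> C * a (l * x)" if x: "x \<ge> x0" and l: "1 \<le> l" "l \<le> 2" for x l
  proof -
    have pos: "x > 0" "l > 0" using x l by (auto simp: x0_def)
    have "1 * x \<le> l * x" using l pos by (intro mult_right_mono) auto
    then have lx: "x \<le> l * x" by simp
    have "x1 \<le> x" using x by (simp add: x0_def)
    then have a: "0 < a x" "0 < a (l * x)" using x1 order_trans[OF _ lx] by auto
    have "ln l \<le> 1" using ln_le_minus_one[of l] l by simp
    moreover have "exp T \<le> x" using x by (simp add: x0_def)
    then have "T \<le> ln x" using pos by (simp add: ln_ge_iff)
    ultimately have "\<bar>h (ln x + ln l) - h (ln x)\<bar> \<le> 4 * \<bar>\<alpha>\<bar> + 2"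
      using l by (intro T) auto
    then have "\<bar>ln (a (l * x)) - ln (a x)\<bar> \<le> 4 * \<bar>\<alpha>\<bar> + 2"
      using pos by (simp add: h_def exp_add mult.commute)
    then have "ln (a (l * x)) \<le> ln (C * a x)" "ln (a x) \<le> ln (C * a (l * x))"
      using a by (auto simp: C_def ln_mult)
    then show ?thesis using a by (simp add: C_def)
  qed
  show thesis
  proof (rule that)
    show "C \<ge> 1" by (simp add: C_def)
    show "x0 \<ge> 1" by (simp add: x0_def)
    show "0 < a x" if "x \<ge> x0" for x using that x1 by (simp add: x0_def)
  qed (use key in auto)
qed

section \<open>Growth of the partial sums of a regularly varying function\<close>

lemma dyadic_induct [consumes 2, case_names base double]:
  fixes x x0 :: real
  assumes "x0 \<le> x" and "0 < x0"
    and base: "\<And>x. x0 \<le> x \<Longrightarrow> x \<le> 2 * x0 \<Longrightarrow> R x"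
    and step: "\<And>x. x0 \<le> x \<Longrightarrow> R x \<Longrightarrow> R (2 * x)"
  shows "R x"
proof -
  obtain n where "x / x0 < 2 ^ n" using real_arch_pow[of 2 "x / x0"] by auto
  then have "x \<le> 2 ^ n * x0" using \<open>0 < x0\<close> by (simp add: field_simps)
  then show ?thesis using \<open>x0 \<le> x\<close>
  proof (induction n arbitrary: x)
    case 0
    then show ?case using base[of x] \<open>0 < x0\<close> by simp
  next
    case (Suc n)
    show ?case
    proof (cases "x \<le> 2 * x0")
      case True
      then show ?thesis using base Suc by simp
    next
      case False
      then have "R (x / 2)" using Suc by (intro Suc.IH) auto
      with step[of "x / 2"] False show ?thesis by simp
    qed
  qed
qed

text \<open>A as a function of a real argument that is monotone for nonnegative a;
  \<open>nat\<close> sends negative arguments to the index 0. The leading 1 keeps it away from 0, so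
  a finite moment weighted with it is also finite without the weight.\<close>

definition partial_sum :: "(real \<Rightarrow> real) \<Rightarrow> real \<Rightarrow> real" where
  "partial_sum a x = 1 + (\<Sum>k\<le>nat \<lfloor>x\<rfloor>. a (real k))"

lemma partial_sum_mono:
  assumes "\<And>x. 0 \<le> x \<Longrightarrow> 0 \<le> a x" and "x \<le> y"
  shows "partial_sum a x \<le> partial_sum a y"
proof -
  have "nat \<lfloor>x\<rfloor> \<le> nat \<lfloor>y\<rfloor>" using assms(2) by (simp add: floor_mono nat_mono)
  then show ?thesis unfolding partial_sum_def using assms(1) by (intro add_left_mono sum_mono2) auto
qed

lemma partial_sum_ge_1:
  assumes "\<And>x. 0 \<le> x \<Longrightarrow> 0 \<le> a x"
  shows "1 \<le> partial_sum a x"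
  using assms by (simp add: partial_sum_def sum_nonneg)

text \<open>With \<open>g x = x a(x)\<close>, the dyadic block sums are dominated by \<open>g\<close>, which grows at least
  geometrically along dyadic points because \<open>\<alpha> > -1\<close>.\<close>

lemma partial_sum_bounds:
  assumes nonneg: "\<And>x. 0 \<le> x \<Longrightarrow> 0 \<le> a x" and rv: "regularly_varying a \<alpha>" and alpha: "-1 < \<alpha>"
  obtains x0 where "x0 \<ge> 1"
    "\<And>K. K \<ge> 1 \<Longrightarrow> \<exists>C. \<forall>x\<ge>x0. partial_sum a (K * x) \<le> C * (x * a x)"
    "\<exists>C p. \<forall>x\<ge>x0. partial_sum a x \<le> C * x ^ p"
proof -
  obtain C x1 where C: "C \<ge> 1" and x1: "x1 \<ge> 1" and pos: "\<And>x. x \<ge> x1 \<Longrightarrow> 0 < a x"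
    and up: "\<And>x l. x \<ge> x1 \<Longrightarrow> 1 \<le> l \<Longrightarrow> l \<le> 2 \<Longrightarrow> a (l * x) \<le> C * a x"
    and low: "\<And>x l. x \<ge> x1 \<Longrightarrow> 1 \<le> l \<Longrightarrow> l \<le> 2 \<Longrightarrow> a x \<le> C * a (l * x)"
    using regularly_varying_locally_bounded[OF rv] by metis
  \<comment> \<open>The midpoint between 1/2 and 2 powr \<alpha>. Since 2 q > 1, doubling a large x
    multiplies \<open>g x\<close> by at least a fixed factor above 1.\<close>
  define q :: real where "q = (1 / 2 + 2 powr \<alpha>) / 2"
  have "(2::real) powr (-1) < 2 powr \<alpha>" using alpha by (intro powr_less_mono) auto
  then have q: "1 / 2 < q" "q < 2 powr \<alpha>" by (auto simp: q_def powr_minus)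
  have "((\<lambda>x. a (2 * x) / a x) \<longlongrightarrow> 2 powr \<alpha>) at_top"
    using rv by (auto simp: regularly_varying_def)
  then have "\<forall>\<^sub>F x in at_top. a (2 * x) / a x > q" using q by (intro order_tendstoD)
  then obtain x2 where x2: "\<And>x. x \<ge> x2 \<Longrightarrow> a (2 * x) / a x > q"
    by (auto simp: eventually_at_top_linorder)
  define x0 where "x0 = max x1 x2"
  have x0: "x0 \<ge> 1" "x0 \<ge> x1" "x0 \<ge> x2" using x1 by (auto simp: x0_def)
  then have "0 < x0" by simp
  define g where "g x = x * a x" for x
  have gpos: "0 < g x" if "x \<ge> x0" for x using that pos[of x] x0 by (simp add: g_def)
  have g2: "2 * q * g x \<le> g (2 * x)" if "x \<ge> x0" for x
  proof -
    have "a x > 0" using pos that x0 by simp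
    then have "q * a x \<le> a (2 * x)" using x2[of x] that x0 by (simp add: field_simps)
    then have "2 * x * (q * a x) \<le> 2 * x * a (2 * x)" using that x0 by (intro mult_left_mono) auto
    then show ?thesis by (simp add: g_def algebra_simps)
  qed
  have g2u: "g (2 * x) \<le> 2 * C * g x" if "x \<ge> x0" for x
    using up[of x 2] that x0 by (simp add: g_def mult_left_mono algebra_simps)
  let ?B = "partial_sum a"
  have block: "?B (2 * x) \<le> ?B x + 2 * C * g x" if x: "x \<ge> x0" for x
  proof -
    have "nat \<lfloor>x\<rfloor> \<le> nat \<lfloor>2 * x\<rfloor>" using x x0 by (intro nat_mono floor_mono) auto
    then have eq: "{..nat \<lfloor>2 * x\<rfloor>} = {..nat \<lfloor>x\<rfloor>} \<union> {nat \<lfloor>x\<rfloor> <.. nat \<lfloor>2 * x\<rfloor>}" by auto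
    have "?B (2 * x) = ?B x + (\<Sum>k\<in>{nat \<lfloor>x\<rfloor> <.. nat \<lfloor>2 * x\<rfloor>}. a (real k))"
      unfolding partial_sum_def eq by (subst sum.union_disjoint) auto
    also have "(\<Sum>k\<in>{nat \<lfloor>x\<rfloor> <.. nat \<lfloor>2 * x\<rfloor>}. a (real k)) \<le> (\<Sum>k\<in>{nat \<lfloor>x\<rfloor> <.. nat \<lfloor>2 * x\<rfloor>}. C * a x)"
    proof (rule sum_mono)
      fix k assume "k \<in> {nat \<lfloor>x\<rfloor> <.. nat \<lfloor>2 * x\<rfloor>}"
      then have "x \<le> real k" "real k \<le> 2 * x" using x x0 by (auto, linarith+)
      then show "a (real k) \<le> C * a x"
        using up[of x "real k / x"] x x0 by (simp add: field_simps)
    qed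
    also have "\<dots> = real (nat \<lfloor>2 * x\<rfloor> - nat \<lfloor>x\<rfloor>) * (C * a x)" by simp
    also have "\<dots> \<le> (2 * x) * (C * a x)"
    proof (rule mult_right_mono)
      show "real (nat \<lfloor>2 * x\<rfloor> - nat \<lfloor>x\<rfloor>) \<le> 2 * x" using x x0 by linarith
      show "0 \<le> C * a x" using C pos[of x] x x0 by simp
    qed
    finally show ?thesis by (simp add: g_def algebra_simps)
  qed
  \<comment> \<open>The first entry covers [x0, 2 x0], where \<open>low\<close> compares
    \<open>g x\<close> with \<open>g x0\<close>. The second solves C1 + 2 C = 2 q C1, so that the
    bound survives the addition of one more dyadic block.\<close>
  define C1 where "C1 = max (?B (2 * x0) * C / g x0) (2 * C / (2 * q - 1))"
  have Bg: "?B x \<le> C1 * g x" if "x \<ge> x0" for x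
    using that \<open>0 < x0\<close>
  proof (induction x rule: dyadic_induct)
    case (base x)
    have "?B x \<le> ?B (2 * x0)" by (rule partial_sum_mono) (use nonneg base in auto)
    also have "\<dots> = (?B (2 * x0) * C / g x0) * (g x0 / C)" using gpos[of x0] C by simp
    also have "\<dots> \<le> C1 * g x"
    proof (rule mult_mono)
      show "?B (2 * x0) * C / g x0 \<le> C1" by (simp add: C1_def)
      have "1 \<le> ?B (2 * x0)" using nonneg by (rule partial_sum_ge_1)
      then have "0 \<le> ?B (2 * x0) * C / g x0" using C gpos[of x0] by simp
      then show "0 \<le> C1" by (simp add: C1_def)
      have "a x0 \<le> C * a x" using low[of x0 "x / x0"] base x0 by (simp add: field_simps)
      then have "x0 * a x0 \<le> x * (C * a x)" using base x0 pos[of x0] by (intro mult_mono) auto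
      then show "g x0 / C \<le> g x" using C by (simp add: g_def field_simps)
      show "0 \<le> g x0 / C" using gpos[of x0] C by simp
    qed
    finally show ?case .
  next
    case (double x)
    have "2 * C / (2 * q - 1) \<le> C1" by (simp add: C1_def)
    then have "2 * C \<le> C1 * (2 * q - 1)" using q by (simp add: field_simps)
    then have "C1 + 2 * C \<le> C1 * (2 * q)" by (simp add: algebra_simps)
    have "?B (2 * x) \<le> (C1 + 2 * C) * g x" using block[of x] double by (simp add: algebra_simps)
    also have "\<dots> \<le> C1 * (2 * q) * g x"
      by (rule mult_right_mono) (use \<open>C1 + 2 * C \<le> C1 * (2 * q)\<close> gpos[of x] double in auto)
    also have "\<dots> = C1 * (2 * q * g x)" by simp
    also have "\<dots> \<le> C1 * g (2 * x)"
    proof (rule mult_left_mono[OF g2[OF double(1)]])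
      have "0 \<le> 2 * C / (2 * q - 1)" using C q by simp
      then show "0 \<le> C1" by (simp add: C1_def)
    qed
    finally show ?case .
  qed
  have C1: "0 \<le> C1"
  proof -
    have "0 \<le> 2 * C / (2 * q - 1)" using C q by simp
    then show "0 \<le> C1" by (simp add: C1_def)
  qed
  show thesis
  proof (rule that)
    show "x0 \<ge> 1" by fact
    fix K :: real assume "K \<ge> 1"
    obtain n where n: "K < 2 ^ n" using real_arch_pow[of 2 K] by auto
    have gn: "g (2 ^ n * x) \<le> (2 * C) ^ n * g x" if x: "x \<ge> x0" for x n
    proof (induction n)
      case (Suc n)
      have "1 * x0 \<le> 2 ^ n * x" using x x0 by (intro mult_mono) auto
      then have "g (2 * (2 ^ n * x)) \<le> 2 * C * g (2 ^ n * x)" by (intro g2u) simp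
      also have "\<dots> \<le> 2 * C * ((2 * C) ^ n * g x)" using Suc C by (intro mult_left_mono) auto
      finally show ?case by (simp add: mult.assoc)
    qed simp
    have "?B (K * x) \<le> C1 * (2 * C) ^ n * (x * a x)" if x: "x \<ge> x0" for x
    proof -
      have "?B (K * x) \<le> ?B (2 ^ n * x)"
        by (rule partial_sum_mono) (use nonneg n x x0 in \<open>auto intro!: mult_right_mono\<close>)
      also have "\<dots> \<le> C1 * g (2 ^ n * x)"
      proof (rule Bg)
        have "1 * x0 \<le> 2 ^ n * x" using x x0 by (intro mult_mono) auto
        then show "x0 \<le> 2 ^ n * x" by simp
      qed
      also have "\<dots> \<le> C1 * ((2 * C) ^ n * g x)" using gn[OF x] C1 by (rule mult_left_mono)
      finally show ?thesis by (simp add: g_def mult.assoc)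
    qed
    then show "\<exists>C. \<forall>x\<ge>x0. ?B (K * x) \<le> C * (x * a x)" by blast
  next
    \<comment> \<open>One doubling of x costs \<open>g\<close> a factor of at most 2 C, whereas it
      multiplies x ^ p by 2 ^ p.\<close>
    obtain p where p: "2 * C < 2 ^ p" using real_arch_pow[of 2 "2 * C"] by auto
    define G where "G = C * (2 * g x0)"
    have G: "0 \<le> G" using C gpos[of x0] by (simp add: G_def)
    have "g x \<le> G * x ^ p" if "x \<ge> x0" for x
      using that \<open>0 < x0\<close>
    proof (induction x rule: dyadic_induct)
      case (base x)
      have "a x \<le> C * a x0" using up[of x0 "x / x0"] base x0 by (simp add: field_simps)
      then have "x * a x \<le> (2 * x0) * (C * a x0)"
        using base x0 pos[of x] by (intro mult_mono) auto
      also have "\<dots> = G * 1" by (simp add: G_def g_def)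
      also have "\<dots> \<le> G * x ^ p" using G base x0 by (intro mult_left_mono) auto
      finally show ?case by (simp add: g_def)
    next
      case (double x)
      have "g (2 * x) \<le> 2 * C * g x" using g2u double by simp
      also have "\<dots> \<le> 2 ^ p * (G * x ^ p)"
        using p double gpos[of x] by (intro mult_mono) auto
      finally show ?case by (simp add: power_mult_distrib algebra_simps)
    qed
    then have "?B x \<le> (C1 * G) * x ^ p" if "x \<ge> x0" for x
      using order_trans[OF Bg[OF that] mult_left_mono[OF _ C1]] that by (simp add: mult.assoc)
    then show "\<exists>C p. \<forall>x\<ge>x0. ?B x \<le> C * x ^ p" by blast
  qed
qed

section \<open>Large deviations of random walks with negative drift\<close>

text \<open>This is P(S_n > - s) for a walk S with independent steps distributed as X. Iterated
  one-step integrals stand in for a sequence of independent steps and match the recursion over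
  generations in \<open>level_sum_Suc\<close>.\<close>

primrec walk_tail :: "'z measure \<Rightarrow> ('z \<Rightarrow> real) \<Rightarrow> nat \<Rightarrow> real \<Rightarrow> ennreal" where
  "walk_tail M X 0 s = indicator {0<..} s"
| "walk_tail M X (Suc n) s = (\<integral>\<^sup>+\<zeta>. walk_tail M X n (s + X \<zeta>) \<partial>M)"

lemma (in prob_space) borel_measurable_walk_tail [measurable]:
  assumes [measurable]: "X \<in> borel_measurable M"
  shows "walk_tail M X n \<in> borel_measurable borel"
  by (induction n) simp_all

lemma walk_tail_mono: "s \<le> t \<Longrightarrow> walk_tail M X n s \<le> walk_tail M X n t"
  by (induction n arbitrary: s t) (auto intro!: nn_integral_mono split: split_indicator)

lemma (in prob_space) walk_tail_le_1: "walk_tail M X n s \<le> 1"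
proof (induction n arbitrary: s)
  case (Suc n)
  have "walk_tail M X (Suc n) s \<le> (\<integral>\<^sup>+\<zeta>. 1 \<partial>M)"
    unfolding walk_tail.simps by (intro nn_integral_mono Suc)
  then show ?case by (simp add: emeasure_space_1)
qed (simp split: split_indicator)

text \<open>A walk of \<open>n\<close> steps either has a step above \<open>c\<close>, or Markov's inequality applies to the
  exponential of the walk with steps truncated at \<open>c\<close>.\<close>

lemma (in prob_space) walk_tail_le:
  assumes [measurable]: "X \<in> borel_measurable M"
    and m: "(\<integral>\<^sup>+\<zeta>. ennreal (exp (\<theta> * min (X \<zeta>) c)) \<partial>M) \<le> ennreal m" and "0 \<le> m" "0 \<le> \<theta>"
  shows "walk_tail M X n s \<le> ennreal (n * prob {\<zeta>\<in>space M. c < X \<zeta>} + exp (\<theta> * s) * m ^ n)"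
proof (induction n arbitrary: s)
  case 0
  show ?case using \<open>0 \<le> \<theta>\<close> by (auto split: split_indicator simp: mult_nonneg_nonneg)
next
  case (Suc n)
  let ?A = "{\<zeta>\<in>space M. c < X \<zeta>}" and ?e = "exp (\<theta> * s) * m ^ n"
  have "walk_tail M X (Suc n) s \<le> (\<integral>\<^sup>+\<zeta>. indicator ?A \<zeta> + (ennreal (n * prob ?A) + ennreal ?e * ennreal (exp (\<theta> * min (X \<zeta>) c))) \<partial>M)"
    unfolding walk_tail.simps
  proof (rule nn_integral_mono)
    fix \<zeta> assume \<zeta>: "\<zeta> \<in> space M"
    show "walk_tail M X n (s + X \<zeta>) \<le> indicator ?A \<zeta> + (ennreal (n * prob ?A) + ennreal ?e * ennreal (exp (\<theta> * min (X \<zeta>) c)))"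
    proof (cases "c < X \<zeta>")
      case True
      have "walk_tail M X n (s + X \<zeta>) \<le> indicator ?A \<zeta>"
        using walk_tail_le_1[of X n "s + X \<zeta>"] True \<zeta> by simp
      then show ?thesis by (rule order_trans) simp
    next
      case False
      then have "min (X \<zeta>) c = X \<zeta>" by simp
      then have "ennreal (n * prob ?A + exp (\<theta> * (s + X \<zeta>)) * m ^ n) =
        ennreal (n * prob ?A) + ennreal ?e * ennreal (exp (\<theta> * min (X \<zeta>) c))"
        using \<open>0 \<le> m\<close> by (simp add: ennreal_mult[symmetric] ennreal_plus[symmetric] exp_add algebra_simps
            del: ennreal_plus)
      with Suc[of "s + X \<zeta>"] show ?thesis by (auto intro: order_trans)
    qed
  qed
  also have "\<dots> = ennreal (prob ?A) + (ennreal (n * prob ?A) +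
      ennreal ?e * (\<integral>\<^sup>+\<zeta>. ennreal (exp (\<theta> * min (X \<zeta>) c)) \<partial>M))"
  proof -
    let ?f = "\<lambda>\<zeta>. ennreal (exp (\<theta> * min (X \<zeta>) c))"
    have "(\<integral>\<^sup>+\<zeta>. indicator ?A \<zeta> + (ennreal (n * prob ?A) + ennreal ?e * ?f \<zeta>) \<partial>M) =
      (\<integral>\<^sup>+\<zeta>. indicator ?A \<zeta> \<partial>M) + (\<integral>\<^sup>+\<zeta>. ennreal (n * prob ?A) + ennreal ?e * ?f \<zeta> \<partial>M)"
      by (rule nn_integral_add) measurable
    also have "(\<integral>\<^sup>+\<zeta>. ennreal (n * prob ?A) + ennreal ?e * ?f \<zeta> \<partial>M) =
      (\<integral>\<^sup>+\<zeta>. ennreal (n * prob ?A) \<partial>M) + (\<integral>\<^sup>+\<zeta>. ennreal ?e * ?f \<zeta> \<partial>M)"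
      by (rule nn_integral_add) measurable
    also have "(\<integral>\<^sup>+\<zeta>. ennreal ?e * ?f \<zeta> \<partial>M) = ennreal ?e * (\<integral>\<^sup>+\<zeta>. ?f \<zeta> \<partial>M)"
      by (rule nn_integral_cmult) measurable
    also have "(\<integral>\<^sup>+\<zeta>. ennreal (n * prob ?A) \<partial>M) = ennreal (n * prob ?A)"
      by (simp add: emeasure_space_1)
    also have "(\<integral>\<^sup>+\<zeta>. indicator ?A \<zeta> \<partial>M) = ennreal (prob ?A)"
      by (subst nn_integral_indicator) (measurable, simp add: emeasure_eq_measure)
    finally show ?thesis .
  qed
  also have "\<dots> \<le> ennreal (prob ?A) + (ennreal (n * prob ?A) + ennreal ?e * ennreal m)"
    using m by (intro add_left_mono mult_left_mono) auto
  also have "\<dots> = ennreal (Suc n * prob ?A + exp (\<theta> * s) * m ^ Suc n)"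
    using \<open>0 \<le> m\<close> by (simp add: ennreal_mult[symmetric] ennreal_plus[symmetric] algebra_simps del: ennreal_plus)
  finally show ?case .
qed

lemma exp_le_quadratic: "exp t \<le> 1 + t + t\<^sup>2 * exp \<bar>t\<bar>" for t :: real
proof -
  obtain u where u: "\<bar>u\<bar> \<le> \<bar>t\<bar>" "exp t = (\<Sum>m<2. t ^ m / fact m) + exp u / fact 2 * t ^ 2"
    using Maclaurin_exp_le[of t 2] by auto
  have "exp u / 2 \<le> exp \<bar>t\<bar>"
    using u(1) by (smt (verit) exp_gt_zero exp_le_cancel_iff field_sum_of_halves)
  then have "exp u / 2 * t\<^sup>2 \<le> exp \<bar>t\<bar> * t\<^sup>2" by (rule mult_right_mono) simp
  then show ?thesis using u(2) by (simp add: numeral_2_eq_2 algebra_simps)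
qed

text \<open>The negative part of X is only integrable, while a quadratic bound on exp calls for a
  second moment. Replacing X by its maximum with -k supplies one, and by dominated convergence the
  mean stays negative for large k; \<nu> is minus this mean and \<sigma> the second moment. Taking c
  at least k makes c bound the variable truncated on both sides in absolute value.\<close>

lemma (in prob_space) truncated_mgf_le:
  assumes X: "integrable M X" and neg: "expectation X < 0"
    and sq: "integrable M (\<lambda>\<zeta>. (max (X \<zeta>) 0)\<^sup>2)"
  obtains \<nu> \<sigma> K where "\<nu> > 0" "\<sigma> \<ge> 0" "K \<ge> 0"
    "\<And>\<theta> c. 0 \<le> \<theta> \<Longrightarrow> K \<le> c \<Longrightarrow>
      (\<integral>\<^sup>+\<zeta>. ennreal (exp (\<theta> * min (X \<zeta>) c)) \<partial>M) \<le> ennreal (exp (- \<theta> * \<nu> + \<theta>\<^sup>2 * \<sigma> * exp (\<theta> * c)))"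
proof -
  have [measurable]: "X \<in> borel_measurable M" using X by simp
  have "(\<lambda>n. expectation (\<lambda>\<zeta>. max (X \<zeta>) (- real n))) \<longlonglongrightarrow> expectation X"
  proof (rule integral_dominated_convergence)
    show "integrable M (\<lambda>\<zeta>. \<bar>X \<zeta>\<bar>)" using X by simp
    show "AE \<zeta> in M. (\<lambda>n. max (X \<zeta>) (- real n)) \<longlonglongrightarrow> X \<zeta>"
    proof (rule AE_I2, rule tendsto_eventually)
      fix \<zeta>
      obtain N :: nat where N: "- X \<zeta> \<le> real N" using real_arch_simple by blast
      show "\<forall>\<^sub>F n in sequentially. max (X \<zeta>) (- real n) = X \<zeta>"
        using eventually_ge_at_top[of N] by eventually_elim (use N in auto)
    qed
  qed (auto intro!: AE_I2)
  then have "\<forall>\<^sub>F n in sequentially. expectation (\<lambda>\<zeta>. max (X \<zeta>) (- real n)) < 0"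
    using neg by (rule order_tendstoD)
  then obtain k where k: "expectation (\<lambda>\<zeta>. max (X \<zeta>) (- real k)) < 0"
    by (auto simp: eventually_sequentially)
  define Y where "Y \<zeta> = max (X \<zeta>) (- real k)" for \<zeta>
  have Y [measurable]: "Y \<in> borel_measurable M" unfolding Y_def by measurable
  have iY: "integrable M Y" unfolding Y_def using X by simp
  have iY2: "integrable M (\<lambda>\<zeta>. (Y \<zeta>)\<^sup>2)"
  proof (rule Bochner_Integration.integrable_bound)
    show "integrable M (\<lambda>\<zeta>. (real k)\<^sup>2 + (max (X \<zeta>) 0)\<^sup>2)" using sq by simp
    have "(Y \<zeta>)\<^sup>2 \<le> (real k)\<^sup>2 + (max (X \<zeta>) 0)\<^sup>2" for \<zeta>
    proof (cases "X \<zeta> \<ge> 0")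
      case True
      then show ?thesis by (simp add: Y_def)
    next
      case False
      then have "\<bar>Y \<zeta>\<bar>\<^sup>2 \<le> (real k)\<^sup>2" by (intro power_mono) (auto simp: Y_def)
      then have "(Y \<zeta>)\<^sup>2 \<le> (real k)\<^sup>2" by simp
      then show ?thesis by (simp add: add_increasing2)
    qed
    then show "AE \<zeta> in M. norm ((Y \<zeta>)\<^sup>2) \<le> norm ((real k)\<^sup>2 + (max (X \<zeta>) 0)\<^sup>2)" by simp
  qed simp
  show thesis
  proof (rule that)
    show "- expectation Y > 0" using k unfolding Y_def by simp
    show "expectation (\<lambda>\<zeta>. (Y \<zeta>)\<^sup>2) \<ge> 0" by simp
    show "real k \<ge> 0" by simp
    fix \<theta> c :: real assume \<theta>: "0 \<le> \<theta>" and c: "real k \<le> c"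
    have "(\<integral>\<^sup>+\<zeta>. ennreal (exp (\<theta> * min (X \<zeta>) c)) \<partial>M) \<le>
      (\<integral>\<^sup>+\<zeta>. ennreal (1 + \<theta> * Y \<zeta> + \<theta>\<^sup>2 * exp (\<theta> * c) * (Y \<zeta>)\<^sup>2) \<partial>M)"
    proof (rule nn_integral_mono, rule ennreal_leI)
      fix \<zeta>
      define T where "T = min (Y \<zeta>) c"
      have T: "min (X \<zeta>) c \<le> T" "T \<le> Y \<zeta>" "\<bar>T\<bar> \<le> c" "\<bar>T\<bar> \<le> \<bar>Y \<zeta>\<bar>" using c by (auto simp: T_def Y_def)
      have "exp (\<theta> * min (X \<zeta>) c) \<le> exp (\<theta> * T)" using T \<theta> by (simp add: mult_left_mono)
      also have "\<dots> \<le> 1 + \<theta> * T + (\<theta> * T)\<^sup>2 * exp \<bar>\<theta> * T\<bar>" by (rule exp_le_quadratic)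
      also have "\<dots> \<le> 1 + \<theta> * Y \<zeta> + (\<theta> * Y \<zeta>)\<^sup>2 * exp (\<theta> * c)"
      proof (rule add_mono[OF _ mult_mono])
        show "1 + \<theta> * T \<le> 1 + \<theta> * Y \<zeta>" using T(2) \<theta> by (simp add: mult_left_mono)
        have "T\<^sup>2 \<le> (Y \<zeta>)\<^sup>2" using T(4) by (simp add: abs_le_square_iff)
        then show "(\<theta> * T)\<^sup>2 \<le> (\<theta> * Y \<zeta>)\<^sup>2" by (simp add: power_mult_distrib mult_left_mono)
        show "exp \<bar>\<theta> * T\<bar> \<le> exp (\<theta> * c)" using T(3) \<theta> by (simp add: abs_mult mult_left_mono)
      qed auto
      finally show "exp (\<theta> * min (X \<zeta>) c) \<le> 1 + \<theta> * Y \<zeta> + \<theta>\<^sup>2 * exp (\<theta> * c) * (Y \<zeta>)\<^sup>2"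
        by (simp add: power_mult_distrib mult_ac)
    qed
    also have "\<dots> = ennreal (expectation (\<lambda>\<zeta>. 1 + \<theta> * Y \<zeta> + \<theta>\<^sup>2 * exp (\<theta> * c) * (Y \<zeta>)\<^sup>2))"
    proof (rule nn_integral_eq_integral)
      show "integrable M (\<lambda>\<zeta>. 1 + \<theta> * Y \<zeta> + \<theta>\<^sup>2 * exp (\<theta> * c) * (Y \<zeta>)\<^sup>2)" using iY iY2 by simp
      show "AE \<zeta> in M. 0 \<le> 1 + \<theta> * Y \<zeta> + \<theta>\<^sup>2 * exp (\<theta> * c) * (Y \<zeta>)\<^sup>2"
      proof (rule AE_I2)
        fix \<zeta>
        \<comment> \<open>Where Y is negative, \<bar>Y\<bar> is at most c, and the quadratic bound
          places the expression above an exponential.\<close>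
        have "0 \<le> 1 + \<theta> * Y \<zeta> + (\<theta> * Y \<zeta>)\<^sup>2 * exp (\<theta> * c)"
        proof (cases "Y \<zeta> \<ge> 0")
          case True then show ?thesis using \<theta> by simp
        next
          case False
          then have "\<bar>Y \<zeta>\<bar> \<le> c" using c by (auto simp: Y_def)
          then have "\<bar>\<theta> * Y \<zeta>\<bar> \<le> \<theta> * c"
            using \<theta> by (simp add: abs_mult mult_left_mono)
          then have "(\<theta> * Y \<zeta>)\<^sup>2 * exp \<bar>\<theta> * Y \<zeta>\<bar> \<le> (\<theta> * Y \<zeta>)\<^sup>2 * exp (\<theta> * c)"
            by (intro mult_left_mono) auto
          with exp_le_quadratic[of "\<theta> * Y \<zeta>"] show ?thesis using exp_gt_zero[of "\<theta> * Y \<zeta>"] by linarith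
        qed
        then show "0 \<le> 1 + \<theta> * Y \<zeta> + \<theta>\<^sup>2 * exp (\<theta> * c) * (Y \<zeta>)\<^sup>2"
          by (simp add: power_mult_distrib mult_ac)
      qed
    qed
    also have "expectation (\<lambda>\<zeta>. 1 + \<theta> * Y \<zeta> + \<theta>\<^sup>2 * exp (\<theta> * c) * (Y \<zeta>)\<^sup>2) =
      1 + (- \<theta> * - expectation Y + \<theta>\<^sup>2 * expectation (\<lambda>\<zeta>. (Y \<zeta>)\<^sup>2) * exp (\<theta> * c))"
      using iY iY2 by (simp add: prob_space)
    also have "\<dots> \<le> exp (- \<theta> * - expectation Y + \<theta>\<^sup>2 * expectation (\<lambda>\<zeta>. (Y \<zeta>)\<^sup>2) * exp (\<theta> * c))"
      by (rule exp_ge_add_one_self)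
    finally show "(\<integral>\<^sup>+\<zeta>. ennreal (exp (\<theta> * min (X \<zeta>) c)) \<partial>M) \<le>
        ennreal (exp (- \<theta> * - expectation Y + \<theta>\<^sup>2 * expectation (\<lambda>\<zeta>. (Y \<zeta>)\<^sup>2) * exp (\<theta> * c)))"
      by (auto intro: ennreal_leI)
  qed
qed

text \<open>With r the fourth root of x, ln x = 4 ln r is at most 4 r, and 16 r^2 = 16 sqrt
  x.\<close>

lemma ln_square_le:
  fixes x :: real
  assumes "1 \<le> x"
  shows "(ln x)\<^sup>2 \<le> 16 * sqrt x"
proof -
  define r where "r = sqrt (sqrt x)"
  have r: "0 < r" "r\<^sup>2 = sqrt x" using assms by (auto simp: r_def)
  have "x = r ^ 4" using r assms by (metis abs_of_nonneg numeral_Bit0 power2_eq_square power_add real_sqrt_abs real_sqrt_pow2 order_trans zero_le_one)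
  then have "ln x = 4 * ln r" using r by (simp add: ln_realpow)
  also have "\<dots> \<le> 4 * r" using ln_le_minus_one[of r] r by linarith
  finally have "ln x \<le> 4 * r" .
  then have "(ln x)\<^sup>2 \<le> (4 * r)\<^sup>2" using assms by (intro power_mono) auto
  then show ?thesis using r by (simp add: power_mult_distrib)
qed

text \<open>The truncation level is \<open>n / (2k)\<close> and the exponent is \<open>\<theta> = k ln n / n\<close>, so that
  \<open>e\<^bsup>\<theta>c\<^esup> = \<surd>n\<close> and the quadratic error term \<open>n \<theta>\<^sup>2 e\<^bsup>\<theta>c\<^esup>\<close> stays bounded.\<close>

lemma (in prob_space) walk_tail_polynomial_decay:
  assumes X: "integrable M X" and neg: "expectation X < 0"
    and sq: "integrable M (\<lambda>\<zeta>. (max (X \<zeta>) 0)\<^sup>2)"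
  obtains \<epsilon> :: real where "\<epsilon> > 0" "\<And>p::nat. \<exists>K C. K \<ge> 1 \<and> C \<ge> 0 \<and> (\<forall>n\<ge>1.
      walk_tail M X n (\<epsilon> * n) \<le> ennreal (n * prob {\<zeta>\<in>space M. n / K < X \<zeta>} + C / n ^ p))"
proof -
  have [measurable]: "X \<in> borel_measurable M" using X by simp
  obtain \<nu> \<sigma> L where \<nu>: "\<nu> > 0" and \<sigma>: "\<sigma> \<ge> 0" and L: "L \<ge> 0" and mgf: "\<And>\<theta> c. 0 \<le> \<theta> \<Longrightarrow> L \<le> c \<Longrightarrow>
      (\<integral>\<^sup>+\<zeta>. ennreal (exp (\<theta> * min (X \<zeta>) c)) \<partial>M) \<le> ennreal (exp (- \<theta> * \<nu> + \<theta>\<^sup>2 * \<sigma> * exp (\<theta> * c)))"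
    by (rule truncated_mgf_le[OF assms], rule that)
  have "\<exists>K C. K \<ge> 1 \<and> C \<ge> 0 \<and> (\<forall>n\<ge>1.
      walk_tail M X n (\<nu> / 2 * n) \<le> ennreal (n * prob {\<zeta>\<in>space M. n / K < X \<zeta>} + C / n ^ p))" for p :: nat
  proof -
    \<comment> \<open>At the level n \<nu> / 2 half of the drift is left and contributes - (k \<nu>
      / 2) ln n to the exponent; this k makes it at most - p ln n.\<close>
    define k where "k = 2 * p / \<nu> + 1"
    have k: "k \<ge> 1" "real p \<le> k * \<nu> / 2" using \<nu> by (auto simp: k_def field_simps)
    \<comment> \<open>The exponential bounds the remainder of the exponent. The power makes the
      claim trivial for n < 2 k L, where the truncation level is too low for
      \<open>mgf\<close>.\<close>
    define C where "C = exp (16 * k\<^sup>2 * \<sigma>) + (2 * k * L) ^ p"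
    have C: "exp (16 * k\<^sup>2 * \<sigma>) \<le> C" "(2 * k * L) ^ p \<le> C" "0 \<le> C" using k L by (auto simp: C_def)
    have "walk_tail M X n (\<nu> / 2 * n) \<le> ennreal (n * prob {\<zeta>\<in>space M. n / (2 * k) < X \<zeta>} + C / n ^ p)"
      if n: "n \<ge> 1" for n :: nat
    proof (cases "L \<le> n / (2 * k)")
      case False
      then have "real n \<le> 2 * k * L" using k by (simp add: field_simps)
      then have "real n ^ p \<le> (2 * k * L) ^ p" by (intro power_mono) auto
      with C have "1 \<le> C / real n ^ p" using n by (simp add: field_simps)
      then have "1 \<le> n * prob {\<zeta>\<in>space M. n / (2 * k) < X \<zeta>} + C / n ^ p"
        by (simp add: add_increasing)
      then have "1 \<le> ennreal (n * prob {\<zeta>\<in>space M. n / (2 * k) < X \<zeta>} + C / n ^ p)"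
        by simp
      with walk_tail_le_1 show ?thesis by (rule order_trans)
    next
      case True
      define \<theta> where "\<theta> = k * ln n / n"
      have \<theta>: "0 \<le> \<theta>" using n k by (simp add: \<theta>_def)
      define m where "m = exp (- \<theta> * \<nu> + \<theta>\<^sup>2 * \<sigma> * exp (\<theta> * (n / (2 * k))))"
      have "walk_tail M X n (\<nu> / 2 * n) \<le>
        ennreal (n * prob {\<zeta>\<in>space M. n / (2 * k) < X \<zeta>} + exp (\<theta> * (\<nu> / 2 * n)) * m ^ n)"
        using mgf[OF \<theta> True] by (intro walk_tail_le) (auto simp: m_def \<theta>)
      also have "\<dots> \<le> ennreal (n * prob {\<zeta>\<in>space M. n / (2 * k) < X \<zeta>} + C / n ^ p)"
      proof (intro ennreal_leI add_left_mono)
        have "\<theta> * (n / (2 * k)) = ln n / 2" using n k by (simp add: \<theta>_def)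
        then have e: "exp (\<theta> * (n / (2 * k))) = sqrt n"
          using n by (simp add: powr_def flip: powr_half_sqrt)
        have n\<theta>: "n * \<theta> = k * ln n" using n by (simp add: \<theta>_def)
        have "exp (\<theta> * (\<nu> / 2 * n)) * m ^ n =
            exp (\<theta> * (\<nu> / 2 * n) + n * (- \<theta> * \<nu> + \<theta>\<^sup>2 * \<sigma> * sqrt n))"
          unfolding m_def e exp_add exp_of_nat_mult ..
        also have "\<theta> * (\<nu> / 2 * n) + n * (- \<theta> * \<nu> + \<theta>\<^sup>2 * \<sigma> * sqrt n) =
            - (\<nu> / 2) * (n * \<theta>) + (n * \<theta>) * \<theta> * \<sigma> * sqrt n"
          by (simp add: algebra_simps power2_eq_square)
        also have "\<dots> = - (k * \<nu> / 2) * ln n + k\<^sup>2 * \<sigma> * ((ln n)\<^sup>2 * sqrt n / n)"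
          unfolding n\<theta> by (simp add: \<theta>_def power2_eq_square mult_ac)
        also have "\<dots> \<le> - p * ln n + k\<^sup>2 * \<sigma> * 16"
        proof (intro add_mono mult_left_mono)
          show "- (k * \<nu> / 2) * ln n \<le> - p * ln n"
            using k n by (intro mult_right_mono) auto
          have "(ln n)\<^sup>2 * sqrt n \<le> (16 * sqrt n) * sqrt n"
            using ln_square_le[of n] n by (intro mult_right_mono) auto
          also have "\<dots> = 16 * n" by (simp add: mult.assoc)
          finally show "(ln n)\<^sup>2 * sqrt n / n \<le> 16" using n by (simp add: field_simps)
        qed (use \<sigma> in auto)
        finally have "exp (\<theta> * (\<nu> / 2 * n)) * m ^ n \<le> exp (- p * ln n + k\<^sup>2 * \<sigma> * 16)"
          by simp
        also have "\<dots> = exp (16 * k\<^sup>2 * \<sigma>) / n ^ p"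
        proof -
          have "exp (p * ln n) = real n ^ p" using n by (simp add: exp_of_nat_mult)
          then show ?thesis by (simp add: exp_diff mult_ac)
        qed
        also have "\<dots> \<le> C / n ^ p" using C by (intro divide_right_mono) auto
        finally show "exp (\<theta> * (\<nu> / 2 * n)) * m ^ n \<le> C / n ^ p" .
      qed
      finally show ?thesis .
    qed
    then show ?thesis using k C by (intro exI[of _ "2 * k"] exI[of _ C]) auto
  qed
  then show thesis using \<nu> by (intro that[of "\<nu> / 2"]) auto
qed

text \<open>Only positive integers below x contribute; there are at most x of them, and each term is
  at most x B(x). This is what turns a weighted sum of tail probabilities into a moment.\<close>

lemma suminf_weighted_indicator_le:
  fixes B :: "real \<Rightarrow> real"
  assumes mono: "\<And>x y. x \<le> y \<Longrightarrow> B x \<le> B y" and nonneg: "\<And>x. 0 \<le> B x" and x: "0 \<le> x"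
  shows "(\<Sum>n. ennreal (real n * B n) * indicator {n. real n < x} n) \<le> ennreal (x\<^sup>2 * B x)"
proof (rule suminf_le_const)
  show "summable (\<lambda>n. ennreal (real n * B n) * indicator {n. real n < x} n)" by (rule summableI)
  fix N
  have "(\<Sum>n<N. ennreal (real n * B n) * indicator {n. real n < x} n) \<le>
    (\<Sum>n<N. ennreal (x * B x) * indicator {1..nat \<lfloor>x\<rfloor>} n)"
  proof (rule sum_mono)
    fix n
    show "ennreal (real n * B n) * indicator {n. real n < x} n \<le> ennreal (x * B x) * indicator {1..nat \<lfloor>x\<rfloor>} n"
    proof (cases "1 \<le> n \<and> real n < x")
      case True
      then have "n \<le> nat \<lfloor>x\<rfloor>" by (simp add: le_nat_floor)
      moreover have "real n * B n \<le> x * B x" using True x nonneg by (intro mult_mono mono) auto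
      ultimately show ?thesis using True by (simp add: ennreal_leI)
    next
      case False
      then have "n = 0 \<or> \<not> real n < x" by auto
      then show ?thesis by auto
    qed
  qed
  also have "\<dots> = ennreal (x * B x) * (\<Sum>n<N. indicator {1..nat \<lfloor>x\<rfloor>} n)" by (simp add: sum_distrib_left)
  also have "(\<Sum>n<N. indicator {1..nat \<lfloor>x\<rfloor>} n) = (of_nat (card ({..<N} \<inter> {1..nat \<lfloor>x\<rfloor>})) :: ennreal)"
    by (simp add: indicator_def sum.If_cases) (auto intro!: arg_cong[where f = card])
  also have "\<dots> \<le> of_nat (nat \<lfloor>x\<rfloor>)"
    using card_mono[of "{1..nat \<lfloor>x\<rfloor>}" "{..<N} \<inter> {1..nat \<lfloor>x\<rfloor>}"] by auto
  also have "\<dots> \<le> ennreal x" using x by (simp add: ennreal_of_nat_eq_real_of_nat ennreal_leI)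
  also have "ennreal (x * B x) * ennreal x = ennreal (x\<^sup>2 * B x)"
    using x nonneg by (simp add: ennreal_mult[symmetric] power2_eq_square mult_ac)
  finally show "(\<Sum>n<N. ennreal (real n * B n) * indicator {n. real n < x} n) \<le> ennreal (x\<^sup>2 * B x)"
    by (simp add: mult_left_mono)
qed

text \<open>With decay of order p + 2 the error term times B(n) is O(n^-2). The jump terms n B(n)
  P(X > n / K) add up, by Tonelli, to the expectation of the sum of n B(n) over n < K X^+, which
  \<open>suminf_weighted_indicator_le\<close> bounds by (K X^+)^2 B(K X^+).\<close>

lemma (in prob_space) walk_tail_summable:
  fixes B :: "real \<Rightarrow> real" and D :: real
  assumes X: "integrable M X" and neg: "expectation X < 0"
    and sq: "integrable M (\<lambda>\<zeta>. (max (X \<zeta>) 0)\<^sup>2)"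
    and mono: "\<And>x y. x \<le> y \<Longrightarrow> B x \<le> B y" and nonneg: "\<And>x. 0 \<le> B x"
    and poly: "\<And>n::nat. n \<ge> 1 \<Longrightarrow> B n \<le> D * real n ^ p"
    and mom: "\<And>K. K \<ge> 1 \<Longrightarrow> (\<integral>\<^sup>+\<zeta>. ennreal ((max (X \<zeta>) 0)\<^sup>2 * B (K * max (X \<zeta>) 0)) \<partial>M) < \<infinity>"
  obtains \<epsilon> :: real where "\<epsilon> > 0" "(\<Sum>n. ennreal (B n) * walk_tail M X n (\<epsilon> * n)) < \<infinity>"
proof -
  have [measurable]: "X \<in> borel_measurable M" using X by simp
  have [measurable]: "B \<in> borel_measurable borel" by (rule borel_measurable_mono) (auto simp: mono_def mono)
  obtain \<epsilon> where \<epsilon>: "\<epsilon> > 0" and dec: "\<And>p::nat. \<exists>K C. K \<ge> 1 \<and> C \<ge> 0 \<and> (\<forall>n\<ge>1.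
      walk_tail M X n (\<epsilon> * n) \<le> ennreal (n * prob {\<zeta>\<in>space M. n / K < X \<zeta>} + C / n ^ p))"
    by (rule walk_tail_polynomial_decay[OF X neg sq], rule that)
  obtain K C where K: "K \<ge> 1" and C: "C \<ge> 0" and le: "\<And>n. n \<ge> 1 \<Longrightarrow>
      walk_tail M X n (\<epsilon> * n) \<le> ennreal (n * prob {\<zeta>\<in>space M. n / K < X \<zeta>} + C / n ^ (p + 2))"
    using dec[of "p + 2"] by blast
  have D: "0 \<le> D" using poly[of 1] nonneg[of 1] by simp
  define b where "b n = (\<integral>\<^sup>+\<zeta>. ennreal (real n * B n) * indicator {n. real n < K * max (X \<zeta>) 0} n \<partial>M)" for n :: nat
  \<comment> \<open>The index 0 is kept apart because the decay estimate starts at n = 1; at 0 the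
    term 1 / 0 ^ 2 evaluates to 0.\<close>
  have "ennreal (B n) * walk_tail M X n (\<epsilon> * n) \<le>
      ennreal (B 0) * indicator {0} n + (b n + ennreal (D * C * (1 / real n ^ 2)))" for n :: nat
  proof (cases "n = 0")
    case True
    have "ennreal (B 0) * walk_tail M X 0 (\<epsilon> * 0) \<le> ennreal (B 0) * 1"
      by (intro mult_left_mono) (auto split: split_indicator)
    then show ?thesis using True by (simp add: add_increasing2)
  next
    case False
    then have n: "n \<ge> 1" by simp
    let ?q = "prob {\<zeta>\<in>space M. n / K < X \<zeta>}"
    have eq: "b n = ennreal (n * B n * ?q)"
    proof -
      have "b n = (\<integral>\<^sup>+\<zeta>. ennreal (real n * B n) * indicator {\<zeta>\<in>space M. n / K < X \<zeta>} \<zeta> \<partial>M)"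
        unfolding b_def
      proof (rule nn_integral_cong)
        fix \<zeta> assume "\<zeta> \<in> space M"
        moreover have "real n < K * max (X \<zeta>) 0 \<longleftrightarrow> n / K < X \<zeta>"
        proof (cases "X \<zeta> \<le> 0")
          case True
          moreover have "0 < n / K" using n K by simp
          ultimately show ?thesis by (auto simp: max_def)
        qed (use K in \<open>simp add: field_simps\<close>)
        ultimately show "ennreal (real n * B n) * indicator {n. real n < K * max (X \<zeta>) 0} n =
            ennreal (real n * B n) * indicator {\<zeta>\<in>space M. n / K < X \<zeta>} \<zeta>"
          by (simp split: split_indicator)
      qed
      also have "\<dots> = ennreal (real n * B n) * ennreal ?q"
        by (subst nn_integral_cmult_indicator) (auto simp: emeasure_eq_measure)
      finally show ?thesis using nonneg by (simp add: ennreal_mult)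
    qed
    have "ennreal (B n) * walk_tail M X n (\<epsilon> * n) \<le> ennreal (B n) * ennreal (n * ?q + C / real n ^ (p + 2))"
      using le[OF n] by (rule mult_left_mono) simp
    also have "\<dots> = ennreal (n * B n * ?q + B n * (C / real n ^ (p + 2)))"
      using nonneg C by (simp add: ennreal_mult[symmetric] algebra_simps)
    also have "\<dots> \<le> ennreal (n * B n * ?q + D * C * (1 / real n ^ 2))"
    proof (intro ennreal_leI add_left_mono)
      have "B n * (C / real n ^ (p + 2)) \<le> (D * real n ^ p) * (C / real n ^ (p + 2))"
        using poly[OF n] C by (intro mult_right_mono) auto
      also have "\<dots> = D * C * (1 / real n ^ 2)" using n by (simp add: power_add power2_eq_square field_simps)
      finally show "B n * (C / real n ^ (p + 2)) \<le> D * C * (1 / real n ^ 2)" .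
    qed
    also have "\<dots> = b n + ennreal (D * C * (1 / real n ^ 2))"
      using nonneg C D by (simp add: eq)
    finally show ?thesis by (simp add: add_increasing)
  qed
  then have "(\<Sum>n. ennreal (B n) * walk_tail M X n (\<epsilon> * n)) \<le>
      (\<Sum>n. ennreal (B 0) * indicator {0} n + (b n + ennreal (D * C * (1 / real n ^ 2))))"
    by (intro suminf_le summableI)
  also have "\<dots> = (\<Sum>n. ennreal (B 0) * indicator {0} n) + ((\<Sum>n. b n) + (\<Sum>n. ennreal (D * C * (1 / real n ^ 2))))"
    by (simp add: suminf_add[symmetric] summableI)
  also have "\<dots> < \<infinity>"
  proof -
    have "(\<Sum>n. ennreal (B 0) * indicator {0::nat} n) = (\<Sum>n\<in>{0}. ennreal (B 0) * indicator {0::nat} n)"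
      by (rule suminf_finite) auto
    then have 1: "(\<Sum>n. ennreal (B 0) * indicator {0::nat} n) < \<infinity>" by (simp add: less_top)
    have "summable (\<lambda>n. D * C * (1 / real n ^ 2))"
      using inverse_power_summable[of 2, where 'a = real] by (intro summable_mult) (simp add: field_simps)
    then have 2: "(\<Sum>n. ennreal (D * C * (1 / real n ^ 2))) < \<infinity>"
      using D C by (simp add: less_top[symmetric] ennreal_suminf_neq_top)
    have "(\<Sum>n. b n) = (\<integral>\<^sup>+\<zeta>. (\<Sum>n. ennreal (real n * B n) * indicator {n. real n < K * max (X \<zeta>) 0} n) \<partial>M)"
      unfolding b_def by (intro nn_integral_suminf[symmetric]) simp
    also have "\<dots> \<le> (\<integral>\<^sup>+\<zeta>. ennreal ((K * max (X \<zeta>) 0)\<^sup>2 * B (K * max (X \<zeta>) 0)) \<partial>M)"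
      using K by (intro nn_integral_mono suminf_weighted_indicator_le mono nonneg) auto
    also have "\<dots> = (\<integral>\<^sup>+\<zeta>. ennreal (K\<^sup>2) * ennreal ((max (X \<zeta>) 0)\<^sup>2 * B (K * max (X \<zeta>) 0)) \<partial>M)"
      using nonneg by (intro nn_integral_cong) (simp add: ennreal_mult[symmetric] power_mult_distrib mult_ac)
    also have "\<dots> = ennreal (K\<^sup>2) * (\<integral>\<^sup>+\<zeta>. ennreal ((max (X \<zeta>) 0)\<^sup>2 * B (K * max (X \<zeta>) 0)) \<partial>M)"
      by (rule nn_integral_cmult) simp
    also have "\<dots> < \<infinity>" using mom[OF K] by (simp add: ennreal_mult_less_top)
    finally show ?thesis using 1 2 by simp
  qed
  finally show thesis by (rule that[OF \<epsilon>])
qed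

section \<open>Countable sums as integrals\<close>

lemma borel_measurable_nn_integral_count_space:
  fixes f :: "'a \<Rightarrow> 'b \<Rightarrow> ennreal"
  assumes A: "countable A" and f: "\<And>a. a \<in> A \<Longrightarrow> f a \<in> borel_measurable M"
  shows "(\<lambda>x. \<integral>\<^sup>+a. f a x \<partial>count_space A) \<in> borel_measurable M"
proof -
  interpret sigma_finite_measure "count_space A"
    by (rule sigma_finite_measure_count_space_countable[OF A])
  have "(\<lambda>p. f (snd p) (fst p)) \<in> borel_measurable (M \<Otimes>\<^sub>M count_space A)"
    by (rule measurable_compose_countable'[where f = "\<lambda>a p. f a (fst p)" and g = snd, OF measurable_compose[OF measurable_fst f] measurable_snd A])
  then show ?thesis by (intro borel_measurable_nn_integral) (simp add: case_prod_beta')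
qed

lemma nn_integral_count_space_swap:
  fixes f :: "'a \<Rightarrow> 'b \<Rightarrow> ennreal"
  assumes "sigma_finite_measure M" and A: "countable A" and f: "\<And>a. a \<in> A \<Longrightarrow> f a \<in> borel_measurable M"
  shows "(\<integral>\<^sup>+x. (\<integral>\<^sup>+a. f a x \<partial>count_space A) \<partial>M) = (\<integral>\<^sup>+a. (\<integral>\<^sup>+x. f a x \<partial>M) \<partial>count_space A)"
proof -
  interpret pair_sigma_finite M "count_space A"
    by (intro pair_sigma_finite.intro assms sigma_finite_measure_count_space_countable)
  have "(\<lambda>p. f (snd p) (fst p)) \<in> borel_measurable (M \<Otimes>\<^sub>M count_space A)"
    by (rule measurable_compose_countable'[where f = "\<lambda>a p. f a (fst p)" and g = snd, OF measurable_compose[OF measurable_fst f] measurable_snd A])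
  then show ?thesis by (intro Fubini'[symmetric]) (simp add: case_prod_beta')
qed

text \<open>One fixed sequence of finite sets exhausting a countable set. It turns convergence along
  the net of finite subsets into convergence of a sequence, the form in which monotone convergence
  and Fatou's lemma apply.\<close>

definition initial_part :: "'a::countable set \<Rightarrow> nat \<Rightarrow> 'a set" where
  "initial_part A k = {a \<in> A. to_nat a < k}"

lemma finite_initial_part: "finite (initial_part A k)"
  by (rule finite_imageD[of to_nat]) (auto simp: initial_part_def intro: finite_subset[of _ "{..<k}"])

lemma initial_part_subset: "initial_part A k \<subseteq> A"
  by (auto simp: initial_part_def)

lemma filterlim_initial_part: "filterlim (initial_part A) (finite_subsets_at_top A) sequentially"
  unfolding filterlim_finite_subsets_at_top
proof safe
  fix X assume X: "finite X" "X \<subseteq> A"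
  show "\<forall>\<^sub>F k in sequentially. finite (initial_part A k) \<and> X \<subseteq> initial_part A k \<and> initial_part A k \<subseteq> A"
    using eventually_gt_at_top[of "Max (insert 0 (to_nat ` X))"]
  proof eventually_elim
    case (elim k)
    then show ?case using X finite_initial_part[of A k] by (auto simp: initial_part_def)
  qed
qed

text \<open>The law of Z is given through \<open>infsum\<close>, while Tonelli is applied to
  integrals over counting measures. On \<open>ennreal\<close> both are the supremum of the finite
  partial sums.\<close>

lemma nn_integral_count_space_eq_infsum:
  fixes f :: "'a::countable \<Rightarrow> ennreal"
  shows "(\<integral>\<^sup>+a. f a \<partial>count_space A) = infsum f A"
proof -
  have fin: "(\<integral>\<^sup>+a. f a * indicator F a \<partial>count_space A) = sum f F" if "finite F" "F \<subseteq> A" for F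
    using that by (subst nn_integral_count_space'[of F]) auto
  have "(\<integral>\<^sup>+a. f a \<partial>count_space A) = (\<integral>\<^sup>+a. (SUP k. f a * indicator (initial_part A k) a) \<partial>count_space A)"
  proof (rule nn_integral_cong, rule antisym)
    fix a assume "a \<in> space (count_space A)"
    then have "f a = f a * indicator (initial_part A (Suc (to_nat a))) a" by (simp add: initial_part_def)
    also have "\<dots> \<le> (SUP k. f a * indicator (initial_part A k) a)" by (rule SUP_upper) simp
    finally show "f a \<le> (SUP k. f a * indicator (initial_part A k) a)" .
    show "(SUP k. f a * indicator (initial_part A k) a) \<le> f a"
      by (rule SUP_least) (simp split: split_indicator)
  qed
  also have "\<dots> = (SUP k. \<integral>\<^sup>+a. f a * indicator (initial_part A k) a \<partial>count_space A)"
    by (rule nn_integral_monotone_convergence_SUP)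
      (auto simp: incseq_def le_fun_def initial_part_def split: split_indicator)
  also have "\<dots> = (SUP k. sum f (initial_part A k))"
    by (simp add: fin finite_initial_part initial_part_subset)
  finally have eq: "(\<integral>\<^sup>+a. f a \<partial>count_space A) = (SUP k. sum f (initial_part A k))" .
  have "infsum f A = (SUP F\<in>{F. finite F \<and> F \<subseteq> A}. sum f F)"
    by (rule nonneg_infsum_complete) simp
  moreover have "(\<integral>\<^sup>+a. f a \<partial>count_space A) = (SUP F\<in>{F. finite F \<and> F \<subseteq> A}. sum f F)"
  proof (rule antisym)
    show "(\<integral>\<^sup>+a. f a \<partial>count_space A) \<le> (SUP F\<in>{F. finite F \<and> F \<subseteq> A}. sum f F)"
      unfolding eq by (rule SUP_mono) (use finite_initial_part initial_part_subset in blast)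
    show "(SUP F\<in>{F. finite F \<and> F \<subseteq> A}. sum f F) \<le> (\<integral>\<^sup>+a. f a \<partial>count_space A)"
    proof (rule SUP_least)
      fix F assume "F \<in> {F. finite F \<and> F \<subseteq> A}"
      then have "sum f F = (\<integral>\<^sup>+a. f a * indicator F a \<partial>count_space A)" by (simp add: fin)
      also have "\<dots> \<le> (\<integral>\<^sup>+a. f a \<partial>count_space A)"
        by (rule nn_integral_mono) (simp split: split_indicator)
      finally show "sum f F \<le> (\<integral>\<^sup>+a. f a \<partial>count_space A)" .
    qed
  qed
  ultimately show ?thesis by simp
qed

lemma has_sum_enn2real:
  fixes f :: "'a \<Rightarrow> real"
  assumes nonneg: "\<And>a. a \<in> A \<Longrightarrow> 0 \<le> f a"
    and fin: "(\<integral>\<^sup>+a. ennreal (f a) \<partial>count_space A) < \<infinity>"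
  shows "(f has_sum enn2real (\<integral>\<^sup>+a. ennreal (f a) \<partial>count_space A)) A"
proof -
  have "(\<integral>\<^sup>+a. ennreal (norm (f a)) \<partial>count_space A) = (\<integral>\<^sup>+a. ennreal (f a) \<partial>count_space A)"
    using nonneg by (intro nn_integral_cong) simp
  with fin have int: "integrable (count_space A) f" by (intro integrableI_bounded) auto
  then have abs: "Infinite_Set_Sum.abs_summable_on f A" by (simp add: abs_summable_on_def)
  have "enn2real (\<integral>\<^sup>+a. ennreal (f a) \<partial>count_space A) = infsum f A"
    using nonneg integral_eq_nn_integral[of f "count_space A"]
    by (simp add: infsetsum_infsum[OF abs, symmetric] infsetsum_def AE_count_space)
  moreover have "f summable_on A"
    using abs abs_summable_equivalent[of f A] abs_summable_summable by blast
  ultimately show ?thesis by (simp add: has_sum_infsum)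
qed

section \<open>Weighted branching processes\<close>

text \<open>All label sequences of length n, on the tree or not. Sequences off the tree will have
  \<open>weight\<close> 0, so that a sum over a generation has a deterministic countable index set
  and can be exchanged with expectations.\<close>

definition level :: "nat \<Rightarrow> 'l list set" where
  "level n = {u. length u = n}"

primrec weight :: "('m \<Rightarrow> 'l \<Rightarrow> real) \<Rightarrow> ('l list \<Rightarrow> 'm) \<Rightarrow> 'l list \<Rightarrow> real" where
  "weight y e [] = 1"
| "weight y e (i # u) = weight y e u * y (e u) i"

text \<open>The individuals from whose environments that of u has to be independent. Weights in the
  generation of u depend on strictly shorter sequences only, so these coordinates determine them
  together with the environments of all other members of that generation.\<close>

definition others :: "'l list \<Rightarrow> 'l list set" where
  "others u = {v. v \<noteq> u \<and> length v \<le> length u}"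

lemma level_0: "level 0 = {[]}"
  by (auto simp: level_def)

lemma weight_restrict:
  "{v. length v < length u} \<subseteq> J \<Longrightarrow> weight y (restrict e J) u = weight y e u"
proof (induction u)
  case (Cons i u)
  then have "{v. length v < length u} \<subseteq> J" "u \<in> J" by auto
  with Cons.IH show ?case by simp
qed simp

lemma nn_integral_level_Suc:
  fixes f :: "'l::countable list \<Rightarrow> ennreal"
  shows "(\<integral>\<^sup>+u. f u \<partial>count_space (level (Suc n))) =
    (\<integral>\<^sup>+v. (\<integral>\<^sup>+i. f (i # v) \<partial>count_space UNIV) \<partial>count_space (level n))"
proof -
  interpret sigma_finite_measure "count_space (UNIV :: 'l set)"
    by (rule sigma_finite_measure_count_space_countable) simp
  let ?g = "\<lambda>(v, i). i # v"
  have "bij_betw ?g (level n \<times> UNIV) (level (Suc n))"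
    by (rule bij_betwI[where g = "\<lambda>u. (tl u, hd u)"]) (auto simp: level_def length_Suc_conv)
  from nn_integral_bij_count_space[OF this, of f, symmetric]
  have "(\<integral>\<^sup>+u. f u \<partial>count_space (level (Suc n))) = (\<integral>\<^sup>+p. f (?g p) \<partial>count_space (level n \<times> UNIV))" .
  also have "count_space (level n \<times> UNIV) = count_space (level n :: 'l list set) \<Otimes>\<^sub>M count_space (UNIV :: 'l set)"
    by (rule pair_measure_countable[symmetric]) auto
  also have "(\<integral>\<^sup>+p. f (?g p) \<partial>(count_space (level n :: 'l list set) \<Otimes>\<^sub>M count_space (UNIV :: 'l set))) =
    (\<integral>\<^sup>+v. (\<integral>\<^sup>+i. f (?g (v, i)) \<partial>count_space UNIV) \<partial>count_space (level n))"
    by (rule nn_integral_fst[symmetric]) (simp add: pair_measure_countable)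
  finally show ?thesis by simp
qed

text \<open>In \<open>step\<close>, X has under Q the size-biased law of the logarithm of a child's
  weight; it will be ln Z. The restriction to f at most 1 reflects that the law of Z is given
  through bounded functions. The case f = 1 says that the children of a node have expected total
  weight 1.\<close>

locale weighted_branching = prob_space P
  for P :: "'w measure" +
  fixes S :: "'m measure" and N :: "'l::countable list \<Rightarrow> 'w \<Rightarrow> 'm" and y :: "'m \<Rightarrow> 'l \<Rightarrow> real"
    and Q :: "'z measure" and X :: "'z \<Rightarrow> real"
  assumes indep: "indep_vars (\<lambda>_. S) N UNIV"
    and ident: "\<And>u. distr P S (N u) = distr P S (N [])"
    and y_meas [measurable]: "\<And>i. (\<lambda>\<mu>. y \<mu> i) \<in> borel_measurable S"
    and y_nonneg: "\<And>\<mu> i. 0 \<le> y \<mu> i"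
    and prob_space_Q: "prob_space Q" and X_meas [measurable]: "X \<in> borel_measurable Q"
    and step: "\<And>f :: real \<Rightarrow> ennreal. f \<in> borel_measurable borel \<Longrightarrow> (\<And>x. f x \<le> 1) \<Longrightarrow>
      (\<integral>\<^sup>+\<omega>. (\<integral>\<^sup>+i. ennreal (y (N [] \<omega>) i) * f (ln (y (N [] \<omega>) i)) \<partial>count_space UNIV) \<partial>P) = (\<integral>\<^sup>+\<zeta>. f (X \<zeta>) \<partial>Q)"
begin

sublocale Q: prob_space Q by (rule prob_space_Q)

abbreviation wt :: "'w \<Rightarrow> 'l list \<Rightarrow> real" where
  "wt \<omega> u \<equiv> weight y (\<lambda>v. N v \<omega>) u"

abbreviation env :: "'l list \<Rightarrow> 'w \<Rightarrow> 'l list \<Rightarrow> 'm" where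
  "env u \<omega> \<equiv> restrict (\<lambda>v. N v \<omega>) (others u)"

lemma N_meas [measurable]: "N u \<in> P \<rightarrow>\<^sub>M S"
  using indep by (auto simp: indep_vars_def)

lemma weight_nonneg [simp]: "0 \<le> weight y e u"
  by (induction u) (auto simp: y_nonneg)

lemma wt_env: "length v \<le> length u \<Longrightarrow> weight y (env u \<omega>) v = wt \<omega> v"
  by (rule weight_restrict) (auto simp: others_def)

lemma measurable_weight_PiM:
  "{v. length v < length u} \<subseteq> J \<Longrightarrow> (\<lambda>e. weight y e u) \<in> borel_measurable (PiM J (\<lambda>_. S))"
proof (induction u)
  case (Cons i u)
  have "u \<in> J" using Cons.prems by auto
  then have "(\<lambda>e. y (e u) i) \<in> borel_measurable (PiM J (\<lambda>_. S))"
    by (intro measurable_compose[OF measurable_component_singleton[where M = "\<lambda>_. S"] y_meas])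
  moreover have "(\<lambda>e. weight y e u) \<in> borel_measurable (PiM J (\<lambda>_. S))"
    using Cons.prems by (intro Cons.IH) auto
  ultimately show ?case by simp
qed simp

lemma measurable_wt [measurable]: "(\<lambda>\<omega>. wt \<omega> u) \<in> borel_measurable P"
proof (induction u)
  case (Cons i u)
  have "(\<lambda>\<omega>. y (N u \<omega>) i) \<in> borel_measurable P" by (rule measurable_compose[OF N_meas y_meas])
  with Cons show ?case by simp
qed simp

text \<open>The index blocks \<open>others u\<close> and {u} are disjoint, so the two components are
  independent, and \<open>ident\<close> replaces the law of \<open>N u\<close> by that of
  \<open>N []\<close>.\<close>

lemma distr_node:
  "distr P (PiM (others u) (\<lambda>_. S) \<Otimes>\<^sub>M S) (\<lambda>\<omega>. (env u \<omega>, N u \<omega>)) =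
    distr P (PiM (others u) (\<lambda>_. S)) (env u) \<Otimes>\<^sub>M distr P S (N [])"
proof -
  let ?O = "PiM (others u) (\<lambda>_. S)" and ?U = "PiM {u} (\<lambda>_. S)" and ?r = "\<lambda>\<omega>. restrict (\<lambda>v. N v \<omega>) {u}"
  have ind: "indep_var ?O (env u) ?U ?r"
    by (rule indep_var_restrict[OF indep]) (auto simp: others_def)
  have [measurable]: "env u \<in> P \<rightarrow>\<^sub>M ?O" "?r \<in> P \<rightarrow>\<^sub>M ?U"
    using ind by (auto dest: indep_var_rv1 indep_var_rv2)
  have comp [measurable]: "(\<lambda>e. e u) \<in> ?U \<rightarrow>\<^sub>M S"
    by (rule measurable_component_singleton[where M = "\<lambda>_. S"]) simp
  have 1: "distr P ?O (env u) = distr (distr P ?O (env u)) ?O (\<lambda>x. x)"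
    by (subst distr_distr) (auto simp: comp_def)
  have 2: "distr P S (N []) = distr (distr P ?U ?r) S (\<lambda>e. e u)"
    by (subst distr_distr) (auto simp: comp_def ident[of u])
  interpret R: prob_space "distr P S (N [])" by (rule prob_space_distr) simp
  have "distr P ?O (env u) \<Otimes>\<^sub>M distr P S (N []) =
      distr (distr P ?O (env u)) ?O (\<lambda>x. x) \<Otimes>\<^sub>M distr (distr P ?U ?r) S (\<lambda>e. e u)"
    using 1 2 by simp
  also have "\<dots> = distr (distr P ?O (env u) \<Otimes>\<^sub>M distr P ?U ?r) (?O \<Otimes>\<^sub>M S) (\<lambda>(x, e). (x, e u))"
    by (rule pair_measure_distr) (auto simp: 2[symmetric] R.sigma_finite_measure_axioms)
  also have "distr P ?O (env u) \<Otimes>\<^sub>M distr P ?U ?r = distr P (?O \<Otimes>\<^sub>M ?U) (\<lambda>\<omega>. (env u \<omega>, ?r \<omega>))"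
    using ind unfolding indep_var_distribution_eq by simp
  also have "distr (distr P (?O \<Otimes>\<^sub>M ?U) (\<lambda>\<omega>. (env u \<omega>, ?r \<omega>))) (?O \<Otimes>\<^sub>M S) (\<lambda>(x, e). (x, e u)) =
      distr P (?O \<Otimes>\<^sub>M S) (\<lambda>\<omega>. (env u \<omega>, N u \<omega>))"
    by (subst distr_distr) (auto simp: comp_def)
  finally show ?thesis by (rule sym)
qed

lemma measurable_env [measurable]: "env u \<in> P \<rightarrow>\<^sub>M PiM (others u) (\<lambda>_. S)"
  by (rule measurable_restrict) simp

text \<open>Conditioning on \<open>env u\<close>, written as an iterated integral: the environment
  of u becomes a fresh copy on a second coordinate \<omega>'.\<close>

lemma nn_integral_node:
  assumes k [measurable]: "k \<in> borel_measurable (PiM (others u) (\<lambda>_. S) \<Otimes>\<^sub>M S)"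
  shows "(\<integral>\<^sup>+\<omega>. k (env u \<omega>, N u \<omega>) \<partial>P) = (\<integral>\<^sup>+\<omega>. (\<integral>\<^sup>+\<omega>'. k (env u \<omega>, N [] \<omega>') \<partial>P) \<partial>P)"
proof -
  let ?O = "PiM (others u) (\<lambda>_. S)"
  interpret R: prob_space "distr P S (N [])" by (rule prob_space_distr) simp
  have "(\<integral>\<^sup>+\<omega>. k (env u \<omega>, N u \<omega>) \<partial>P) = (\<integral>\<^sup>+p. k p \<partial>distr P (?O \<Otimes>\<^sub>M S) (\<lambda>\<omega>. (env u \<omega>, N u \<omega>)))"
    by (rule nn_integral_distr[symmetric]) auto
  also have "\<dots> = (\<integral>\<^sup>+x. (\<integral>\<^sup>+\<mu>. k (x, \<mu>) \<partial>distr P S (N [])) \<partial>distr P ?O (env u))"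
    unfolding distr_node by (rule R.nn_integral_fst[symmetric]) simp
  also have "\<dots> = (\<integral>\<^sup>+\<omega>. (\<integral>\<^sup>+\<mu>. k (env u \<omega>, \<mu>) \<partial>distr P S (N [])) \<partial>P)"
    by (rule nn_integral_distr) auto
  also have "\<dots> = (\<integral>\<^sup>+\<omega>. (\<integral>\<^sup>+\<omega>'. k (env u \<omega>, N [] \<omega>') \<partial>P) \<partial>P)"
    using measurable_space[OF measurable_env[of u]]
    by (intro nn_integral_cong nn_integral_distr) auto
  finally show ?thesis .
qed

lemma integral_node:
  fixes k :: "_ \<Rightarrow> real"
  assumes k [measurable]: "k \<in> borel_measurable (PiM (others u) (\<lambda>_. S) \<Otimes>\<^sub>M S)"
    and bound: "\<And>p. \<bar>k p\<bar> \<le> c"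
  shows "(\<integral>\<omega>. k (env u \<omega>, N u \<omega>) \<partial>P) = (\<integral>\<omega>. (\<integral>\<omega>'. k (env u \<omega>, N [] \<omega>') \<partial>P) \<partial>P)"
proof -
  let ?O = "PiM (others u) (\<lambda>_. S)"
  interpret L: prob_space "distr P ?O (env u)" by (rule prob_space_distr) simp
  interpret R: prob_space "distr P S (N [])" by (rule prob_space_distr) simp
  interpret LR: pair_prob_space "distr P ?O (env u)" "distr P S (N [])" ..
  have "(\<integral>\<omega>. k (env u \<omega>, N u \<omega>) \<partial>P) = (\<integral>p. k p \<partial>distr P (?O \<Otimes>\<^sub>M S) (\<lambda>\<omega>. (env u \<omega>, N u \<omega>)))"
    by (rule integral_distr[symmetric]) auto
  also have "\<dots> = (\<integral>x. (\<integral>\<mu>. k (x, \<mu>) \<partial>distr P S (N [])) \<partial>distr P ?O (env u))"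
    unfolding distr_node using bound
    by (intro LR.integral_fst'[symmetric] LR.P.integrable_const_bound[of _ c]) auto
  also have "\<dots> = (\<integral>\<omega>. (\<integral>\<mu>. k (env u \<omega>, \<mu>) \<partial>distr P S (N [])) \<partial>P)"
    by (rule integral_distr) auto
  also have "\<dots> = (\<integral>\<omega>. (\<integral>\<omega>'. k (env u \<omega>, N [] \<omega>') \<partial>P) \<partial>P)"
    using measurable_space[OF measurable_env[of u]]
    by (intro Bochner_Integration.integral_cong refl integral_distr) auto
  finally show ?thesis .
qed

lemma nn_integral_wt_node:
  assumes [measurable]: "k \<in> borel_measurable (borel \<Otimes>\<^sub>M S)"
  shows "(\<integral>\<^sup>+\<omega>. k (wt \<omega> u, N u \<omega>) \<partial>P) = (\<integral>\<^sup>+\<omega>. (\<integral>\<^sup>+\<omega>'. k (wt \<omega> u, N [] \<omega>') \<partial>P) \<partial>P)"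
proof -
  have [measurable]: "(\<lambda>e. weight y e u) \<in> borel_measurable (PiM (others u) (\<lambda>_. S))"
    by (rule measurable_weight_PiM) (auto simp: others_def)
  show ?thesis
    using nn_integral_node[of "\<lambda>p. k (weight y (fst p) u, snd p)" u] by (simp add: wt_env)
qed

section \<open>The many-to-one formula\<close>

definition level_sum :: "nat \<Rightarrow> (real \<Rightarrow> ennreal) \<Rightarrow> ennreal" where
  "level_sum n f = (\<integral>\<^sup>+\<omega>. (\<integral>\<^sup>+u. ennreal (wt \<omega> u) * f (ln (wt \<omega> u)) \<partial>count_space (level n)) \<partial>P)"

lemma level_sum_swap:
  assumes [measurable]: "f \<in> borel_measurable borel"
  shows "level_sum n f = (\<integral>\<^sup>+u. (\<integral>\<^sup>+\<omega>. ennreal (wt \<omega> u) * f (ln (wt \<omega> u)) \<partial>P) \<partial>count_space (level n))"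
  unfolding level_sum_def
  by (rule nn_integral_count_space_swap) (auto simp: sigma_finite_measure_axioms)

text \<open>Taking logarithms, the parent's weight x becomes a shift by ln x. Children of weight 0
  are removed by the factor in front of f, so the default value of ln at 0 does no harm.\<close>

lemma step_scaled:
  assumes f [measurable]: "f \<in> borel_measurable borel" and f1: "\<And>x. f x \<le> 1" and x: "0 \<le> x"
  shows "(\<integral>\<^sup>+\<omega>. (\<integral>\<^sup>+i. ennreal (x * y (N [] \<omega>) i) * f (ln (x * y (N [] \<omega>) i)) \<partial>count_space UNIV) \<partial>P) =
    ennreal x * (\<integral>\<^sup>+\<zeta>. f (ln x + X \<zeta>) \<partial>Q)"
proof (cases "x = 0")
  case False
  with x have x: "0 < x" by simp
  have "(\<integral>\<^sup>+\<omega>. (\<integral>\<^sup>+i. ennreal (x * y (N [] \<omega>) i) * f (ln (x * y (N [] \<omega>) i)) \<partial>count_space UNIV) \<partial>P) =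
    (\<integral>\<^sup>+\<omega>. (\<integral>\<^sup>+i. ennreal x * (ennreal (y (N [] \<omega>) i) * f (ln x + ln (y (N [] \<omega>) i))) \<partial>count_space UNIV) \<partial>P)"
  proof (intro nn_integral_cong)
    fix \<omega> i
    show "ennreal (x * y (N [] \<omega>) i) * f (ln (x * y (N [] \<omega>) i)) =
        ennreal x * (ennreal (y (N [] \<omega>) i) * f (ln x + ln (y (N [] \<omega>) i)))"
      using x y_nonneg[of "N [] \<omega>" i]
      by (cases "y (N [] \<omega>) i = 0") (auto simp: ennreal_mult ln_mult mult.assoc)
  qed
  also have "\<dots> = (\<integral>\<^sup>+\<omega>. ennreal x * (\<integral>\<^sup>+i. ennreal (y (N [] \<omega>) i) * f (ln x + ln (y (N [] \<omega>) i)) \<partial>count_space UNIV) \<partial>P)"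
    by (simp add: nn_integral_cmult)
  also have "\<dots> = ennreal x * (\<integral>\<^sup>+\<omega>. (\<integral>\<^sup>+i. ennreal (y (N [] \<omega>) i) * f (ln x + ln (y (N [] \<omega>) i)) \<partial>count_space UNIV) \<partial>P)"
  proof (rule nn_integral_cmult, rule borel_measurable_nn_integral_count_space)
    fix i :: 'l
    have "(\<lambda>\<omega>. y (N [] \<omega>) i) \<in> borel_measurable P" by (rule measurable_compose[OF N_meas y_meas])
    then show "(\<lambda>\<omega>. ennreal (y (N [] \<omega>) i) * f (ln x + ln (y (N [] \<omega>) i))) \<in> borel_measurable P" by measurable
  qed simp
  also have "(\<integral>\<^sup>+\<omega>. (\<integral>\<^sup>+i. ennreal (y (N [] \<omega>) i) * f (ln x + ln (y (N [] \<omega>) i)) \<partial>count_space UNIV) \<partial>P) =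
      (\<integral>\<^sup>+\<zeta>. f (ln x + X \<zeta>) \<partial>Q)"
    using step[of "\<lambda>t. f (ln x + t)"] f1 by simp
  finally show ?thesis .
qed simp

text \<open>The last generation is integrated out first. Given the weight of the parent v, a child's
  logarithmic weight is that of v plus an independent displacement, and the size-biasing by
  \<open>wt\<close> gives this displacement the law of X.\<close>

lemma level_sum_Suc:
  assumes f [measurable]: "f \<in> borel_measurable borel" and f1: "\<And>x. f x \<le> 1"
  shows "level_sum (Suc n) f = level_sum n (\<lambda>t. \<integral>\<^sup>+\<zeta>. f (t + X \<zeta>) \<partial>Q)"
proof -
  define k where "k p = (\<integral>\<^sup>+i. ennreal (fst p * y (snd p) i) * f (ln (fst p * y (snd p) i)) \<partial>count_space UNIV)"
    for p :: "real \<times> 'm"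
  have k [measurable]: "k \<in> borel_measurable (borel \<Otimes>\<^sub>M S)"
    unfolding k_def
  proof (rule borel_measurable_nn_integral_count_space)
    fix i :: 'l
    have "(\<lambda>p. y (snd p) i) \<in> borel_measurable (borel \<Otimes>\<^sub>M S)" by (rule measurable_compose[OF measurable_snd y_meas])
    then show "(\<lambda>p. ennreal (fst p * y (snd p) i) * f (ln (fst p * y (snd p) i))) \<in> borel_measurable (borel \<Otimes>\<^sub>M S)"
      by measurable
  qed simp
  have "level_sum (Suc n) f = (\<integral>\<^sup>+\<omega>. (\<integral>\<^sup>+v. k (wt \<omega> v, N v \<omega>) \<partial>count_space (level n)) \<partial>P)"
    unfolding level_sum_def nn_integral_level_Suc by (simp add: k_def)
  also have "\<dots> = (\<integral>\<^sup>+v. (\<integral>\<^sup>+\<omega>. k (wt \<omega> v, N v \<omega>) \<partial>P) \<partial>count_space (level n))"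
    by (rule nn_integral_count_space_swap) (auto simp: sigma_finite_measure_axioms)
  also have "\<dots> = (\<integral>\<^sup>+v. (\<integral>\<^sup>+\<omega>. ennreal (wt \<omega> v) * (\<integral>\<^sup>+\<zeta>. f (ln (wt \<omega> v) + X \<zeta>) \<partial>Q) \<partial>P) \<partial>count_space (level n))"
    unfolding nn_integral_wt_node[OF k]
    by (intro nn_integral_cong) (simp add: k_def step_scaled[OF f f1])
  also have "\<dots> = level_sum n (\<lambda>t. \<integral>\<^sup>+\<zeta>. f (t + X \<zeta>) \<partial>Q)"
    by (rule level_sum_swap[symmetric]) simp
  finally show ?thesis .
qed

lemma level_sum_0: "level_sum 0 f = f 0"
  by (simp add: level_sum_def level_0 nn_integral_count_space_finite emeasure_space_1)

lemma level_sum_1: "level_sum n (\<lambda>_. 1) = 1"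
  by (induction n) (simp_all add: level_sum_0 level_sum_Suc Q.emeasure_space_1)

text \<open>Each generation removed at the leaves lengthens the walk by one step, hence the
  induction for general k.\<close>

lemma level_sum_walk_tail: "level_sum n (\<lambda>t. walk_tail Q X k (s + t)) = walk_tail Q X (n + k) s"
proof (induction n arbitrary: k)
  case (Suc n)
  have "level_sum (Suc n) (\<lambda>t. walk_tail Q X k (s + t)) = level_sum n (\<lambda>t. walk_tail Q X (Suc k) (s + t))"
    by (subst level_sum_Suc) (auto simp: Q.walk_tail_le_1 add.assoc)
  then show ?case using Suc[of "Suc k"] by simp
qed (simp add: level_sum_0)

lemma many_to_one:
  "(\<integral>\<^sup>+\<omega>. (\<integral>\<^sup>+u. ennreal (wt \<omega> u) * indicator {0<..} (s + ln (wt \<omega> u)) \<partial>count_space (level n)) \<partial>P) = walk_tail Q X n s"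
  using level_sum_walk_tail[of n 0 s] by (simp add: level_sum_def)

section \<open>Total masses and martingale increments\<close>

definition mass :: "'m \<Rightarrow> ennreal" where
  "mass \<mu> = (\<integral>\<^sup>+i. ennreal (y \<mu> i) \<partial>count_space UNIV)"

text \<open>At \<open>N u\<close> this is the U of the overview, a copy of W_1. It is 0 where
  \<open>mass\<close> is infinite, which \<open>AE_mass_finite\<close> shows to be a null
  event.\<close>

definition total :: "'m \<Rightarrow> real" where
  "total \<mu> = enn2real (mass \<mu>)"

definition level_mass :: "nat \<Rightarrow> 'w \<Rightarrow> ennreal" where
  "level_mass n \<omega> = (\<integral>\<^sup>+u. ennreal (wt \<omega> u) \<partial>count_space (level n))"

definition level_total :: "nat \<Rightarrow> 'w \<Rightarrow> real" where
  "level_total n \<omega> = enn2real (level_mass n \<omega>)"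

lemma measurable_mass [measurable]: "mass \<in> borel_measurable S"
  unfolding mass_def by (rule borel_measurable_nn_integral_count_space) auto

lemma measurable_total [measurable]: "total \<in> borel_measurable S"
  unfolding total_def by measurable

lemma total_nonneg [simp]: "0 \<le> total \<mu>"
  by (simp add: total_def)

lemma measurable_level_mass [measurable]: "level_mass n \<in> borel_measurable P"
  unfolding level_mass_def by (rule borel_measurable_nn_integral_count_space) auto

lemma measurable_level_total [measurable]: "level_total n \<in> borel_measurable P"
  unfolding level_total_def by measurable

lemma nn_integral_N:
  assumes [measurable]: "f \<in> borel_measurable S"
  shows "(\<integral>\<^sup>+\<omega>. f (N u \<omega>) \<partial>P) = (\<integral>\<^sup>+\<omega>. f (N [] \<omega>) \<partial>P)"
  using nn_integral_distr[OF N_meas, of f u] nn_integral_distr[OF N_meas, of f "[]"] ident[of u] by simp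

lemma nn_integral_mass: "(\<integral>\<^sup>+\<omega>. mass (N u \<omega>) \<partial>P) = 1"
proof -
  have "(\<integral>\<^sup>+\<omega>. mass (N [] \<omega>) \<partial>P) = 1"
    using step[of "\<lambda>_. 1"] by (simp add: mass_def Q.emeasure_space_1)
  then show ?thesis using nn_integral_N[OF measurable_mass, of u] by simp
qed

lemma AE_mass_finite: "AE \<omega> in P. \<forall>u. mass (N u \<omega>) < \<infinity>"
  unfolding AE_all_countable
proof
  fix u
  have "AE \<omega> in P. mass (N u \<omega>) \<noteq> \<infinity>"
    by (rule nn_integral_PInf_AE) (simp_all add: nn_integral_mass)
  then show "AE \<omega> in P. mass (N u \<omega>) < \<infinity>" by (simp add: less_top)
qed

lemma nn_integral_total: "(\<integral>\<^sup>+\<omega>. ennreal (total (N u \<omega>)) \<partial>P) = 1"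
proof -
  have "(\<integral>\<^sup>+\<omega>. ennreal (total (N u \<omega>)) \<partial>P) = (\<integral>\<^sup>+\<omega>. mass (N u \<omega>) \<partial>P)"
    using AE_mass_finite by (intro nn_integral_cong_AE) (auto simp: total_def)
  then show ?thesis by (simp add: nn_integral_mass)
qed

lemma nn_integral_level_mass: "(\<integral>\<^sup>+\<omega>. level_mass n \<omega> \<partial>P) = 1"
  using level_sum_1[of n] by (simp add: level_sum_def level_mass_def)

lemma AE_level_mass_finite: "AE \<omega> in P. \<forall>n. level_mass n \<omega> < \<infinity>"
  unfolding AE_all_countable
proof
  fix n
  have "AE \<omega> in P. level_mass n \<omega> \<noteq> \<infinity>"
    by (rule nn_integral_PInf_AE) (simp_all add: nn_integral_level_mass)
  then show "AE \<omega> in P. level_mass n \<omega> < \<infinity>" by (simp add: less_top)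
qed

lemma level_mass_Suc: "level_mass (Suc n) \<omega> = (\<integral>\<^sup>+v. ennreal (wt \<omega> v) * mass (N v \<omega>) \<partial>count_space (level n))"
  unfolding level_mass_def nn_integral_level_Suc mass_def
  by (intro nn_integral_cong) (simp add: ennreal_mult y_nonneg nn_integral_cmult)

text \<open>Almost surely both generation sums converge absolutely, so their difference can be
  summed over the parents in any order. A fixed order yields finite sums, for which expectations can
  be estimated.\<close>

lemma AE_level_total_diff:
  "AE \<omega> in P. \<forall>n. (\<lambda>k. \<Sum>u\<in>initial_part (level n) k. wt \<omega> u * (total (N u \<omega>) - 1))
    \<longlonglongrightarrow> level_total (Suc n) \<omega> - level_total n \<omega>"
  using AE_mass_finite AE_level_mass_finite
proof eventually_elim
  case (elim \<omega>)
  show ?case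
  proof
    fix n
    have eq: "level_mass (Suc n) \<omega> = (\<integral>\<^sup>+v. ennreal (wt \<omega> v * total (N v \<omega>)) \<partial>count_space (level n))"
      unfolding level_mass_Suc using elim(1) by (intro nn_integral_cong) (simp add: ennreal_mult total_def)
    have "((\<lambda>v. wt \<omega> v * total (N v \<omega>)) has_sum level_total (Suc n) \<omega>) (level n)"
      unfolding level_total_def eq using elim(2) by (intro has_sum_enn2real) (auto simp flip: eq)
    moreover have "((\<lambda>v. wt \<omega> v) has_sum level_total n \<omega>) (level n)"
      unfolding level_total_def level_mass_def
      using elim(2) by (intro has_sum_enn2real) (auto simp flip: level_mass_def)
    then have "((\<lambda>v. - wt \<omega> v) has_sum - level_total n \<omega>) (level n)"
      by (simp add: has_sum_uminus)
    ultimately have "((\<lambda>v. wt \<omega> v * total (N v \<omega>) + - wt \<omega> v) has_sum (level_total (Suc n) \<omega> + - level_total n \<omega>)) (level n)"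
      by (rule has_sum_add)
    then have "(sum (\<lambda>v. wt \<omega> v * (total (N v \<omega>) - 1)) \<longlongrightarrow> level_total (Suc n) \<omega> - level_total n \<omega>)
        (finite_subsets_at_top (level n))"
      by (simp add: has_sum_def algebra_simps)
    from filterlim_compose[OF this filterlim_initial_part]
    show "(\<lambda>k. \<Sum>u\<in>initial_part (level n) k. wt \<omega> u * (total (N u \<omega>) - 1))
      \<longlonglongrightarrow> level_total (Suc n) \<omega> - level_total n \<omega>" .
  qed
qed

section \<open>Truncation of the increments\<close>

definition excess :: "real \<Rightarrow> real \<Rightarrow> ennreal" where
  "excess c x = (\<integral>\<^sup>+\<omega>. ennreal (x * total (N [] \<omega>)) * indicator {c<..} (x * total (N [] \<omega>)) \<partial>P)"

text \<open>This is E[U; S_n + ln U > ln c] for a copy U of W_1 independent of the walk S;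
  \<open>sum_excess\<close> identifies it with the expected mass that truncation at c removes from
  generation n.\<close>

definition level_excess :: "nat \<Rightarrow> real \<Rightarrow> ennreal" where
  "level_excess n c = (\<integral>\<^sup>+\<omega>. ennreal (total (N [] \<omega>)) * walk_tail Q X n (ln (total (N [] \<omega>)) - ln c) \<partial>P)"

lemma measurable_excess [measurable]: "excess c \<in> borel_measurable borel"
  unfolding excess_def by measurable

lemma nn_integral_excess_node:
  "(\<integral>\<^sup>+\<omega>. ennreal (wt \<omega> u * total (N u \<omega>)) * indicator {c<..} (wt \<omega> u * total (N u \<omega>)) \<partial>P) =
    (\<integral>\<^sup>+\<omega>. excess c (wt \<omega> u) \<partial>P)"
  using nn_integral_wt_node[of "\<lambda>p. ennreal (fst p * total (snd p)) * indicator {c<..} (fst p * total (snd p))" u]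
  by (simp add: excess_def)

text \<open>The copy U lives on a coordinate \<omega>' of its own and can be frozen. For a weight Y
  the condition c < Y U then reads ln U - ln c + ln Y > 0, the event in \<open>many_to_one\<close>;
  terms with Y = 0 or U = 0 vanish on both sides.\<close>

lemma sum_excess:
  assumes c: "0 < c"
  shows "(\<integral>\<^sup>+u. (\<integral>\<^sup>+\<omega>. excess c (wt \<omega> u) \<partial>P) \<partial>count_space (level n)) = level_excess n c"
proof -
  interpret PP: pair_sigma_finite P P ..
  let ?k = "\<lambda>u \<omega> \<omega>'. ennreal (wt \<omega> u * total (N [] \<omega>')) * indicator {c<..} (wt \<omega> u * total (N [] \<omega>'))"
  have "(\<integral>\<^sup>+u. (\<integral>\<^sup>+\<omega>. excess c (wt \<omega> u) \<partial>P) \<partial>count_space (level n)) =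
    (\<integral>\<^sup>+u. (\<integral>\<^sup>+\<omega>'. (\<integral>\<^sup>+\<omega>. ?k u \<omega> \<omega>' \<partial>P) \<partial>P) \<partial>count_space (level n))"
    unfolding excess_def by (intro nn_integral_cong PP.Fubini'[symmetric]) measurable
  also have "\<dots> = (\<integral>\<^sup>+\<omega>'. (\<integral>\<^sup>+u. (\<integral>\<^sup>+\<omega>. ?k u \<omega> \<omega>' \<partial>P) \<partial>count_space (level n)) \<partial>P)"
    by (intro nn_integral_count_space_swap[symmetric] sigma_finite_measure_axioms) auto
  also have "\<dots> = (\<integral>\<^sup>+\<omega>'. (\<integral>\<^sup>+\<omega>. (\<integral>\<^sup>+u. ?k u \<omega> \<omega>' \<partial>count_space (level n)) \<partial>P) \<partial>P)"
    by (intro nn_integral_cong nn_integral_count_space_swap[symmetric] sigma_finite_measure_axioms) auto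
  also have "\<dots> = level_excess n c"
    unfolding level_excess_def
  proof (rule nn_integral_cong)
    fix \<omega>' assume "\<omega>' \<in> space P"
    let ?t = "total (N [] \<omega>')"
    have "?k u \<omega> \<omega>' = ennreal ?t * (ennreal (wt \<omega> u) * indicator {0<..} (ln ?t - ln c + ln (wt \<omega> u)))" for u \<omega>
    proof (cases "wt \<omega> u = 0 \<or> ?t = 0")
      case False
      then have pos: "0 < wt \<omega> u" "0 < ?t"
        using weight_nonneg[of "\<lambda>v. N v \<omega>" u] total_nonneg[of "N [] \<omega>'"] by (auto simp: less_le simp del: weight_nonneg total_nonneg)
      then have "c < wt \<omega> u * ?t \<longleftrightarrow> ln c < ln (wt \<omega> u * ?t)" using c by (subst ln_less_cancel_iff) auto
      also have "\<dots> \<longleftrightarrow> 0 < ln ?t - ln c + ln (wt \<omega> u)" using pos by (auto simp: ln_mult)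
      finally show ?thesis using pos by (simp add: ennreal_mult mult_ac split: split_indicator)
    qed auto
    then have "(\<integral>\<^sup>+\<omega>. (\<integral>\<^sup>+u. ?k u \<omega> \<omega>' \<partial>count_space (level n)) \<partial>P) =
      (\<integral>\<^sup>+\<omega>. ennreal ?t * (\<integral>\<^sup>+u. ennreal (wt \<omega> u) * indicator {0<..} (ln ?t - ln c + ln (wt \<omega> u)) \<partial>count_space (level n)) \<partial>P)"
      by (simp add: nn_integral_cmult)
    also have "\<dots> = ennreal ?t * (\<integral>\<^sup>+\<omega>. (\<integral>\<^sup>+u. ennreal (wt \<omega> u) * indicator {0<..} (ln ?t - ln c + ln (wt \<omega> u)) \<partial>count_space (level n)) \<partial>P)"
      by (intro nn_integral_cmult borel_measurable_nn_integral_count_space) auto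
    finally show "(\<integral>\<^sup>+\<omega>. (\<integral>\<^sup>+u. ?k u \<omega> \<omega>' \<partial>count_space (level n)) \<partial>P) =
        ennreal ?t * walk_tail Q X n (ln ?t - ln c)"
      by (simp add: many_to_one)
  qed
  finally show ?thesis .
qed

text \<open>Values above c are replaced by 0 rather than by c, so that
  \<open>x * total \<mu>\<close> is exactly the sum of its cut part and the quantity integrated in
  \<open>excess\<close>.\<close>

definition cut :: "real \<Rightarrow> real \<Rightarrow> 'm \<Rightarrow> real" where
  "cut c x \<mu> = (if x * total \<mu> \<le> c then x * total \<mu> else 0)"

definition mean_cut :: "real \<Rightarrow> real \<Rightarrow> real" where
  "mean_cut c x = (\<integral>\<omega>. cut c x (N [] \<omega>) \<partial>P)"

text \<open>The mean is taken for a given weight x, so that it is a conditional mean; this makes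
  distinct members of a generation orthogonal.\<close>

definition centered :: "real \<Rightarrow> real \<Rightarrow> 'm \<Rightarrow> real" where
  "centered c x \<mu> = cut c x \<mu> - mean_cut c x"

lemma measurable_cut [measurable (raw)]:
  assumes [measurable]: "f \<in> borel_measurable M" "g \<in> M \<rightarrow>\<^sub>M S"
  shows "(\<lambda>z. cut c (f z) (g z)) \<in> borel_measurable M"
  unfolding cut_def by measurable

lemma measurable_mean_cut [measurable]: "mean_cut c \<in> borel_measurable borel"
  unfolding mean_cut_def by measurable

lemma measurable_centered [measurable (raw)]:
  assumes [measurable]: "f \<in> borel_measurable M" "g \<in> M \<rightarrow>\<^sub>M S"
  shows "(\<lambda>z. centered c (f z) (g z)) \<in> borel_measurable M"
  unfolding centered_def by measurable

lemma cut_bounds: "0 \<le> x \<Longrightarrow> 0 \<le> c \<Longrightarrow> 0 \<le> cut c x \<mu> \<and> cut c x \<mu> \<le> c \<and> cut c x \<mu> \<le> x * total \<mu>"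
  by (simp add: cut_def)

lemma integrable_cut: "0 \<le> x \<Longrightarrow> 0 \<le> c \<Longrightarrow> integrable P (\<lambda>\<omega>. cut c x (N u \<omega>))"
  by (intro integrable_const_bound[of _ c]) (auto simp: cut_bounds)

lemma mean_cut_bounds:
  assumes "0 \<le> x" "0 \<le> c"
  shows "0 \<le> mean_cut c x" "mean_cut c x \<le> c"
proof -
  show "0 \<le> mean_cut c x" unfolding mean_cut_def using cut_bounds[OF assms] by simp
  have "mean_cut c x \<le> (\<integral>\<omega>. c \<partial>P)"
    unfolding mean_cut_def using integrable_cut[OF assms] cut_bounds[OF assms] by (intro integral_mono) auto
  then show "mean_cut c x \<le> c" by (simp add: prob_space)
qed

text \<open>Copies U of W_1 have mean 1, so x = E[x U], and splitting this expectation at the level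
  c gives both claims.\<close>

lemma mean_cut_excess:
  assumes x: "0 \<le> x" and c: "0 \<le> c"
  shows "mean_cut c x \<le> x" "ennreal (x - mean_cut c x) = excess c x"
proof -
  have "ennreal x = (\<integral>\<^sup>+\<omega>. ennreal x * ennreal (total (N [] \<omega>)) \<partial>P)"
    by (subst nn_integral_cmult) (auto simp: nn_integral_total)
  also have "\<dots> = (\<integral>\<^sup>+\<omega>. ennreal (cut c x (N [] \<omega>)) + ennreal (x * total (N [] \<omega>)) * indicator {c<..} (x * total (N [] \<omega>)) \<partial>P)"
    using x by (intro nn_integral_cong) (auto simp: cut_def ennreal_mult split: split_indicator)
  also have "\<dots> = (\<integral>\<^sup>+\<omega>. ennreal (cut c x (N [] \<omega>)) \<partial>P) + excess c x"
    unfolding excess_def by (rule nn_integral_add) auto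
  also have "(\<integral>\<^sup>+\<omega>. ennreal (cut c x (N [] \<omega>)) \<partial>P) = ennreal (mean_cut c x)"
    unfolding mean_cut_def using integrable_cut[OF x c] cut_bounds[OF x c] by (intro nn_integral_eq_integral) auto
  finally have eq: "ennreal x = ennreal (mean_cut c x) + excess c x" .
  then have "ennreal (mean_cut c x) \<le> ennreal x" by simp
  then show le: "mean_cut c x \<le> x" using x by simp
  have "ennreal (x - mean_cut c x) = ennreal x - ennreal (mean_cut c x)"
    using mean_cut_bounds[OF x c] by (simp add: ennreal_minus)
  also have "\<dots> = excess c x" unfolding eq by simp
  finally show "ennreal (x - mean_cut c x) = excess c x" .
qed

lemma centered_bound: "0 \<le> x \<Longrightarrow> 0 \<le> c \<Longrightarrow> \<bar>centered c x \<mu>\<bar> \<le> c"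
  using cut_bounds[of x c \<mu>] mean_cut_bounds[of x c] by (auto simp: centered_def)

lemma integrable_centered: "0 \<le> x \<Longrightarrow> 0 \<le> c \<Longrightarrow> integrable P (\<lambda>\<omega>. centered c x (N [] \<omega>))"
  by (simp add: centered_def integrable_cut)

lemma integral_centered: "0 \<le> x \<Longrightarrow> 0 \<le> c \<Longrightarrow> (\<integral>\<omega>. centered c x (N [] \<omega>) \<partial>P) = 0"
  by (simp add: centered_def integrable_cut mean_cut_def prob_space)

text \<open>Given \<open>env u\<close>, both weights and \<open>N v\<close> are fixed, and the
  factor belonging to u has mean 0. The uniform bound c on each factor provides the integrability
  for Fubini.\<close>

lemma centered_orthogonal:
  assumes uv: "u \<in> level n" "v \<in> level n" "u \<noteq> v" and c: "0 \<le> c"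
  shows "(\<integral>\<omega>. centered c (wt \<omega> u) (N u \<omega>) * centered c (wt \<omega> v) (N v \<omega>) \<partial>P) = 0"
proof -
  let ?k = "\<lambda>p. centered c (weight y (fst p) u) (snd p) * centered c (weight y (fst p) v) (fst p v)"
  have len: "length u = n" "length v = n" and v: "v \<in> others u" using uv by (auto simp: level_def others_def)
  have [measurable]: "(\<lambda>e. weight y e u) \<in> borel_measurable (PiM (others u) (\<lambda>_. S))"
      "(\<lambda>e. weight y e v) \<in> borel_measurable (PiM (others u) (\<lambda>_. S))"
    using len by (auto intro!: measurable_weight_PiM simp: others_def)
  have [measurable]: "(\<lambda>e. e v) \<in> PiM (others u) (\<lambda>_. S) \<rightarrow>\<^sub>M S"
    using v by (rule measurable_component_singleton[where M = "\<lambda>_. S"])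
  have "?k \<in> borel_measurable (PiM (others u) (\<lambda>_. S) \<Otimes>\<^sub>M S)" by measurable
  moreover have "\<bar>?k p\<bar> \<le> c * c" for p
    unfolding abs_mult using c by (intro mult_mono centered_bound) auto
  ultimately have "(\<integral>\<omega>. ?k (env u \<omega>, N u \<omega>) \<partial>P) = (\<integral>\<omega>. (\<integral>\<omega>'. ?k (env u \<omega>, N [] \<omega>') \<partial>P) \<partial>P)"
    by (rule integral_node)
  also have "\<dots> = 0"
    using c by (simp add: integrable_centered integral_centered)
  finally show ?thesis using v len by (simp add: wt_env)
qed

text \<open>In the square one factor is at most c and the other at most Y U + Y, whose mean is twice
  that of Y. Thus first moments alone control the variance.\<close>

lemma nn_integral_centered_square:
  assumes c: "0 \<le> c"
  shows "(\<integral>\<^sup>+\<omega>. ennreal ((centered c (wt \<omega> u) (N u \<omega>))\<^sup>2) \<partial>P) \<le> ennreal (2 * c) * (\<integral>\<^sup>+\<omega>. ennreal (wt \<omega> u) \<partial>P)"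
proof -
  have "(\<integral>\<^sup>+\<omega>. ennreal ((centered c (wt \<omega> u) (N u \<omega>))\<^sup>2) \<partial>P) \<le>
    (\<integral>\<^sup>+\<omega>. ennreal c * (ennreal (wt \<omega> u) * ennreal (total (N u \<omega>)) + ennreal (wt \<omega> u)) \<partial>P)"
  proof (rule nn_integral_mono)
    fix \<omega>
    let ?x = "wt \<omega> u" and ?D = "centered c (wt \<omega> u) (N u \<omega>)"
    have "?D\<^sup>2 = \<bar>?D\<bar> * \<bar>?D\<bar>" by (simp add: power2_eq_square)
    also have "\<dots> \<le> c * (cut c ?x (N u \<omega>) + mean_cut c ?x)"
      using c cut_bounds[of ?x c "N u \<omega>"] mean_cut_bounds[of ?x c]
      by (intro mult_mono centered_bound) (auto simp: centered_def)
    also have "\<dots> \<le> c * (?x * total (N u \<omega>) + ?x)"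
      using c cut_bounds[of ?x c "N u \<omega>"] mean_cut_excess(1)[of ?x c] by (intro mult_left_mono add_mono) auto
    finally have "ennreal (?D\<^sup>2) \<le> ennreal (c * (?x * total (N u \<omega>) + ?x))" by (rule ennreal_leI)
    also have "\<dots> = ennreal c * (ennreal ?x * ennreal (total (N u \<omega>)) + ennreal ?x)"
      using c by (simp add: ennreal_mult)
    finally show "ennreal (?D\<^sup>2) \<le> ennreal c * (ennreal ?x * ennreal (total (N u \<omega>)) + ennreal ?x)" .
  qed
  also have "\<dots> = ennreal c * ((\<integral>\<^sup>+\<omega>. ennreal (wt \<omega> u) * ennreal (total (N u \<omega>)) \<partial>P) + (\<integral>\<^sup>+\<omega>. ennreal (wt \<omega> u) \<partial>P))"
    by (subst nn_integral_cmult) (auto simp: nn_integral_add)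
  also have "(\<integral>\<^sup>+\<omega>. ennreal (wt \<omega> u) * ennreal (total (N u \<omega>)) \<partial>P) = (\<integral>\<^sup>+\<omega>. ennreal (wt \<omega> u) \<partial>P)"
    using nn_integral_wt_node[of "\<lambda>p. ennreal (fst p) * ennreal (total (snd p))" u]
    by (simp add: nn_integral_cmult nn_integral_total)
  also have "ennreal c * ((\<integral>\<^sup>+\<omega>. ennreal (wt \<omega> u) \<partial>P) + (\<integral>\<^sup>+\<omega>. ennreal (wt \<omega> u) \<partial>P)) =
      ennreal (2 * c) * (\<integral>\<^sup>+\<omega>. ennreal (wt \<omega> u) \<partial>P)"
    using c by (simp add: ennreal_mult distrib_left mult_2[symmetric] mult_ac)
  finally show ?thesis .
qed

lemma sum_nn_integral_wt_le:
  assumes "finite F" "F \<subseteq> level n"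
  shows "(\<Sum>u\<in>F. \<integral>\<^sup>+\<omega>. ennreal (wt \<omega> u) \<partial>P) \<le> 1"
proof -
  have "(\<Sum>u\<in>F. \<integral>\<^sup>+\<omega>. ennreal (wt \<omega> u) \<partial>P) = (\<integral>\<^sup>+u. (\<integral>\<^sup>+\<omega>. ennreal (wt \<omega> u) \<partial>P) * indicator F u \<partial>count_space (level n))"
    using assms by (subst nn_integral_count_space'[of F]) auto
  also have "\<dots> \<le> (\<integral>\<^sup>+u. (\<integral>\<^sup>+\<omega>. ennreal (wt \<omega> u) \<partial>P) \<partial>count_space (level n))"
    by (intro nn_integral_mono) (simp split: split_indicator)
  also have "\<dots> = level_sum n (\<lambda>_. 1)" by (subst level_sum_swap) auto
  finally show ?thesis by (simp add: level_sum_1)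
qed

lemma nn_integral_abs_centered_sum:
  assumes F: "finite F" "F \<subseteq> level n" and \<delta>: "0 < \<delta>"
  shows "(\<integral>\<^sup>+\<omega>. ennreal \<bar>\<Sum>u\<in>F. centered (\<delta>\<^sup>2) (wt \<omega> u) (N u \<omega>)\<bar> \<partial>P) \<le> ennreal (3 * \<delta>)"
proof -
  define D where "D u \<omega> = centered (\<delta>\<^sup>2) (wt \<omega> u) (N u \<omega>)" for u \<omega>
  have [measurable]: "D u \<in> borel_measurable P" for u unfolding D_def by measurable
  have bound: "\<bar>D u \<omega>\<bar> \<le> \<delta>\<^sup>2" for u \<omega> unfolding D_def by (intro centered_bound) auto
  have int: "integrable P (\<lambda>\<omega>. D u \<omega> * D v \<omega>)" for u v
    using mult_mono[OF bound bound] by (intro integrable_const_bound[of _ "\<delta>\<^sup>2 * \<delta>\<^sup>2"]) (auto simp: abs_mult)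
  have sq: "(\<Sum>u\<in>F. D u \<omega>)\<^sup>2 = (\<Sum>u\<in>F. \<Sum>v\<in>F. D u \<omega> * D v \<omega>)" for \<omega>
    by (simp add: power2_eq_square sum_product)
  have "(\<integral>\<^sup>+\<omega>. ennreal ((\<Sum>u\<in>F. D u \<omega>)\<^sup>2) \<partial>P) = ennreal (\<integral>\<omega>. (\<Sum>u\<in>F. \<Sum>v\<in>F. D u \<omega> * D v \<omega>) \<partial>P)"
    unfolding sq
  proof (rule nn_integral_eq_integral)
    show "integrable P (\<lambda>\<omega>. \<Sum>u\<in>F. \<Sum>v\<in>F. D u \<omega> * D v \<omega>)" using int by simp
    show "AE \<omega> in P. 0 \<le> (\<Sum>u\<in>F. \<Sum>v\<in>F. D u \<omega> * D v \<omega>)" by (simp flip: sq)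
  qed
  also have "(\<integral>\<omega>. (\<Sum>u\<in>F. \<Sum>v\<in>F. D u \<omega> * D v \<omega>) \<partial>P) = (\<Sum>u\<in>F. \<Sum>v\<in>F. \<integral>\<omega>. D u \<omega> * D v \<omega> \<partial>P)"
    using int by simp
  also have "\<dots> = (\<Sum>u\<in>F. \<Sum>v\<in>F. if u = v then \<integral>\<omega>. (D u \<omega>)\<^sup>2 \<partial>P else 0)"
    using F centered_orthogonal[of _ n _ "\<delta>\<^sup>2"]
    by (intro sum.cong refl) (auto simp: D_def power2_eq_square subset_eq)
  also have "\<dots> = (\<Sum>u\<in>F. \<integral>\<omega>. (D u \<omega>)\<^sup>2 \<partial>P)" using F by simp
  also have "ennreal \<dots> = (\<Sum>u\<in>F. ennreal (\<integral>\<omega>. (D u \<omega>)\<^sup>2 \<partial>P))" by (simp add: sum_ennreal)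
  also have "\<dots> = (\<Sum>u\<in>F. \<integral>\<^sup>+\<omega>. ennreal ((D u \<omega>)\<^sup>2) \<partial>P)"
    using int by (intro sum.cong refl nn_integral_eq_integral[symmetric]) (auto simp: power2_eq_square)
  also have "\<dots> \<le> (\<Sum>u\<in>F. ennreal (2 * \<delta>\<^sup>2) * (\<integral>\<^sup>+\<omega>. ennreal (wt \<omega> u) \<partial>P))"
    unfolding D_def by (intro sum_mono nn_integral_centered_square) simp
  also have "\<dots> \<le> ennreal (2 * \<delta>\<^sup>2) * 1"
    unfolding sum_distrib_left[symmetric] by (intro mult_left_mono sum_nn_integral_wt_le[OF F]) simp
  finally have sq_le: "(\<integral>\<^sup>+\<omega>. ennreal ((\<Sum>u\<in>F. D u \<omega>)\<^sup>2) \<partial>P) \<le> ennreal (2 * \<delta>\<^sup>2)" by simp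
  have "(\<integral>\<^sup>+\<omega>. ennreal \<bar>\<Sum>u\<in>F. D u \<omega>\<bar> \<partial>P) \<le> (\<integral>\<^sup>+\<omega>. ennreal (1 / \<delta>) * ennreal ((\<Sum>u\<in>F. D u \<omega>)\<^sup>2) + ennreal \<delta> \<partial>P)"
  proof (rule nn_integral_mono)
    fix \<omega>
    define s where "s = (\<Sum>u\<in>F. D u \<omega>)"
    \<comment> \<open>Either \<bar>s\<bar> is at most \<delta> or it is at most s^2 / \<delta>.
      Since the truncation level \<delta>^2 bounds the mean of s^2 by 2 \<delta>^2, both parts have
      means of order \<delta>.\<close>
    have "\<bar>s\<bar> \<le> 1 / \<delta> * s\<^sup>2 + \<delta>"
    proof (cases "\<bar>s\<bar> \<le> \<delta>")
      case False
      then have "\<bar>s\<bar> * \<delta> \<le> \<bar>s\<bar> * \<bar>s\<bar>" by (intro mult_left_mono) auto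
      then have "\<bar>s\<bar> \<le> 1 / \<delta> * s\<^sup>2" using \<delta> by (simp add: field_simps power2_eq_square)
      then show ?thesis using \<delta> by simp
    qed (use \<delta> in \<open>simp add: add_increasing\<close>)
    then have "ennreal \<bar>s\<bar> \<le> ennreal (1 / \<delta> * s\<^sup>2 + \<delta>)" by (rule ennreal_leI)
    also have "\<dots> = ennreal (1 / \<delta>) * ennreal (s\<^sup>2) + ennreal \<delta>"
      using \<delta> by (simp add: ennreal_mult[symmetric])
    finally show "ennreal \<bar>\<Sum>u\<in>F. D u \<omega>\<bar> \<le> ennreal (1 / \<delta>) * ennreal ((\<Sum>u\<in>F. D u \<omega>)\<^sup>2) + ennreal \<delta>"
      by (simp add: s_def)
  qed
  also have "\<dots> = ennreal (1 / \<delta>) * (\<integral>\<^sup>+\<omega>. ennreal ((\<Sum>u\<in>F. D u \<omega>)\<^sup>2) \<partial>P) + ennreal \<delta>"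
    by (subst nn_integral_add) (auto simp: nn_integral_cmult emeasure_space_1)
  also have "\<dots> \<le> ennreal (1 / \<delta>) * ennreal (2 * \<delta>\<^sup>2) + ennreal \<delta>"
    by (intro add_mono mult_left_mono sq_le) auto
  also have "\<dots> = ennreal (3 * \<delta>)"
    using \<delta> by (simp add: ennreal_mult[symmetric] ennreal_plus[symmetric] power2_eq_square del: ennreal_plus)
  finally show ?thesis by (simp add: D_def)
qed

text \<open>Y U - Y is the centred truncated term plus the part of Y U that is cut off minus the
  part of Y lost in the truncated mean. The last two are nonnegative and have equal expectations by
  \<open>nn_integral_excess_node\<close>, whence the factor 2.\<close>

lemma nn_integral_abs_increment_finite:
  assumes F: "finite F" "F \<subseteq> level n" and \<delta>: "0 < \<delta>"
  shows "(\<integral>\<^sup>+\<omega>. ennreal \<bar>\<Sum>u\<in>F. wt \<omega> u * (total (N u \<omega>) - 1)\<bar> \<partial>P) \<le> ennreal (3 * \<delta>) + 2 * level_excess n (\<delta>\<^sup>2)"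
proof -
  let ?c = "\<delta>\<^sup>2"
  let ?big = "\<lambda>u \<omega>. ennreal (wt \<omega> u * total (N u \<omega>)) * indicator {?c<..} (wt \<omega> u * total (N u \<omega>))"
  have "(\<integral>\<^sup>+\<omega>. ennreal \<bar>\<Sum>u\<in>F. wt \<omega> u * (total (N u \<omega>) - 1)\<bar> \<partial>P) \<le>
    (\<integral>\<^sup>+\<omega>. ennreal \<bar>\<Sum>u\<in>F. centered ?c (wt \<omega> u) (N u \<omega>)\<bar> + ((\<Sum>u\<in>F. ?big u \<omega>) + (\<Sum>u\<in>F. excess ?c (wt \<omega> u))) \<partial>P)"
  proof (rule nn_integral_mono)
    fix \<omega>
    define b where "b u = wt \<omega> u * total (N u \<omega>) - cut ?c (wt \<omega> u) (N u \<omega>)" for u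
    define e where "e u = wt \<omega> u - mean_cut ?c (wt \<omega> u)" for u
    have b: "0 \<le> b u" for u using cut_bounds[of "wt \<omega> u" ?c "N u \<omega>"] by (simp add: b_def)
    have e: "0 \<le> e u" for u using mean_cut_excess(1)[of "wt \<omega> u" ?c] by (simp add: e_def)
    have "(\<Sum>u\<in>F. wt \<omega> u * (total (N u \<omega>) - 1)) =
        (\<Sum>u\<in>F. centered ?c (wt \<omega> u) (N u \<omega>)) + ((\<Sum>u\<in>F. b u) - (\<Sum>u\<in>F. e u))"
      unfolding sum.distrib[symmetric] sum_subtractf[symmetric]
      by (intro sum.cong) (auto simp: centered_def b_def e_def algebra_simps)
    moreover have "0 \<le> (\<Sum>u\<in>F. b u)" "0 \<le> (\<Sum>u\<in>F. e u)" using b e by (auto intro: sum_nonneg)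
    ultimately have "\<bar>\<Sum>u\<in>F. wt \<omega> u * (total (N u \<omega>) - 1)\<bar> \<le>
        \<bar>\<Sum>u\<in>F. centered ?c (wt \<omega> u) (N u \<omega>)\<bar> + ((\<Sum>u\<in>F. b u) + (\<Sum>u\<in>F. e u))"
      by linarith
    then have "ennreal \<bar>\<Sum>u\<in>F. wt \<omega> u * (total (N u \<omega>) - 1)\<bar> \<le>
        ennreal (\<bar>\<Sum>u\<in>F. centered ?c (wt \<omega> u) (N u \<omega>)\<bar> + ((\<Sum>u\<in>F. b u) + (\<Sum>u\<in>F. e u)))"
      by (rule ennreal_leI)
    also have "\<dots> = ennreal \<bar>\<Sum>u\<in>F. centered ?c (wt \<omega> u) (N u \<omega>)\<bar> + ((\<Sum>u\<in>F. ennreal (b u)) + (\<Sum>u\<in>F. ennreal (e u)))"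
      using b e by (simp add: sum_nonneg sum_ennreal)
    also have "(\<Sum>u\<in>F. ennreal (b u)) = (\<Sum>u\<in>F. ?big u \<omega>)"
      by (intro sum.cong) (auto simp: b_def cut_def split: split_indicator)
    also have "(\<Sum>u\<in>F. ennreal (e u)) = (\<Sum>u\<in>F. excess ?c (wt \<omega> u))"
      by (intro sum.cong) (auto simp: e_def mean_cut_excess)
    finally show "ennreal \<bar>\<Sum>u\<in>F. wt \<omega> u * (total (N u \<omega>) - 1)\<bar> \<le>
      ennreal \<bar>\<Sum>u\<in>F. centered ?c (wt \<omega> u) (N u \<omega>)\<bar> + ((\<Sum>u\<in>F. ?big u \<omega>) + (\<Sum>u\<in>F. excess ?c (wt \<omega> u)))" .
  qed
  also have "\<dots> = (\<integral>\<^sup>+\<omega>. ennreal \<bar>\<Sum>u\<in>F. centered ?c (wt \<omega> u) (N u \<omega>)\<bar> \<partial>P) +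
      ((\<Sum>u\<in>F. \<integral>\<^sup>+\<omega>. ?big u \<omega> \<partial>P) + (\<Sum>u\<in>F. \<integral>\<^sup>+\<omega>. excess ?c (wt \<omega> u) \<partial>P))"
    by (simp add: nn_integral_add nn_integral_sum)
  also have "\<dots> = (\<integral>\<^sup>+\<omega>. ennreal \<bar>\<Sum>u\<in>F. centered ?c (wt \<omega> u) (N u \<omega>)\<bar> \<partial>P) +
      2 * (\<Sum>u\<in>F. \<integral>\<^sup>+\<omega>. excess ?c (wt \<omega> u) \<partial>P)"
    by (simp add: nn_integral_excess_node mult_2)
  also have "\<dots> \<le> ennreal (3 * \<delta>) + 2 * level_excess n ?c"
  proof (intro add_mono mult_left_mono nn_integral_abs_centered_sum[OF F \<delta>])
    have "(\<Sum>u\<in>F. \<integral>\<^sup>+\<omega>. excess ?c (wt \<omega> u) \<partial>P) =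
        (\<integral>\<^sup>+u. (\<integral>\<^sup>+\<omega>. excess ?c (wt \<omega> u) \<partial>P) * indicator F u \<partial>count_space (level n))"
      using F by (subst nn_integral_count_space'[of F]) auto
    also have "\<dots> \<le> (\<integral>\<^sup>+u. (\<integral>\<^sup>+\<omega>. excess ?c (wt \<omega> u) \<partial>P) \<partial>count_space (level n))"
      by (intro nn_integral_mono) (simp split: split_indicator)
    also have "\<dots> = level_excess n ?c" using \<delta> by (intro sum_excess) simp
    finally show "(\<Sum>u\<in>F. \<integral>\<^sup>+\<omega>. excess ?c (wt \<omega> u) \<partial>P) \<le> level_excess n ?c" .
  qed simp
  finally show ?thesis .
qed

text \<open>The estimate for finite F does not depend on F, so Fatou's lemma along
  \<open>initial_part\<close> extends it to the whole generation.\<close>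

lemma nn_integral_abs_increment:
  assumes \<delta>: "0 < \<delta>"
  shows "(\<integral>\<^sup>+\<omega>. ennreal \<bar>level_total (Suc n) \<omega> - level_total n \<omega>\<bar> \<partial>P) \<le> ennreal (3 * \<delta>) + 2 * level_excess n (\<delta>\<^sup>2)"
proof -
  let ?d = "\<lambda>k \<omega>. ennreal \<bar>\<Sum>u\<in>initial_part (level n) k. wt \<omega> u * (total (N u \<omega>) - 1)\<bar>"
  have "(\<integral>\<^sup>+\<omega>. ennreal \<bar>level_total (Suc n) \<omega> - level_total n \<omega>\<bar> \<partial>P) = (\<integral>\<^sup>+\<omega>. liminf (\<lambda>k. ?d k \<omega>) \<partial>P)"
  proof (rule nn_integral_cong_AE)
    show "AE \<omega> in P. ennreal \<bar>level_total (Suc n) \<omega> - level_total n \<omega>\<bar> = liminf (\<lambda>k. ?d k \<omega>)"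
      using AE_level_total_diff
    proof eventually_elim
      case (elim \<omega>)
      then have "(\<lambda>k. ?d k \<omega>) \<longlonglongrightarrow> ennreal \<bar>level_total (Suc n) \<omega> - level_total n \<omega>\<bar>"
        by (intro tendsto_ennrealI tendsto_rabs) blast
      then show ?case by (intro lim_imp_Liminf[symmetric]) auto
    qed
  qed
  also have "\<dots> \<le> liminf (\<lambda>k. \<integral>\<^sup>+\<omega>. ?d k \<omega> \<partial>P)"
    by (rule nn_integral_liminf) measurable
  also have "\<dots> \<le> liminf (\<lambda>k. ennreal (3 * \<delta>) + 2 * level_excess n (\<delta>\<^sup>2))"
    by (intro Liminf_mono always_eventually allI nn_integral_abs_increment_finite finite_initial_part initial_part_subset \<delta>)
  finally show ?thesis by (simp add: Liminf_const)
qed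

end

section \<open>Elementary bounds for sequences and series\<close>

lemma exp_neg_le_inverse_power:
  fixes \<beta> :: real and n k :: nat
  assumes "0 < \<beta>" and that: "1 \<le> k" "1 \<le> n"
  shows "exp (- \<beta> * n) \<le> (k / \<beta>) ^ k / real n ^ k"
proof -
  \<comment> \<open>The inequality t \<le> exp t at t = \<beta> n / k, to be raised to the power
    k.\<close>
  have "\<beta> * n / k \<le> exp (\<beta> * n / k)" using exp_ge_add_one_self[of "\<beta> * n / k"] by linarith
  then have "(\<beta> * n / k) ^ k \<le> exp (\<beta> * n / k) ^ k" using assms by (intro power_mono) auto
  also have "\<dots> = exp (\<beta> * n)" using that by (simp flip: exp_of_nat_mult)
  finally have "inverse (exp (\<beta> * n)) \<le> inverse ((\<beta> * n / k) ^ k)"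
    using assms that by (intro le_imp_inverse_le) auto
  then show ?thesis using assms that by (simp add: exp_minus power_divide power_mult_distrib field_simps)
qed

text \<open>A remainder is at most the sum of the later increments in absolute value. After
  exchanging the two sums, the k-th increment carries the factor a(0) + ... + a(k), which B(k)
  dominates. The convergence obtained is absolute.\<close>

lemma summable_weighted_remainders:
  fixes a :: "nat \<Rightarrow> real"
  assumes a: "\<And>n. 0 \<le> a n" and B: "\<And>n. (\<Sum>k\<le>n. a k) \<le> B n"
    and lim: "w \<longlonglongrightarrow> W" and fin: "(\<Sum>n. ennreal (B n) * ennreal \<bar>w (Suc n) - w n\<bar>) < \<infinity>"
  shows "summable (\<lambda>n. a n * (W - w n))"
proof -
  have B0: "0 \<le> B n" for n using B[of n] sum_nonneg[of "{..n}" a] a by (meson order_trans)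
  define d where "d k = \<bar>w (Suc k) - w k\<bar>" for k
  have "summable (\<lambda>n. B n * d n)"
    using fin B0 by (intro summable_suminf_not_top) (auto simp: d_def ennreal_mult less_top)
  then have partial: "(\<Sum>k<L. B k * d k) \<le> (\<Sum>k. B k * d k)" for L
    using B0 by (intro sum_le_suminf) (auto simp: d_def)
  have tele: "\<bar>w L - w n\<bar> \<le> (\<Sum>k=n..<L. d k)" if "n \<le> L" for n L
    using that
  proof (induction L rule: dec_induct)
    case (step L)
    then show ?case by (simp add: d_def)
  qed simp
  \<comment> \<open>With \<open>w L\<close> in place of W all sums are finite; L tends to infinity
    once a bound uniform in L and M is available.\<close>
  have "(\<Sum>n<M. a n * \<bar>w L - w n\<bar>) \<le> (\<Sum>k. B k * d k)" if "M \<le> L" for M L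
  proof -
    have "(\<Sum>n<M. a n * \<bar>w L - w n\<bar>) \<le> (\<Sum>n<M. a n * (\<Sum>k=n..<L. d k))"
      using that a by (intro sum_mono mult_left_mono tele) auto
    also have "\<dots> = (\<Sum>n<M. \<Sum>k<L. if n \<le> k then a n * d k else 0)"
    proof (rule sum.cong)
      fix n
      have "{..<L} \<inter> {k. n \<le> k} = {n..<L}" by auto
      then show "a n * (\<Sum>k=n..<L. d k) = (\<Sum>k<L. if n \<le> k then a n * d k else 0)"
        by (simp add: sum.If_cases sum_distrib_left)
    qed simp
    also have "\<dots> = (\<Sum>k<L. \<Sum>n<M. if n \<le> k then a n * d k else 0)" by (rule sum.swap)
    also have "\<dots> \<le> (\<Sum>k<L. B k * d k)"
    proof (rule sum_mono)
      fix k
      have "(\<Sum>n<M. if n \<le> k then a n * d k else 0) = (\<Sum>n\<in>{..<M} \<inter> {n. n \<le> k}. a n) * d k"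
        by (simp add: sum.If_cases sum_distrib_right)
      also have "\<dots> \<le> (\<Sum>n\<le>k. a n) * d k"
        using a by (intro mult_right_mono sum_mono2) (auto simp: d_def)
      also have "\<dots> \<le> B k * d k" using B by (intro mult_right_mono) (auto simp: d_def)
      finally show "(\<Sum>n<M. if n \<le> k then a n * d k else 0) \<le> B k * d k" .
    qed
    finally show ?thesis using partial[of L] by linarith
  qed
  then have bounded: "\<forall>\<^sub>F L in sequentially. (\<Sum>n<M. a n * \<bar>w L - w n\<bar>) \<le> (\<Sum>k. B k * d k)" for M
    by (intro eventually_mono[OF eventually_ge_at_top[of M]])
  have "(\<lambda>L. \<Sum>n<M. a n * \<bar>w L - w n\<bar>) \<longlonglongrightarrow> (\<Sum>n<M. a n * \<bar>W - w n\<bar>)" for M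
    by (intro tendsto_intros lim)
  from tendsto_upperbound[OF this bounded sequentially_bot] have "(\<Sum>n<M. a n * \<bar>W - w n\<bar>) \<le> (\<Sum>k. B k * d k)" for M
    .
  then have "summable (\<lambda>n. a n * \<bar>W - w n\<bar>)"
    using a by (intro summableI_nonneg_bounded) auto
  moreover have "a n * \<bar>W - w n\<bar> = \<bar>a n * (W - w n)\<bar>" for n
    using a[of n] by (simp add: abs_mult)
  ultimately have "summable (\<lambda>n. \<bar>a n * (W - w n)\<bar>)" by simp
  then show ?thesis by (rule summable_rabs_cancel)
qed

section \<open>Almost sure summability of the weighted increments\<close>

context weighted_branching
begin

text \<open>The threshold exp (- 2 \<beta> n) lets the walk start at ln U + 2 \<beta> n. If ln U is
  at most \<beta> n, this is at most 3 \<beta> n, and U factors out with mean 1; otherwise the walk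
  tail is bounded by 1.\<close>

lemma level_excess_le:
  assumes \<beta>: "0 < \<beta>"
  shows "level_excess n ((exp (- \<beta> * n))\<^sup>2) \<le>
    (\<integral>\<^sup>+\<omega>. ennreal (total (N [] \<omega>)) * indicator {n. \<beta> * real n < ln_plus (total (N [] \<omega>))} n \<partial>P) + walk_tail Q X n (3 * \<beta> * n)"
proof -
  have ln_c: "ln ((exp (- \<beta> * n))\<^sup>2) = - 2 * \<beta> * n" by (simp flip: exp_double)
  have [measurable]: "ln_plus \<in> borel_measurable borel" unfolding ln_plus_def by measurable
  have "level_excess n ((exp (- \<beta> * n))\<^sup>2) \<le>
    (\<integral>\<^sup>+\<omega>. ennreal (total (N [] \<omega>)) * indicator {n. \<beta> * real n < ln_plus (total (N [] \<omega>))} n +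
      ennreal (total (N [] \<omega>)) * walk_tail Q X n (3 * \<beta> * n) \<partial>P)"
    unfolding level_excess_def ln_c
  proof (rule nn_integral_mono)
    fix \<omega>
    let ?t = "total (N [] \<omega>)" and ?s = "ln (total (N [] \<omega>)) - - 2 * \<beta> * real n"
    show "ennreal ?t * walk_tail Q X n ?s \<le> ennreal ?t * indicator {n. \<beta> * real n < ln_plus ?t} n +
        ennreal ?t * walk_tail Q X n (3 * \<beta> * n)"
    proof (cases "\<beta> * real n < ln_plus ?t")
      case True
      have "ennreal ?t * walk_tail Q X n ?s \<le> ennreal ?t * 1" by (intro mult_left_mono Q.walk_tail_le_1) simp
      with True show ?thesis by (simp add: add_increasing2)
    next
      case False
      then have "ln ?t \<le> \<beta> * n" by (simp add: ln_plus_def)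
      then have "walk_tail Q X n ?s \<le> walk_tail Q X n (3 * \<beta> * n)" by (intro walk_tail_mono) simp
      then have "ennreal ?t * walk_tail Q X n ?s \<le> ennreal ?t * walk_tail Q X n (3 * \<beta> * n)"
        by (rule mult_left_mono) simp
      then show ?thesis by (rule order_trans) simp
    qed
  qed
  also have "\<dots> = (\<integral>\<^sup>+\<omega>. ennreal (total (N [] \<omega>)) * indicator {n. \<beta> * real n < ln_plus (total (N [] \<omega>))} n \<partial>P) +
      (\<integral>\<^sup>+\<omega>. ennreal (total (N [] \<omega>)) * walk_tail Q X n (3 * \<beta> * n) \<partial>P)"
    by (rule nn_integral_add) measurable
  also have "(\<integral>\<^sup>+\<omega>. ennreal (total (N [] \<omega>)) * walk_tail Q X n (3 * \<beta> * n) \<partial>P) = walk_tail Q X n (3 * \<beta> * n)"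
    by (subst nn_integral_multc) (auto simp: nn_integral_total)
  finally show ?thesis .
qed

text \<open>For fixed U at most 1 + K ln+ U indices survive the indicator, all of them at most K ln+
  U, so monotonicity of B bounds the sum before integration. Here K exceeds 1 / \<beta> or equals
  it, and is raised to 1 if necessary to fit \<open>mom\<close>.\<close>

lemma suminf_level_excess:
  fixes B :: "real \<Rightarrow> real"
  assumes \<beta>: "0 < \<beta>" and mono: "\<And>x y. x \<le> y \<Longrightarrow> B x \<le> B y" and nonneg: "\<And>x. 0 \<le> B x"
    and mom: "\<And>K. 1 \<le> K \<Longrightarrow> (\<integral>\<^sup>+\<omega>. ennreal (total (N [] \<omega>) *
      ((1 + K * ln_plus (total (N [] \<omega>))) * B (K * ln_plus (total (N [] \<omega>))))) \<partial>P) < \<infinity>"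
  shows "(\<Sum>n. ennreal (B n) * (\<integral>\<^sup>+\<omega>. ennreal (total (N [] \<omega>)) * indicator {n. \<beta> * real n < ln_plus (total (N [] \<omega>))} n \<partial>P)) < \<infinity>"
proof -
  have [measurable]: "ln_plus \<in> borel_measurable borel" unfolding ln_plus_def by measurable
  define K where "K = max 1 (1 / \<beta>)"
  have K: "1 \<le> K" "1 / \<beta> \<le> K" by (auto simp: K_def)
  have pt: "(\<Sum>n. ennreal (B n) * (ennreal t * indicator {n. \<beta> * real n < l} n)) \<le>
      ennreal (t * ((1 + K * l) * B (K * l)))" if t: "0 \<le> t" and l: "0 \<le> l" for t l :: real
  proof -
    let ?A = "{..nat \<lfloor>K * l\<rfloor>}"
    have Kl: "0 \<le> K * l" using K l by simp
    have sub: "n \<in> ?A" "real n \<le> K * l" if "\<beta> * real n < l" for n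
    proof -
      have "real n \<le> 1 / \<beta> * l" using that \<beta> by (simp add: field_simps)
      also have "\<dots> \<le> K * l" using K l by (intro mult_right_mono) auto
      finally show "real n \<le> K * l" .
      then show "n \<in> ?A" using le_nat_floor by blast
    qed
    have "(\<Sum>n. ennreal (B n) * (ennreal t * indicator {n. \<beta> * real n < l} n)) =
        (\<Sum>n\<in>?A. ennreal (B n) * (ennreal t * indicator {n. \<beta> * real n < l} n))"
      using sub(1) by (intro suminf_finite) (auto split: split_indicator)
    also have "\<dots> \<le> (\<Sum>n\<in>?A. ennreal (B (K * l) * t))"
    proof (rule sum_mono)
      fix n
      show "ennreal (B n) * (ennreal t * indicator {n. \<beta> * real n < l} n) \<le> ennreal (B (K * l) * t)"
        using sub(2)[of n] mono[of "real n" "K * l"] nonneg t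
        by (auto simp: ennreal_mult[symmetric] intro!: ennreal_leI mult_right_mono split: split_indicator)
    qed
    also have "\<dots> = ennreal (real (Suc (nat \<lfloor>K * l\<rfloor>)) * (B (K * l) * t))"
      using nonneg t by (simp add: ennreal_mult ennreal_of_nat_eq_real_of_nat)
    also have "\<dots> \<le> ennreal ((1 + K * l) * (B (K * l) * t))"
      using Kl nonneg t by (intro ennreal_leI mult_right_mono) auto
    finally show ?thesis by (simp add: mult_ac)
  qed
  have [measurable]: "B \<in> borel_measurable borel" by (rule borel_measurable_mono) (auto simp: mono_def mono)
  have "(\<Sum>n. ennreal (B n) * (\<integral>\<^sup>+\<omega>. ennreal (total (N [] \<omega>)) * indicator {n. \<beta> * real n < ln_plus (total (N [] \<omega>))} n \<partial>P)) =
    (\<Sum>n. \<integral>\<^sup>+\<omega>. ennreal (B n) * (ennreal (total (N [] \<omega>)) * indicator {n. \<beta> * real n < ln_plus (total (N [] \<omega>))} n) \<partial>P)"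
    by (intro suminf_cong nn_integral_cmult[symmetric]) measurable
  also have "\<dots> = (\<integral>\<^sup>+\<omega>. (\<Sum>n. ennreal (B n) * (ennreal (total (N [] \<omega>)) * indicator {n. \<beta> * real n < ln_plus (total (N [] \<omega>))} n)) \<partial>P)"
    by (rule nn_integral_suminf[symmetric]) measurable
  also have "\<dots> \<le> (\<integral>\<^sup>+\<omega>. ennreal (total (N [] \<omega>) *
      ((1 + K * ln_plus (total (N [] \<omega>))) * B (K * ln_plus (total (N [] \<omega>))))) \<partial>P)"
    by (intro nn_integral_mono pt) (auto simp: ln_plus_def)
  also have "\<dots> < \<infinity>" by (rule mom[OF K(1)])
  finally show ?thesis .
qed

lemma suminf_increments:
  fixes B :: "real \<Rightarrow> real" and D :: real
  assumes X: "integrable Q X" and neg: "Q.expectation X < 0"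
    and sq: "integrable Q (\<lambda>\<zeta>. (max (X \<zeta>) 0)\<^sup>2)"
    and mono: "\<And>x y. x \<le> y \<Longrightarrow> B x \<le> B y" and nonneg: "\<And>x. 0 \<le> B x"
    and poly: "\<And>n::nat. n \<ge> 1 \<Longrightarrow> B n \<le> D * real n ^ p"
    and mom_X: "\<And>K. 1 \<le> K \<Longrightarrow> (\<integral>\<^sup>+\<zeta>. ennreal ((max (X \<zeta>) 0)\<^sup>2 * B (K * max (X \<zeta>) 0)) \<partial>Q) < \<infinity>"
    and mom: "\<And>K. 1 \<le> K \<Longrightarrow> (\<integral>\<^sup>+\<omega>. ennreal (total (N [] \<omega>) *
      ((1 + K * ln_plus (total (N [] \<omega>))) * B (K * ln_plus (total (N [] \<omega>))))) \<partial>P) < \<infinity>"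
  shows "AE \<omega> in P. (\<Sum>n. ennreal (B n) * ennreal \<bar>level_total (Suc n) \<omega> - level_total n \<omega>\<bar>) < \<infinity>"
proof -
  obtain \<epsilon> :: real where \<epsilon>: "0 < \<epsilon>" and walk: "(\<Sum>n. ennreal (B n) * walk_tail Q X n (\<epsilon> * n)) < \<infinity>"
    by (rule Q.walk_tail_summable[OF X neg sq, of B D p]) (assumption | rule mono nonneg poly mom_X that)+
  \<comment> \<open>\<open>level_excess_le\<close> evaluates the walk tail at 3 \<beta> n, which is
    thereby the level \<epsilon> n of \<open>walk\<close>.\<close>
  define \<beta> where "\<beta> = \<epsilon> / 3"
  have \<beta>: "0 < \<beta>" "3 * \<beta> = \<epsilon>" using \<epsilon> by (auto simp: \<beta>_def)
  define I :: "nat \<Rightarrow> ennreal" where "I n =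
    (\<integral>\<^sup>+\<omega>. ennreal (total (N [] \<omega>)) * indicator {n. \<beta> * real n < ln_plus (total (N [] \<omega>))} n \<partial>P)" for n
  have D: "0 \<le> D" using poly[of 1] nonneg[of 1] by simp
  \<comment> \<open>As B(n) grows at most like n ^ p, decay of order p + 2 in exp (- \<beta> n)
    leaves the summable 1 / n ^ 2. The 3 in \<open>E\<close> comes from the term 3 \<delta> with
    \<delta> = exp (- \<beta> n).\<close>
  define k where "k = p + 2"
  define E where "E = 3 * D * (k / \<beta>) ^ k"
  have E: "0 \<le> E" using D \<beta> by (simp add: E_def)
  have geo: "ennreal (B n) * ennreal (3 * exp (- \<beta> * n)) \<le> ennreal (3 * B 0) * indicator {0} n + ennreal (E * (1 / real n ^ 2))" for n :: nat
  proof (cases "n = 0")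
    case True
    then show ?thesis using nonneg by (simp add: ennreal_mult mult.commute)
  next
    case False
    have "B n * (3 * exp (- \<beta> * n)) \<le> (D * real n ^ p) * (3 * ((k / \<beta>) ^ k / real n ^ k))"
      using False poly[of n] nonneg exp_neg_le_inverse_power[OF \<beta>(1), of k n] D
      by (intro mult_mono) (auto simp: k_def)
    also have "\<dots> = E * (1 / real n ^ 2)"
    proof -
      have "real n ^ k = real n ^ p * real n ^ 2" unfolding k_def by (rule power_add)
      then show ?thesis using False by (simp add: E_def)
    qed
    finally show ?thesis using False nonneg by (simp add: ennreal_mult[symmetric] ennreal_leI)
  qed
  have "(\<integral>\<^sup>+\<omega>. (\<Sum>n. ennreal (B n) * ennreal \<bar>level_total (Suc n) \<omega> - level_total n \<omega>\<bar>) \<partial>P) =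
    (\<Sum>n. \<integral>\<^sup>+\<omega>. ennreal (B n) * ennreal \<bar>level_total (Suc n) \<omega> - level_total n \<omega>\<bar> \<partial>P)"
    by (rule nn_integral_suminf) measurable
  also have "\<dots> = (\<Sum>n. ennreal (B n) * (\<integral>\<^sup>+\<omega>. ennreal \<bar>level_total (Suc n) \<omega> - level_total n \<omega>\<bar> \<partial>P))"
    by (intro suminf_cong nn_integral_cmult) measurable
  also have "\<dots> \<le> (\<Sum>n. (ennreal (3 * B 0) * indicator {0} n + ennreal (E * (1 / real n ^ 2))) +
      2 * (ennreal (B n) * I n + ennreal (B n) * walk_tail Q X n (\<epsilon> * n)))"
  proof (intro suminf_le summableI)
    fix n
    have "(\<integral>\<^sup>+\<omega>. ennreal \<bar>level_total (Suc n) \<omega> - level_total n \<omega>\<bar> \<partial>P) \<le>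
        ennreal (3 * exp (- \<beta> * n)) + 2 * level_excess n ((exp (- \<beta> * n))\<^sup>2)"
      by (rule nn_integral_abs_increment) simp
    also have "\<dots> \<le> ennreal (3 * exp (- \<beta> * n)) + 2 * (I n + walk_tail Q X n (\<epsilon> * n))"
      using level_excess_le[OF \<beta>(1), of n] by (intro add_left_mono mult_left_mono) (auto simp: \<beta> I_def)
    finally have "ennreal (B n) * (\<integral>\<^sup>+\<omega>. ennreal \<bar>level_total (Suc n) \<omega> - level_total n \<omega>\<bar> \<partial>P) \<le>
        ennreal (B n) * (ennreal (3 * exp (- \<beta> * n)) + 2 * (I n + walk_tail Q X n (\<epsilon> * n)))"
      by (rule mult_left_mono) simp
    also have "\<dots> = ennreal (B n) * ennreal (3 * exp (- \<beta> * n)) +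
        2 * (ennreal (B n) * I n + ennreal (B n) * walk_tail Q X n (\<epsilon> * n))"
      by (simp add: distrib_left mult_ac)
    also have "\<dots> \<le> (ennreal (3 * B 0) * indicator {0} n + ennreal (E * (1 / real n ^ 2))) +
      2 * (ennreal (B n) * I n + ennreal (B n) * walk_tail Q X n (\<epsilon> * n))"
      by (intro add_right_mono geo)
    finally show "ennreal (B n) * (\<integral>\<^sup>+\<omega>. ennreal \<bar>level_total (Suc n) \<omega> - level_total n \<omega>\<bar> \<partial>P) \<le>
      (ennreal (3 * B 0) * indicator {0} n + ennreal (E * (1 / real n ^ 2))) +
      2 * (ennreal (B n) * I n + ennreal (B n) * walk_tail Q X n (\<epsilon> * n))" .
  qed
  also have "\<dots> = ((\<Sum>n. ennreal (3 * B 0) * indicator {0::nat} n) + (\<Sum>n. ennreal (E * (1 / real n ^ 2)))) +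
      2 * ((\<Sum>n. ennreal (B n) * I n) + (\<Sum>n. ennreal (B n) * walk_tail Q X n (\<epsilon> * n)))"
    by (simp add: suminf_add[symmetric] summableI)
  also have "\<dots> < \<infinity>"
  proof -
    have "(\<Sum>n. ennreal (3 * B 0) * indicator {0::nat} n) = (\<Sum>n\<in>{0}. ennreal (3 * B 0) * indicator {0::nat} n)"
      by (rule suminf_finite) auto
    then have 1: "(\<Sum>n. ennreal (3 * B 0) * indicator {0::nat} n) < \<infinity>" by (simp add: less_top)
    have "summable (\<lambda>n. E * (1 / real n ^ 2))"
      using inverse_power_summable[of 2, where 'a = real] by (intro summable_mult) (simp add: field_simps)
    then have 2: "(\<Sum>n. ennreal (E * (1 / real n ^ 2))) < \<infinity>"
      using E by (simp add: less_top[symmetric] ennreal_suminf_neq_top)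
    have 3: "(\<Sum>n. ennreal (B n) * I n) < \<infinity>"
      unfolding I_def by (rule suminf_level_excess[OF \<beta>(1) mono nonneg mom])
    show ?thesis using 1 2 3 walk by (simp add: ennreal_mult_less_top)
  qed
  finally have "AE \<omega> in P. (\<Sum>n. ennreal (B n) * ennreal \<bar>level_total (Suc n) \<omega> - level_total n \<omega>\<bar>) \<noteq> \<infinity>"
    by (intro nn_integral_PInf_AE) auto
  then show ?thesis by (simp add: less_top)
qed

end

section \<open>The branching random walk as a weighted branching process\<close>

lemma measurable_emeasure_counting [measurable]:
  "B \<in> sets borel \<Longrightarrow> (\<lambda>\<mu>. emeasure \<mu> B) \<in> borel_measurable counting_measure_space"
  unfolding counting_measure_space_def
  by (intro measurable_Sup1[of "vimage_algebra counting_measures (\<lambda>\<mu>. emeasure \<mu> B) borel"] measurable_vimage_algebra1) auto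

lemma pred_labels [measurable]: "Measurable.pred counting_measure_space (\<lambda>\<mu>. i \<in> labels \<mu>)"
  by (cases i) (simp add: labels_def)

definition child_weight :: "real \<Rightarrow> real \<Rightarrow> real measure \<Rightarrow> label \<Rightarrow> real" where
  "child_weight \<gamma> m \<mu> i = (if i \<in> labels \<mu> then exp (\<gamma> * label_point \<mu> i) / m else 0)"

text \<open>\<open>label_point\<close> is an infimum over uncountably many x, but
  \<open>label_point_le_iff\<close> describes its sublevel sets by evaluations of the measure, which
  generate the \<sigma>-algebra. Off \<open>labels\<close> a constant takes its place.\<close>

lemma measurable_child_weight: "(\<lambda>\<mu>. child_weight \<gamma> m \<mu> i) \<in> borel_measurable counting_measure_space"
proof -
  let ?f = "\<lambda>\<mu>. if i \<in> labels \<mu> then label_point \<mu> i else 0"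
  obtain z k where i: "i = (z, k)" by force
  have "?f \<in> borel_measurable counting_measure_space"
  proof (subst borel_measurable_iff_le, rule allI)
    fix t
    have "{\<mu> \<in> space counting_measure_space. ?f \<mu> \<le> t} = {\<mu> \<in> space counting_measure_space.
        if i \<in> labels \<mu> then real_of_int z \<le> t \<and> of_nat k < emeasure \<mu> {real_of_int z..t} else 0 \<le> t}"
    proof (intro Collect_cong conj_cong refl)
      fix \<mu> assume "\<mu> \<in> space counting_measure_space"
      then have \<mu>: "\<mu> \<in> counting_measures" by (simp add: space_counting_measure_space)
      show "?f \<mu> \<le> t \<longleftrightarrow> (if i \<in> labels \<mu> then real_of_int z \<le> t \<and> of_nat k < emeasure \<mu> {real_of_int z..t} else 0 \<le> t)"
        using label_point_le_iff[OF \<mu>, of z t k] label_point_in_cell(1)[OF \<mu>, of z k] by (auto simp: i)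
    qed
    also have "\<dots> \<in> sets counting_measure_space" by measurable
    finally show "{\<mu> \<in> space counting_measure_space. ?f \<mu> \<le> t} \<in> sets counting_measure_space" .
  qed
  then have "(\<lambda>\<mu>. if i \<in> labels \<mu> then exp (\<gamma> * ?f \<mu>) / m else 0) \<in> borel_measurable counting_measure_space"
    by measurable
  then show ?thesis by (simp add: child_weight_def cong: if_cong)
qed

lemma weight_child_weight:
  "weight (child_weight \<gamma> (enn2real (brw_moment P N \<gamma>))) (\<lambda>v. N v \<omega>) u =
    (if alive N \<omega> u then brw_Y P N \<gamma> u \<omega> else 0)"
  by (induction u) (auto simp: child_weight_def brw_Y_def distrib_left exp_add)

lemma brw_W_eq_level_sum:
  assumes "(\<integral>\<^sup>+u. ennreal (weight (child_weight \<gamma> (enn2real (brw_moment P N \<gamma>))) (\<lambda>v. N v \<omega>) u) \<partial>count_space (level n)) < \<infinity>"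
  shows "brw_W P N \<gamma> n \<omega> =
    enn2real (\<integral>\<^sup>+u. ennreal (weight (child_weight \<gamma> (enn2real (brw_moment P N \<gamma>))) (\<lambda>v. N v \<omega>) u) \<partial>count_space (level n))"
proof -
  let ?w = "weight (child_weight \<gamma> (enn2real (brw_moment P N \<gamma>))) (\<lambda>v. N v \<omega>)"
  have "0 \<le> ?w u" for u unfolding weight_child_weight by (simp add: brw_Y_def)
  then have "infsum ?w (level n) = enn2real (\<integral>\<^sup>+u. ennreal (?w u) \<partial>count_space (level n))"
    using assms by (intro infsumI has_sum_enn2real)
  moreover have "brw_W P N \<gamma> n \<omega> = infsum ?w (level n)"
    unfolding brw_W_def by (rule infsum_cong_neutral) (auto simp: weight_child_weight generation_def level_def)
  ultimately show ?thesis by simp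
qed

lemma sum_generation_1:
  fixes f :: "real \<Rightarrow> ennreal"
  shows "(\<Sum>\<^sub>\<infinity>u\<in>generation N 1 \<omega>. ennreal (brw_Y P N \<gamma> u \<omega>) * f (brw_Y P N \<gamma> u \<omega>)) =
    (\<integral>\<^sup>+i. ennreal (child_weight \<gamma> (enn2real (brw_moment P N \<gamma>)) (N [] \<omega>) i) *
      f (child_weight \<gamma> (enn2real (brw_moment P N \<gamma>)) (N [] \<omega>) i) \<partial>count_space UNIV)"
proof -
  let ?c = "child_weight \<gamma> (enn2real (brw_moment P N \<gamma>)) (N [] \<omega>)"
  have bij: "bij_betw (\<lambda>i. [i]) (labels (N [] \<omega>)) (generation N 1 \<omega>)"
    by (rule bij_betwI[where g = hd]) (auto simp: generation_def length_Suc_conv)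
  have "(\<Sum>\<^sub>\<infinity>u\<in>generation N 1 \<omega>. ennreal (brw_Y P N \<gamma> u \<omega>) * f (brw_Y P N \<gamma> u \<omega>)) =
    (\<integral>\<^sup>+u. ennreal (brw_Y P N \<gamma> u \<omega>) * f (brw_Y P N \<gamma> u \<omega>) \<partial>count_space (generation N 1 \<omega>))"
    by (rule nn_integral_count_space_eq_infsum[symmetric])
  also have "\<dots> = (\<integral>\<^sup>+i. ennreal (brw_Y P N \<gamma> [i] \<omega>) * f (brw_Y P N \<gamma> [i] \<omega>) \<partial>count_space (labels (N [] \<omega>)))"
    by (rule nn_integral_bij_count_space[OF bij, symmetric])
  also have "\<dots> = (\<integral>\<^sup>+i. ennreal (?c i) * f (?c i) \<partial>count_space (labels (N [] \<omega>)))"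
    by (rule nn_integral_cong) (simp add: brw_Y_def child_weight_def)
  also have "\<dots> = (\<integral>\<^sup>+i. ennreal (?c i) * f (?c i) \<partial>count_space UNIV)"
    by (rule nn_integral_count_space_eq) (auto simp: child_weight_def)
  finally show ?thesis .
qed

theorem theorem1p1:
  fixes P :: "'w measure" and N :: "individual \<Rightarrow> 'w \<Rightarrow> real measure"
    and Q :: "'z measure" and Z :: "'z \<Rightarrow> real"
    and W :: "'w \<Rightarrow> real" and a :: "real \<Rightarrow> real" and \<gamma> \<alpha> :: real
  assumes brw: "branching_random_walk P N"
    and gamma: "0 < \<gamma>"
    and moment: "0 < brw_moment P N \<gamma>" "brw_moment P N \<gamma> < \<infinity>"
    and Q: "prob_space Q" and Z: "Z \<in> borel_measurable Q"
    and Z_distr: "\<And>r :: real \<Rightarrow> real. r \<in> borel_measurable borel \<Longrightarrow> (\<And>x. 0 \<le> r x) \<Longrightarrow> bounded (range r) \<Longrightarrow>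
      (\<integral>\<^sup>+\<zeta>. ennreal (r (Z \<zeta>)) \<partial>Q) =
      (\<integral>\<^sup>+\<omega>. (\<Sum>\<^sub>\<infinity>u\<in>generation N 1 \<omega>. ennreal (brw_Y P N \<gamma> u \<omega> * r (brw_Y P N \<gamma> u \<omega>))) \<partial>P)"
    and W: "W \<in> borel_measurable P"
      "AE \<omega> in P. (\<lambda>n. brw_W P N \<gamma> n \<omega>) \<longlonglongrightarrow> W \<omega>"
    and a_nonneg: "\<And>x. 0 \<le> x \<Longrightarrow> 0 \<le> a x"
    and a_rv: "regularly_varying a \<alpha>" and alpha: "-1 < \<alpha>"
    and a_mono: "\<alpha> = 0 \<Longrightarrow> \<exists>x0. mono_on {x0..} a"
    and log_Z: "integrable Q (\<lambda>\<zeta>. ln (Z \<zeta>))" "(\<integral>\<zeta>. ln (Z \<zeta>) \<partial>Q) < 0"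
    and W1: "integrable P (\<lambda>\<omega>. brw_W P N \<gamma> 1 \<omega> * ln_plus (brw_W P N \<gamma> 1 \<omega>))"
    and nonarith: "non_arithmetic (distr Q borel (\<lambda>\<zeta>. ln (Z \<zeta>)))"
    and log_Z_a: "integrable Q (\<lambda>\<zeta>. ln_plus (Z \<zeta>) ^ 3 * a (ln_plus (Z \<zeta>)))"
    and W1_a: "integrable P (\<lambda>\<omega>. brw_W P N \<gamma> 1 \<omega> * ln_plus (brw_W P N \<gamma> 1 \<omega>) ^ 2 *
      a (ln_plus (brw_W P N \<gamma> 1 \<omega>)))"
  shows "AE \<omega> in P. summable (\<lambda>n. a (real n) * (W \<omega> - brw_W P N \<gamma> n \<omega>))"
proof -
  interpret branching_random_walk P N by (rule brw)
  interpret Q: prob_space Q by (rule Q)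
  define m where "m = enn2real (brw_moment P N \<gamma>)"
  define X where "X \<zeta> = ln (Z \<zeta>)" for \<zeta>
  have [measurable]: "X \<in> borel_measurable Q" unfolding X_def using Z by measurable
  interpret T: weighted_branching P counting_measure_space N "child_weight \<gamma> m" Q X
  proof
    show "indep_vars (\<lambda>_. counting_measure_space) N UNIV" by (rule indep)
    show "distr P counting_measure_space (N u) = distr P counting_measure_space (N [])" for u
      by (rule ident)
    show "(\<lambda>\<mu>. child_weight \<gamma> m \<mu> i) \<in> borel_measurable counting_measure_space" for i
      by (rule measurable_child_weight)
    show "0 \<le> child_weight \<gamma> m \<mu> i" for \<mu> i by (simp add: child_weight_def m_def)
    show "X \<in> borel_measurable Q" by simp
    fix f :: "real \<Rightarrow> ennreal"
    assume f [measurable]: "f \<in> borel_measurable borel" and f1: "\<And>x. f x \<le> 1"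
    \<comment> \<open>The law of Z is prescribed through real functions, whereas f has values in
      \<open>ennreal\<close>. Being at most 1, f is finite and is recovered from its real
      version.\<close>
    define r where "r x = enn2real (f (ln x))" for x
    have r_eq: "ennreal (r x) = f (ln x)" for x
      using f1[of "ln x"] unfolding r_def by (intro ennreal_enn2real) (auto intro: le_less_trans)
    have "r x \<le> 1" for x
      using f1[of "ln x"] unfolding r_def by (simp add: enn2real_leI)
    then have r1: "norm (r x) \<le> 1" for x by (simp add: r_def)
    have "(\<integral>\<^sup>+\<zeta>. ennreal (r (Z \<zeta>)) \<partial>Q) =
      (\<integral>\<^sup>+\<omega>. (\<Sum>\<^sub>\<infinity>u\<in>generation N 1 \<omega>. ennreal (brw_Y P N \<gamma> u \<omega> * r (brw_Y P N \<gamma> u \<omega>))) \<partial>P)"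
    proof (rule Z_distr)
      show "r \<in> borel_measurable borel" unfolding r_def by measurable
      show "0 \<le> r x" for x by (simp add: r_def)
      show "bounded (range r)" using r1 by (auto simp: bounded_iff)
    qed
    also have "\<dots> = (\<integral>\<^sup>+\<omega>. (\<Sum>\<^sub>\<infinity>u\<in>generation N 1 \<omega>. ennreal (brw_Y P N \<gamma> u \<omega>) * f (ln (brw_Y P N \<gamma> u \<omega>))) \<partial>P)"
    proof -
      have "ennreal (brw_Y P N \<gamma> u \<omega> * r (brw_Y P N \<gamma> u \<omega>)) =
          ennreal (brw_Y P N \<gamma> u \<omega>) * f (ln (brw_Y P N \<gamma> u \<omega>))" for u \<omega>
        unfolding r_eq[symmetric] by (rule ennreal_mult) (simp_all add: brw_Y_def r_def)
      then show ?thesis by simp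
    qed
    finally show "(\<integral>\<^sup>+\<omega>. (\<integral>\<^sup>+i. ennreal (child_weight \<gamma> m (N [] \<omega>) i) * f (ln (child_weight \<gamma> m (N [] \<omega>) i)) \<partial>count_space UNIV) \<partial>P) =
        (\<integral>\<^sup>+\<zeta>. f (X \<zeta>) \<partial>Q)"
      unfolding sum_generation_1[where f = "\<lambda>x. f (ln x)"] r_eq X_def m_def by (rule sym)
  qed
  have level: "AE \<omega> in P. \<forall>n. brw_W P N \<gamma> n \<omega> = T.level_total n \<omega>"
    using T.AE_level_mass_finite
  proof eventually_elim
    case (elim \<omega>)
    then show ?case
      unfolding T.level_total_def T.level_mass_def unfolding m_def by (auto intro: brw_W_eq_level_sum)
  qed
  have level1: "AE \<omega> in P. brw_W P N \<gamma> 1 \<omega> = T.total (N [] \<omega>)"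
    using level
  proof eventually_elim
    case (elim \<omega>)
    have "T.level_mass (Suc 0) \<omega> = T.mass (N [] \<omega>)"
      unfolding T.level_mass_Suc by (simp add: level_0 nn_integral_count_space_finite)
    with elim show ?case by (simp add: T.level_total_def T.total_def)
  qed
  let ?B = "partial_sum a"
  obtain x0 where x0: "1 \<le> x0" and lin: "\<And>K. K \<ge> 1 \<Longrightarrow> \<exists>C. \<forall>x\<ge>x0. ?B (K * x) \<le> C * (x * a x)"
    and pol: "\<exists>C p. \<forall>x\<ge>x0. ?B x \<le> C * x ^ p"
    by (rule partial_sum_bounds[OF a_nonneg a_rv alpha], assumption, rule that)
  obtain C0 p where C0: "\<And>x. x0 \<le> x \<Longrightarrow> ?B x \<le> C0 * x ^ p" using pol by blast
  have mono: "?B x \<le> ?B y" if "x \<le> y" for x y using a_nonneg that by (rule partial_sum_mono)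
  have B1: "1 \<le> ?B x" for x using a_nonneg by (rule partial_sum_ge_1)
  have B0: "0 \<le> ?B x" for x using B1[of x] by simp
  \<comment> \<open>The polynomial bound starts at x0; the entry \<open>?B x0\<close> in the maximum
    covers the finitely many n below.\<close>
  have poly: "?B n \<le> max C0 (?B x0) * real n ^ p" if "1 \<le> n" for n :: nat
  proof (cases "x0 \<le> real n")
    case True
    have "?B n \<le> C0 * real n ^ p" by (rule C0[OF True])
    also have "\<dots> \<le> max C0 (?B x0) * real n ^ p" by (intro mult_right_mono) auto
    finally show ?thesis by simp
  next
    case False
    then have "?B n \<le> ?B x0 * 1" using mono[of "real n" x0] by simp
    also have "\<dots> \<le> max C0 (?B x0) * real n ^ p" using that B0[of x0] by (intro mult_mono) auto
    finally show ?thesis by simp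
  qed
  define l where "l \<zeta> = max (X \<zeta>) 0" for \<zeta>
  have l_eq: "ln_plus (Z \<zeta>) = l \<zeta>" for \<zeta> by (simp add: ln_plus_def l_def X_def)
  have [measurable]: "l \<in> borel_measurable Q" unfolding l_def by measurable
  have [measurable]: "?B \<in> borel_measurable borel" by (rule borel_measurable_mono) (auto simp: mono_def mono)
  \<comment> \<open>A(K x) = O(x a(x)) turns the weights of \<open>suminf_increments\<close> into
    the assumed moments, raising each power of x by one. The summand 1 on the right covers x below
    x0, where a may vanish.\<close>
  have B_le: "\<exists>C\<ge>0. \<forall>x\<ge>0. x\<^sup>2 * ?B (K * x) \<le> C * (1 + x ^ 3 * a x) \<and> (1 + K * x) * ?B (K * x) \<le> C * (1 + x\<^sup>2 * a x)"
    if K: "1 \<le> K" for K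
  proof -
    obtain C where C: "\<And>x. x0 \<le> x \<Longrightarrow> ?B (K * x) \<le> C * (x * a x)" using lin[OF K] by blast
    define C1 where "C1 = max C 0"
    have C1: "0 \<le> C1" "?B (K * x) \<le> C1 * (x * a x)" if "x0 \<le> x" for x
    proof -
      show "0 \<le> C1" by (simp add: C1_def)
      have "0 \<le> x * a x" using that x0 a_nonneg[of x] by simp
      then have "C * (x * a x) \<le> C1 * (x * a x)" by (intro mult_right_mono) (simp_all add: C1_def)
      with C[OF that] show "?B (K * x) \<le> C1 * (x * a x)" by simp
    qed
    \<comment> \<open>The first entry serves both estimates for x at least x0, where 1 + K x is at
      most (1 + K) x. The second bounds both left-hand sides for x below x0.\<close>
    define C2 where "C2 = max ((1 + K) * C1) ((x0\<^sup>2 + (1 + K * x0)) * ?B (K * x0))"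
    have C1': "0 \<le> C1" by (simp add: C1_def)
    have C2: "0 \<le> C2" "C1 \<le> C2" "(1 + K) * C1 \<le> C2" "(x0\<^sup>2 + (1 + K * x0)) * ?B (K * x0) \<le> C2"
    proof -
      show "(1 + K) * C1 \<le> C2" "(x0\<^sup>2 + (1 + K * x0)) * ?B (K * x0) \<le> C2" by (auto simp: C2_def)
      have "1 * C1 \<le> (1 + K) * C1" using K C1' by (intro mult_right_mono) auto
      then show "C1 \<le> C2" by (simp add: C2_def)
      then show "0 \<le> C2" using C1' by simp
    qed
    have "x\<^sup>2 * ?B (K * x) \<le> C2 * (1 + x ^ 3 * a x) \<and> (1 + K * x) * ?B (K * x) \<le> C2 * (1 + x\<^sup>2 * a x)"
      if x: "0 \<le> x" for x
    proof (cases "x0 \<le> x")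
      case True
      have ax: "0 \<le> a x" using a_nonneg x by simp
      have "x\<^sup>2 * ?B (K * x) \<le> x\<^sup>2 * (C1 * (x * a x))" using C1[OF True] by (intro mult_left_mono) auto
      also have "\<dots> = C1 * (x ^ 3 * a x)" by (simp add: power2_eq_square power3_eq_cube)
      also have "\<dots> \<le> C2 * (1 + x ^ 3 * a x)" using C2 ax x by (intro mult_mono) auto
      finally have 1: "x\<^sup>2 * ?B (K * x) \<le> C2 * (1 + x ^ 3 * a x)" .
      have "(1 + K * x) * ?B (K * x) \<le> ((1 + K) * x) * (C1 * (x * a x))"
        using C1[OF True] K x True x0 B0 by (intro mult_mono) (auto simp: algebra_simps)
      also have "\<dots> = ((1 + K) * C1) * (x\<^sup>2 * a x)" by (simp add: power2_eq_square)
      also have "\<dots> \<le> C2 * (1 + x\<^sup>2 * a x)" using C2 C1' ax by (intro mult_mono) auto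
      finally show ?thesis using 1 by simp
    next
      case False
      have ax: "0 \<le> a x" using a_nonneg x by simp
      have le: "?B (K * x) \<le> ?B (K * x0)" using False K by (intro mono mult_left_mono) auto
      have "x\<^sup>2 * ?B (K * x) \<le> (x0\<^sup>2 + (1 + K * x0)) * ?B (K * x0)"
      proof (rule mult_mono[OF _ le])
        have "x\<^sup>2 \<le> x0\<^sup>2" using False x by (intro power_mono) auto
        moreover have "0 \<le> K * x0" using K x0 by simp
        ultimately show "x\<^sup>2 \<le> x0\<^sup>2 + (1 + K * x0)" by simp
        show "0 \<le> x0\<^sup>2 + (1 + K * x0)" using \<open>0 \<le> K * x0\<close> by simp
      qed (rule B0)
      also have "\<dots> \<le> C2 * 1" using C2 by simp
      also have "\<dots> \<le> C2 * (1 + x ^ 3 * a x)" using C2 ax x by (intro mult_left_mono) auto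
      finally have 1: "x\<^sup>2 * ?B (K * x) \<le> C2 * (1 + x ^ 3 * a x)" .
      have "(1 + K * x) * ?B (K * x) \<le> (x0\<^sup>2 + (1 + K * x0)) * ?B (K * x0)"
      proof (rule mult_mono[OF _ le])
        have "K * x \<le> K * x0" using False K by (intro mult_left_mono) auto
        then show "1 + K * x \<le> x0\<^sup>2 + (1 + K * x0)" by (simp add: add_increasing)
        show "0 \<le> x0\<^sup>2 + (1 + K * x0)" using K x0 by simp
      qed (rule B0)
      also have "\<dots> \<le> C2 * 1" using C2 by simp
      also have "\<dots> \<le> C2 * (1 + x\<^sup>2 * a x)" using C2 ax x by (intro mult_left_mono) auto
      finally show ?thesis using 1 by simp
    qed
    with C2(1) show ?thesis by blast
  qed
  have mom_X: "integrable Q (\<lambda>\<zeta>. (l \<zeta>)\<^sup>2 * ?B (K * l \<zeta>))" if K: "1 \<le> K" for K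
  proof -
    obtain C where C: "0 \<le> C" and le: "\<And>x. 0 \<le> x \<Longrightarrow> x\<^sup>2 * ?B (K * x) \<le> C * (1 + x ^ 3 * a x)"
      using B_le[OF K] by blast
    show ?thesis
    proof (rule Bochner_Integration.integrable_bound)
      show "integrable Q (\<lambda>\<zeta>. C * (1 + l \<zeta> ^ 3 * a (l \<zeta>)))"
        using log_Z_a by (simp add: l_eq)
      show "AE \<zeta> in Q. norm ((l \<zeta>)\<^sup>2 * ?B (K * l \<zeta>)) \<le> norm (C * (1 + l \<zeta> ^ 3 * a (l \<zeta>)))"
      proof (rule AE_I2)
        fix \<zeta>
        have "0 \<le> l \<zeta>" by (simp add: l_def)
        then show "norm ((l \<zeta>)\<^sup>2 * ?B (K * l \<zeta>)) \<le> norm (C * (1 + l \<zeta> ^ 3 * a (l \<zeta>)))"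
          using le[of "l \<zeta>"] mult_nonneg_nonneg[OF zero_le_power2[of "l \<zeta>"] B0[of "K * l \<zeta>"]]
          unfolding real_norm_def by linarith
      qed
    qed measurable
  qed
  have "AE \<omega> in P. (\<Sum>n. ennreal (?B n) * ennreal \<bar>T.level_total (Suc n) \<omega> - T.level_total n \<omega>\<bar>) < \<infinity>"
  proof (rule T.suminf_increments[OF _ _ _ mono B0 poly])
    show "integrable Q X" "Q.expectation X < 0" using log_Z by (auto simp: X_def[abs_def])
    \<comment> \<open>\<open>partial_sum\<close> is at least 1, so the weighted moment with K = 1
      dominates the plain second moment.\<close>
    show "integrable Q (\<lambda>\<zeta>. (max (X \<zeta>) 0)\<^sup>2)"
    proof (rule Bochner_Integration.integrable_bound[OF mom_X[of 1]])
      show "AE \<zeta> in Q. norm ((max (X \<zeta>) 0)\<^sup>2) \<le> norm ((l \<zeta>)\<^sup>2 * ?B (1 * l \<zeta>))"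
      proof (rule AE_I2)
        fix \<zeta>
        have "(l \<zeta>)\<^sup>2 * 1 \<le> (l \<zeta>)\<^sup>2 * ?B (l \<zeta>)" by (intro mult_left_mono B1) simp
        then show "norm ((max (X \<zeta>) 0)\<^sup>2) \<le> norm ((l \<zeta>)\<^sup>2 * ?B (1 * l \<zeta>))"
          using B0[of "l \<zeta>"] by (simp add: l_def abs_mult)
      qed
    qed simp_all
  next
    fix K :: real assume K: "1 \<le> K"
    show "(\<integral>\<^sup>+\<zeta>. ennreal ((max (X \<zeta>) 0)\<^sup>2 * ?B (K * max (X \<zeta>) 0)) \<partial>Q) < \<infinity>"
      using mom_X[OF K] B0 by (simp add: nn_integral_eq_integral l_def)
    obtain C where C: "0 \<le> C" and le: "\<And>x. 0 \<le> x \<Longrightarrow> (1 + K * x) * ?B (K * x) \<le> C * (1 + x\<^sup>2 * a x)"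
      using B_le[OF K] by blast
    let ?t = "\<lambda>\<omega>. T.total (N [] \<omega>)"
    \<comment> \<open>This pays for the summand 1 in the bound by 1 + x^2 a(x) below.\<close>
    have fin1: "(\<integral>\<^sup>+\<omega>. ennreal (?t \<omega>) \<partial>P) < \<infinity>" by (simp add: T.nn_integral_total)
    have "(\<integral>\<^sup>+\<omega>. ennreal (?t \<omega> * (ln_plus (?t \<omega>))\<^sup>2 * a (ln_plus (?t \<omega>))) \<partial>P) =
        (\<integral>\<^sup>+\<omega>. ennreal (norm (brw_W P N \<gamma> 1 \<omega> * ln_plus (brw_W P N \<gamma> 1 \<omega>) ^ 2 * a (ln_plus (brw_W P N \<gamma> 1 \<omega>)))) \<partial>P)"
    proof (rule nn_integral_cong_AE)
      show "AE \<omega> in P. ennreal (?t \<omega> * (ln_plus (?t \<omega>))\<^sup>2 * a (ln_plus (?t \<omega>))) =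
          ennreal (norm (brw_W P N \<gamma> 1 \<omega> * ln_plus (brw_W P N \<gamma> 1 \<omega>) ^ 2 * a (ln_plus (brw_W P N \<gamma> 1 \<omega>))))"
        using level1
      proof eventually_elim
        case (elim \<omega>)
        have "0 \<le> a (ln_plus (?t \<omega>))" by (rule a_nonneg) (simp add: ln_plus_def)
        then show ?case unfolding elim by (simp add: abs_mult)
      qed
    qed
    also have "\<dots> < \<infinity>" using W1_a by (simp add: integrable_iff_bounded)
    finally have fin2: "(\<integral>\<^sup>+\<omega>. ennreal (?t \<omega> * (ln_plus (?t \<omega>))\<^sup>2 * a (ln_plus (?t \<omega>))) \<partial>P) < \<infinity>" .
    have [measurable]: "(\<lambda>\<omega>. ennreal (?t \<omega> * (ln_plus (?t \<omega>))\<^sup>2 * a (ln_plus (?t \<omega>)))) \<in> borel_measurable P"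
    proof -
      \<comment> \<open>Regular variation provides measurability of a on the half-line only, and
        \<open>ln_plus\<close> takes its values there.\<close>
      have "ln_plus \<in> borel \<rightarrow>\<^sub>M restrict_space borel {0..}"
        by (rule measurable_restrict_space2) (auto simp: ln_plus_def[abs_def])
      then have [measurable]: "(\<lambda>x. a (ln_plus x)) \<in> borel_measurable borel"
        using a_rv by (auto simp: regularly_varying_def intro: measurable_compose)
      have [measurable]: "ln_plus \<in> borel_measurable borel" unfolding ln_plus_def by measurable
      show ?thesis by measurable
    qed
    have "(\<integral>\<^sup>+\<omega>. ennreal (?t \<omega> * ((1 + K * ln_plus (?t \<omega>)) * ?B (K * ln_plus (?t \<omega>)))) \<partial>P) \<le>
      (\<integral>\<^sup>+\<omega>. ennreal C * (ennreal (?t \<omega>) + ennreal (?t \<omega> * (ln_plus (?t \<omega>))\<^sup>2 * a (ln_plus (?t \<omega>)))) \<partial>P)"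
    proof (rule nn_integral_mono)
      fix \<omega>
      have l0: "0 \<le> ln_plus (?t \<omega>)" by (simp add: ln_plus_def)
      have "?t \<omega> * ((1 + K * ln_plus (?t \<omega>)) * ?B (K * ln_plus (?t \<omega>))) \<le>
          ?t \<omega> * (C * (1 + (ln_plus (?t \<omega>))\<^sup>2 * a (ln_plus (?t \<omega>))))"
        by (intro mult_left_mono le l0) simp
      also have "\<dots> = C * (?t \<omega> + ?t \<omega> * (ln_plus (?t \<omega>))\<^sup>2 * a (ln_plus (?t \<omega>)))"
        by (simp add: algebra_simps)
      finally have "ennreal (?t \<omega> * ((1 + K * ln_plus (?t \<omega>)) * ?B (K * ln_plus (?t \<omega>)))) \<le>
          ennreal (C * (?t \<omega> + ?t \<omega> * (ln_plus (?t \<omega>))\<^sup>2 * a (ln_plus (?t \<omega>))))" by (rule ennreal_leI)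
      also have "\<dots> = ennreal C * (ennreal (?t \<omega>) + ennreal (?t \<omega> * (ln_plus (?t \<omega>))\<^sup>2 * a (ln_plus (?t \<omega>))))"
        using C a_nonneg[OF l0] by (simp add: ennreal_mult)
      finally show "ennreal (?t \<omega> * ((1 + K * ln_plus (?t \<omega>)) * ?B (K * ln_plus (?t \<omega>)))) \<le>
          ennreal C * (ennreal (?t \<omega>) + ennreal (?t \<omega> * (ln_plus (?t \<omega>))\<^sup>2 * a (ln_plus (?t \<omega>))))" .
    qed
    also have "\<dots> = ennreal C * ((\<integral>\<^sup>+\<omega>. ennreal (?t \<omega>) \<partial>P) +
        (\<integral>\<^sup>+\<omega>. ennreal (?t \<omega> * (ln_plus (?t \<omega>))\<^sup>2 * a (ln_plus (?t \<omega>))) \<partial>P))"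
      by (subst nn_integral_cmult) (auto simp: nn_integral_add)
    also have "\<dots> < \<infinity>" using fin1 fin2 by (simp add: ennreal_mult_less_top)
    finally show "(\<integral>\<^sup>+\<omega>. ennreal (?t \<omega> * ((1 + K * ln_plus (?t \<omega>)) * ?B (K * ln_plus (?t \<omega>)))) \<partial>P) < \<infinity>" .
  qed
  then show ?thesis
    using W(2) level
  proof eventually_elim
    case (elim \<omega>)
    show ?case
    proof (rule summable_weighted_remainders)
      show "0 \<le> a (real n)" for n by (rule a_nonneg) simp
      show "(\<Sum>k\<le>n. a (real k)) \<le> ?B (real n)" for n by (simp add: partial_sum_def)
      show "(\<lambda>n. brw_W P N \<gamma> n \<omega>) \<longlonglongrightarrow> W \<omega>" by (rule elim(2))
      show "(\<Sum>n. ennreal (?B (real n)) * ennreal \<bar>brw_W P N \<gamma> (Suc n) \<omega> - brw_W P N \<gamma> n \<omega>\<bar>) < \<infinity>"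
        using elim(1,3) by simp
    qed
  qed
qed

end
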